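(* Let $G$ be a simply connected, $2$-step nilpotent Lie group equipped with a sub-Riemannian metric $d$. Denote by $d_\infty$ the canonical asymptotic metric of $(G,d)$. Then the horoboundary of $(G,d)$ coincides with the horoboundary of $(G,d_\infty)$.
   Context: Let $G$ be a connected Lie group with identity $e$ and Lie algebra $\mathfrak g=T_eG$; $L_p$ denotes left translation by $p$. The group is $2$-step nilpotent if its nilpotency step is $2$, i.e. $[\mathfrak g,[\mathfrak g,\mathfrak g]]=0$ and $[\mathfrak g,\mathfrak g]\neq 0$. A sub-Riemannian structure $(\Delta,\rho)$ on $G$ consists of a left-invariant subbundle $\Delta\subseteq TG$ that is bracket-generating (the Lie algebra generated by $\Delta_e$ is $\mathfrak g$) and a left-invariant metric tensor $\rho$ on $\Delta$. The case $\Delta=TG$ (Riemannian) is included. An absolutely continuous curve $\gamma:[0,1]\to G$ is $\Delta$-horizontal if $\dot\gamma(t)\in\Delta_{\gamma(t)}$ for a.e. $t$; its length is $\ell(\gamma)=\int_0^1\sqrt{\rho(\dot\gamma(t),\dot\gamma(t))}\,dt$. The associated (left-invariant) sub-Riemannian metric is $d(p,q)=\inf\{\ell(\gamma): \gamma \text{ is } \Delta\text{-horizontal},\ p,q\in\gamma([0,1])\}$. Canonical asymptotic metric: given $(\Delta,\rho)$ with metric $d$, let $V=\{v\in\Delta_e: \rho(v,w)=0 \text{ for every } w\in\Delta_e\cap[\mathfrak g,\mathfrak g]\}$ and $\Delta_\infty=\bigcup_{p\in G}dL_p(V)\subseteq\Delta$. Then $d_\infty(p,q)=\inf\{\ell(\gamma):\gamma:[0,1]\to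 G\text{ is }\Delta_\infty\text{-horizontal},\ p,q\in\gamma([0,1])\}$. Horoboundary: for a (proper, geodesic) metric $\delta$ on $G$ inducing the manifold topology, let $\iota_\delta:G\to C(G)$, $\iota_\delta(x)=\delta(x,\cdot)-\delta(x,e)$, where $C(G)$ is the space of continuous real functions on $G$ with the topology of uniform convergence on compact sets. The horoboundary of $(G,\delta)$ is $\overline{\iota_\delta(G)}\setminus\iota_\delta(G)\subseteq C(G)$. That two horoboundaries coincide means they are equal as subsets of $C(G)$. *)

theory Defs
  imports "HOL-Analysis.Analysis"
begin

section \<open>Smooth maps and Lie groups\<close>

text \<open>\<open>C\<^sup>k\<close> and \<open>C\<^sup>\<infinity>\<close> maps on an open subset of a Euclidean space; the successor step asks that
  every directional derivative \<open>x \<mapsto> Df(x) v\<close> be of class \<open>C\<^sup>k\<close>.\<close>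

primrec C_k_on :: "nat \<Rightarrow> ('a::euclidean_space \<Rightarrow> 'b::euclidean_space) \<Rightarrow> 'a set \<Rightarrow> bool" where
  "C_k_on 0 f S \<longleftrightarrow> continuous_on S f"
| "C_k_on (Suc k) f S \<longleftrightarrow> (\<forall>x\<in>S. f differentiable (at x)) \<and>
     (\<forall>v. C_k_on k (\<lambda>x. frechet_derivative f (at x) v) S)"

definition smooth_on :: "'a::euclidean_space set \<Rightarrow> ('a \<Rightarrow> 'b::euclidean_space) \<Rightarrow> bool" where
  "smooth_on S f \<longleftrightarrow> open S \<and> (\<forall>k. C_k_on k f S)"

text \<open>A chart is a pair \<open>(U, \<phi>)\<close> of a domain and a coordinate map, of which only the values on
  \<open>U\<close> matter.\<close>

type_synonym ('g, 'e) chart = "'g set \<times> ('g \<Rightarrow> 'e)"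

definition chart_inv :: "('g, 'e) chart \<Rightarrow> 'e \<Rightarrow> 'g" where
  "chart_inv c = inv_into (fst c) (snd c)"

definition is_chart :: "('g::topological_space, 'e::euclidean_space) chart \<Rightarrow> bool" where
  "is_chart c \<longleftrightarrow> open (fst c) \<and> open (snd c ` fst c) \<and>
     homeomorphism (fst c) (snd c ` fst c) (snd c) (chart_inv c)"

text \<open>The atlas need not be maximal: any smooth atlas determines the smooth structure.\<close>

definition smooth_atlas :: "('g::topological_space, 'e::euclidean_space) chart set \<Rightarrow> bool" where
  "smooth_atlas A \<longleftrightarrow> (\<forall>c\<in>A. is_chart c) \<and> (\<Union>c\<in>A. fst c) = UNIV \<and>
     (\<forall>c\<in>A. \<forall>c'\<in>A. smooth_on (snd c ` (fst c \<inter> fst c')) (snd c' \<circ> chart_inv c))"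

record ('g, 'e) lie_struct =
  gmul :: "'g \<Rightarrow> 'g \<Rightarrow> 'g"
  gone :: "'g"
  ginv :: "'g \<Rightarrow> 'g"
  atlas :: "('g, 'e) chart set"

definition lie_group ::
  "('g::{t2_space, second_countable_topology}, 'e::euclidean_space) lie_struct \<Rightarrow> bool" where
  "lie_group G \<longleftrightarrow>
     Groups.group (gmul G) (gone G) (ginv G) \<and>
     smooth_atlas (atlas G) \<and>
     continuous_on UNIV (\<lambda>(x, y). gmul G x y) \<and>
     continuous_on UNIV (ginv G) \<and>
     (\<forall>a\<in>atlas G. \<forall>b\<in>atlas G. \<forall>c\<in>atlas G.
        smooth_on {(x, y). x \<in> snd a ` fst a \<and> y \<in> snd b ` fst b \<and>
                           gmul G (chart_inv a x) (chart_inv b y) \<in> fst c}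
                  (\<lambda>(x, y). snd c (gmul G (chart_inv a x) (chart_inv b y)))) \<and>
     (\<forall>a\<in>atlas G. \<forall>c\<in>atlas G.
        smooth_on {x \<in> snd a ` fst a. ginv G (chart_inv a x) \<in> fst c}
                  (\<lambda>x. snd c (ginv G (chart_inv a x))))"

section \<open>The Lie algebra\<close>

text \<open>In everything that follows \<open>c\<^sub>0\<close> is a chart around the identity, used to identify the tangent
  space \<open>\<gg> = T\<^sub>eG\<close> with the model space \<^typ>\<open>'e\<close>. A tangent vector at a point \<open>p\<close> is given by its
  coordinates in a chart \<open>c\<close> around \<open>p\<close>, and \<open>left_diff G c\<^sub>0 c p\<close> is the differential \<open>dL\<^sub>p\<close> at the
  identity of the left translation by \<open>p\<close>, with respect to \<open>c\<^sub>0\<close> and \<open>c\<close>.\<close>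

definition left_diff ::
  "('g::topological_space, 'e::euclidean_space) lie_struct \<Rightarrow> ('g, 'e) chart \<Rightarrow> ('g, 'e) chart \<Rightarrow>
   'g \<Rightarrow> 'e \<Rightarrow> 'e" where
  "left_diff G c\<^sub>0 c p =
     frechet_derivative (\<lambda>x. snd c (gmul G p (chart_inv c\<^sub>0 x))) (at (snd c\<^sub>0 (gone G)))"

text \<open>The left-invariant vector field with value \<open>v\<close> at the identity, in the coordinates \<open>c\<^sub>0\<close>.\<close>

definition left_inv_field ::
  "('g::topological_space, 'e::euclidean_space) lie_struct \<Rightarrow> ('g, 'e) chart \<Rightarrow> 'e \<Rightarrow> 'e \<Rightarrow> 'e" where
  "left_inv_field G c\<^sub>0 v x = left_diff G c\<^sub>0 c\<^sub>0 (chart_inv c\<^sub>0 x) v"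

text \<open>\<open>[v, w] = [X\<^sub>v, X\<^sub>w](e)\<close>, with the coordinate formula \<open>[X, Y] = DY(X) - DX(Y)\<close> for the
  commutator of vector fields.\<close>

definition lie_bracket ::
  "('g::topological_space, 'e::euclidean_space) lie_struct \<Rightarrow> ('g, 'e) chart \<Rightarrow> 'e \<Rightarrow> 'e \<Rightarrow> 'e" where
  "lie_bracket G c\<^sub>0 v w =
     (let X = left_inv_field G c\<^sub>0 v; Y = left_inv_field G c\<^sub>0 w; x\<^sub>0 = snd c\<^sub>0 (gone G)
      in frechet_derivative Y (at x\<^sub>0) (X x\<^sub>0) - frechet_derivative X (at x\<^sub>0) (Y x\<^sub>0))"

definition bracket_space ::
  "('g::topological_space, 'e::euclidean_space) lie_struct \<Rightarrow> ('g, 'e) chart \<Rightarrow>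
   'e set \<Rightarrow> 'e set \<Rightarrow> 'e set" where
  "bracket_space G c\<^sub>0 A B = span {lie_bracket G c\<^sub>0 a b | a b. a \<in> A \<and> b \<in> B}"

definition two_step_nilpotent ::
  "('g::topological_space, 'e::euclidean_space) lie_struct \<Rightarrow> ('g, 'e) chart \<Rightarrow> bool" where
  "two_step_nilpotent G c\<^sub>0 \<longleftrightarrow>
     bracket_space G c\<^sub>0 UNIV (bracket_space G c\<^sub>0 UNIV UNIV) = {0} \<and>
     bracket_space G c\<^sub>0 UNIV UNIV \<noteq> {0}"

definition lie_subalgebra ::
  "('g::topological_space, 'e::euclidean_space) lie_struct \<Rightarrow> ('g, 'e) chart \<Rightarrow> 'e set \<Rightarrow> bool" where
  "lie_subalgebra G c\<^sub>0 H \<longleftrightarrow> subspace H \<and> (\<forall>u\<in>H. \<forall>v\<in>H. lie_bracket G c\<^sub>0 u v \<in> H)"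

section \<open>Sub-Riemannian structures\<close>

definition inner_product_on :: "'e::real_vector set \<Rightarrow> ('e \<Rightarrow> 'e \<Rightarrow> real) \<Rightarrow> bool" where
  "inner_product_on S \<rho> \<longleftrightarrow>
     (\<forall>u\<in>S. \<forall>v\<in>S. \<rho> u v = \<rho> v u) \<and>
     (\<forall>u\<in>S. \<forall>v\<in>S. \<forall>w\<in>S. \<forall>a b. \<rho> (a *\<^sub>R u + b *\<^sub>R v) w = a * \<rho> u w + b * \<rho> v w) \<and>
     (\<forall>u\<in>S. u \<noteq> 0 \<longrightarrow> \<rho> u u > 0)"

text \<open>A left-invariant subbundle with a left-invariant metric tensor is given by its fibre
  \<open>\<Delta> \<subseteq> \<gg>\<close> at the identity and an inner product \<open>\<rho>\<close> on it: the fibre at \<open>p\<close> is \<open>dL\<^sub>p(\<Delta>)\<close>, and the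
  metric there is \<open>\<rho>\<^sub>p(dL\<^sub>p v, dL\<^sub>p w) = \<rho>(v, w)\<close>. The values of \<open>\<rho>\<close> outside \<open>\<Delta>\<close> play no role.\<close>

definition sub_riemannian_structure ::
  "('g::topological_space, 'e::euclidean_space) lie_struct \<Rightarrow> ('g, 'e) chart \<Rightarrow>
   'e set \<Rightarrow> ('e \<Rightarrow> 'e \<Rightarrow> real) \<Rightarrow> bool" where
  "sub_riemannian_structure G c\<^sub>0 \<Delta> \<rho> \<longleftrightarrow>
     subspace \<Delta> \<and> lie_subalgebra G c\<^sub>0 hull \<Delta> = UNIV \<and> inner_product_on \<Delta> \<rho>"

definition abs_continuous_on :: "real set \<Rightarrow> (real \<Rightarrow> 'e::real_normed_vector) \<Rightarrow> bool" where
  "abs_continuous_on I f \<longleftrightarrow>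
     (\<forall>\<epsilon>>0. \<exists>\<delta>>0. \<forall>(n::nat) u v.
        (\<forall>i<n. u i \<le> v i \<and> {u i..v i} \<subseteq> I) \<and>
        disjoint_family_on (\<lambda>i. {u i<..<v i}) {..<n} \<and>
        (\<Sum>i<n. v i - u i) < \<delta> \<longrightarrow>
        (\<Sum>i<n. norm (f (v i) - f (u i))) < \<epsilon>)"

definition abs_continuous_curve ::
  "('g::topological_space, 'e::euclidean_space) lie_struct \<Rightarrow> (real \<Rightarrow> 'g) \<Rightarrow> bool" where
  "abs_continuous_curve G \<gamma> \<longleftrightarrow> continuous_on {0..1} \<gamma> \<and>
     (\<forall>c\<in>atlas G. \<forall>a b. 0 \<le> a \<and> a \<le> b \<and> b \<le> 1 \<and> \<gamma> ` {a..b} \<subseteq> fst c \<longrightarrow>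
        abs_continuous_on {a..b} (snd c \<circ> \<gamma>))"

text \<open>\<open>\<gamma>\<close> is differentiable at \<open>t\<close> with velocity \<open>dL\<^bsub>\<gamma>(t)\<^esub>(v)\<close>.\<close>

definition has_velocity ::
  "('g::topological_space, 'e::euclidean_space) lie_struct \<Rightarrow> ('g, 'e) chart \<Rightarrow>
   (real \<Rightarrow> 'g) \<Rightarrow> real \<Rightarrow> 'e \<Rightarrow> bool" where
  "has_velocity G c\<^sub>0 \<gamma> t v \<longleftrightarrow>
     (\<forall>c\<in>atlas G. \<gamma> t \<in> fst c \<longrightarrow>
        ((snd c \<circ> \<gamma>) has_vector_derivative left_diff G c\<^sub>0 c (\<gamma> t) v) (at t within {0..1}))"

definition horizontal ::
  "('g::topological_space, 'e::euclidean_space) lie_struct \<Rightarrow> ('g, 'e) chart \<Rightarrow>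
   'e set \<Rightarrow> (real \<Rightarrow> 'g) \<Rightarrow> bool" where
  "horizontal G c\<^sub>0 \<Delta> \<gamma> \<longleftrightarrow> abs_continuous_curve G \<gamma> \<and>
     (AE t in lebesgue. t \<in> {0..1} \<longrightarrow> (\<exists>v\<in>\<Delta>. has_velocity G c\<^sub>0 \<gamma> t v))"

definition curve_length ::
  "('g::topological_space, 'e::euclidean_space) lie_struct \<Rightarrow> ('g, 'e) chart \<Rightarrow>
   ('e \<Rightarrow> 'e \<Rightarrow> real) \<Rightarrow> (real \<Rightarrow> 'g) \<Rightarrow> real" where
  "curve_length G c\<^sub>0 \<rho> \<gamma> =
     integral {0..1} (\<lambda>t. let v = (THE v. has_velocity G c\<^sub>0 \<gamma> t v) in sqrt (\<rho> v v))"

definition sub_riemannian_dist ::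
  "('g::topological_space, 'e::euclidean_space) lie_struct \<Rightarrow> ('g, 'e) chart \<Rightarrow>
   'e set \<Rightarrow> ('e \<Rightarrow> 'e \<Rightarrow> real) \<Rightarrow> 'g \<Rightarrow> 'g \<Rightarrow> real" where
  "sub_riemannian_dist G c\<^sub>0 \<Delta> \<rho> p q =
     Inf {curve_length G c\<^sub>0 \<rho> \<gamma> | \<gamma>.
            horizontal G c\<^sub>0 \<Delta> \<gamma> \<and> p \<in> \<gamma> ` {0..1} \<and> q \<in> \<gamma> ` {0..1}}"

text \<open>The fibre at the identity of \<open>\<Delta>\<^sub>\<infinity>\<close>.\<close>

definition asymptotic_fibre ::
  "('g::topological_space, 'e::euclidean_space) lie_struct \<Rightarrow> ('g, 'e) chart \<Rightarrow>
   'e set \<Rightarrow> ('e \<Rightarrow> 'e \<Rightarrow> real) \<Rightarrow> 'e set" where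
  "asymptotic_fibre G c\<^sub>0 \<Delta> \<rho> =
     {v \<in> \<Delta>. \<forall>w \<in> \<Delta> \<inter> bracket_space G c\<^sub>0 UNIV UNIV. \<rho> v w = 0}"

definition asymptotic_dist ::
  "('g::topological_space, 'e::euclidean_space) lie_struct \<Rightarrow> ('g, 'e) chart \<Rightarrow>
   'e set \<Rightarrow> ('e \<Rightarrow> 'e \<Rightarrow> real) \<Rightarrow> 'g \<Rightarrow> 'g \<Rightarrow> real" where
  "asymptotic_dist G c\<^sub>0 \<Delta> \<rho> = sub_riemannian_dist G c\<^sub>0 (asymptotic_fibre G c\<^sub>0 \<Delta> \<rho>) \<rho>"

section \<open>The horoboundary\<close>

text \<open>The topology of uniform convergence on compact sets on the set of continuous real-valued
  functions.\<close>

definition compact_convergence :: "('g::topological_space \<Rightarrow> real) topology" where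
  "compact_convergence = topology_generated_by
     {{g. continuous_on UNIV g \<and> (\<forall>y\<in>K. \<bar>g y - f y\<bar> < \<epsilon>)} | f K \<epsilon>.
        continuous_on UNIV f \<and> compact K \<and> \<epsilon> > 0}"

definition horo_embedding :: "'g \<Rightarrow> ('g \<Rightarrow> 'g \<Rightarrow> real) \<Rightarrow> 'g \<Rightarrow> 'g \<Rightarrow> real" where
  "horo_embedding o\<^sub>0 d x = (\<lambda>y. d x y - d x o\<^sub>0)"

definition horoboundary :: "'g::topological_space \<Rightarrow> ('g \<Rightarrow> 'g \<Rightarrow> real) \<Rightarrow> ('g \<Rightarrow> real) set" where
  "horoboundary o\<^sub>0 d =
     compact_convergence closure_of (range (horo_embedding o\<^sub>0 d)) - range (horo_embedding o\<^sub>0 d)"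

end

theory Submission
  imports Defs
begin

text \<open>A horofunction only sees the distance far away from the base point. If two distances satisfy
\<open>\<bar>d\<^sup>2 - d'\<^sup>2\<bar> \<le> C\<close>, then \<open>\<bar>d - d'\<bar> \<le> C / (d + d')\<close> tends to \<open>0\<close> at infinity, so that \<open>d\<close> and
\<open>d'\<close> have the same limits of \<open>d x y - d x e\<close> as \<open>x\<close> goes to infinity; for proper length distances
these limits are exactly the horofunctions (\<open>horoboundary_eq\<close>). The theorem therefore follows
from a bound on the difference of the squares of the two distances.

The estimate is made in exponential coordinates. On the Lie algebra the group law is the polynomial
\<open>x \<odot> y = x + y + 1/2 [x, y]\<close>. A logarithm is found by integrating the Maurer-Cartan form in a chart:
the equation \<open>d\<theta> = - 1/2 [\<theta>, \<theta>]\<close> (\<open>Maurer_Cartan\<close>) makes first \<open>\<theta>\<close> modulo \<open>[\<gg>, \<gg>]\<close> and then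
\<open>\<theta> + 1/2 [x, \<theta>]\<close> a closed form. Its local inverse extends by powers to a homomorphism \<open>\<Phi>\<close> of the
Lie algebra onto the group (\<open>exponential_exists\<close>). The product of a list of vectors of a fibre \<open>W\<close>
is the endpoint of a \<open>W\<close>-horizontal polygon, and the sub-Riemannian distance of \<open>W\<close> is the infimum
of the lengths of such polygons (\<open>sub_riemannian_dist_eq\<close>).

Let \<open>V\<close> be the asymptotic fibre and \<open>Z = [\<gg>, \<gg>]\<close>. A polygon in \<open>\<Delta>\<close> projects to a polygon in \<open>V\<close>
whose endpoint differs from the old one by some \<open>w \<in> \<Delta> \<inter> Z\<close>, and Minkowski's inequality gives
\<open>l\<^sub>V\<^sup>2 + \<rho>(w, w) \<le> l\<^sup>2\<close> for the lengths (\<open>\<Delta>_polygon_decomposition\<close>). The point is that a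
central displacement \<open>w\<close> can be produced inside \<open>V\<close> at a cost that is linear in \<open>w\<close> for the square
of the length: \<open>l'\<^sup>2 \<le> l\<^sub>V\<^sup>2 + C \<bar>w\<bar>\<close> (\<open>center_correction\<close>). Since \<open>C \<bar>w\<bar> - \<rho>(w, w)\<close> is
bounded, the squares of the two distances differ by a bounded amount.

For the linear cost, cut the polygon into finitely many blocks and add to the \<open>m\<close>-th block the
velocities \<open>a, b, - a, - b\<close>, each on a quarter of the block, multiplied by \<open>\<alpha>\<^sub>m\<close>. This changes the
endpoint by \<open>\<alpha>\<^sub>m\<^sup>2 [a, b]\<close> times a constant plus a term that is linear in \<open>\<alpha>\<^sub>m\<close> and central, and
the energy by a multiple of \<open>\<alpha>\<^sub>m\<^sup>2\<close> plus a linear term. As there are more blocks than linear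
conditions, a nonzero \<open>\<alpha>\<close> annihilates all the linear terms, and what remains is a displacement and
an energy that are both proportional to \<open>\<Sum>\<^sub>m \<alpha>\<^sub>m\<^sup>2\<close>.\<close>

section \<open>The group law on a two-step nilpotent Lie algebra\<close>

locale two_step_bracket =
  fixes br :: "'e::euclidean_space \<Rightarrow> 'e \<Rightarrow> 'e"
  assumes bilinear: "bounded_bilinear br"
    and alt: "br x x = 0"
    and nil: "br x (br y z) = 0"
begin

sublocale br: bounded_bilinear br by (rule bilinear)

lemma skew: "br y x = - br x y"
proof -
  have "br (x + y) (x + y) = br x (x + y) + br y (x + y)" by (rule br.add_left)
  also have "\<dots> = br x x + br x y + (br y x + br y y)" by (simp only: br.add_right)
  finally have "br y x + br x y = 0" by (simp add: alt add.commute)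
  then show ?thesis by (simp add: eq_neg_iff_add_eq_0)
qed

lemma nil_left: "br (br y z) x = 0"
  using nil[of x y z] skew[of "br y z" x] by simp

text \<open>The Baker-Campbell-Hausdorff product, whose series stops after the first bracket.\<close>

definition bch :: "'e \<Rightarrow> 'e \<Rightarrow> 'e" (infixl "\<odot>" 70) where
  "x \<odot> y = x + y + (1/2) *\<^sub>R br x y"

lemmas br_simps = br.add_left br.add_right br.diff_left br.diff_right br.minus_left br.minus_right
  br.scaleR_left br.scaleR_right br.zero_left br.zero_right nil nil_left alt

lemma bch_assoc: "(x \<odot> y) \<odot> z = x \<odot> (y \<odot> z)"
  by (simp add: bch_def br_simps algebra_simps)

lemma bch_zero [simp]: "0 \<odot> x = x" "x \<odot> 0 = x"
  by (simp_all add: bch_def br_simps)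

lemma bch_minus [simp]: "- x \<odot> x = 0" "x \<odot> - x = 0"
  by (simp_all add: bch_def br_simps)

lemma bch_cancel [simp]: "- x \<odot> (x \<odot> y) = y" "x \<odot> (- x \<odot> y) = y"
  by (simp_all flip: bch_assoc)

lemma minus_bch: "- (x \<odot> y) = - y \<odot> - x"
  by (simp add: bch_def br_simps skew[of y x])

lemma bch_scaleR: "(s *\<^sub>R x) \<odot> (t *\<^sub>R x) = (s + t) *\<^sub>R x"
  by (simp add: bch_def br_simps algebra_simps)

text \<open>The derived algebra \<open>[\<gg>, \<gg>]\<close>, which is central because the nilpotency step is two.\<close>

definition Z :: "'e set" where "Z = span {br a b | a b. True}"

lemma Z_subspace: "subspace Z" unfolding Z_def by simp

lemma br_in_Z: "br a b \<in> Z" unfolding Z_def by (rule span_base) auto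

lemma Z_central: assumes "z \<in> Z" shows "br z x = 0" "br x z = 0"
proof -
  show "br z x = 0" using assms unfolding Z_def
    by (induction rule: span_induct_alt) (auto simp: br_simps)
  then show "br x z = 0" using skew[of x z] by (simp)
qed

lemma bch_Z: assumes "z \<in> Z" shows "(x + z) \<odot> y = (x \<odot> y) + z" "x \<odot> (y + z) = (x \<odot> y) + z"
  "x \<odot> z = x + z" "z \<odot> x = x + z"
  by (simp_all add: bch_def br_simps Z_central[OF assms])

text \<open>The endpoint of the polygon whose successive edges are the one-parameter segments given by the
vectors of the list.\<close>

primrec lprod :: "'e list \<Rightarrow> 'e" where
  "lprod [] = 0"
| "lprod (x # xs) = x \<odot> lprod xs"

lemma lprod_append: "lprod (xs @ ys) = lprod xs \<odot> lprod ys"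
  by (induction xs) (simp_all add: bch_assoc)

lemma lprod_replicate: "lprod (replicate n x) = real n *\<^sub>R x"
proof (induction n)
  case (Suc n)
  have "x \<odot> real n *\<^sub>R x = (1 + real n) *\<^sub>R x" using bch_scaleR[of 1 x "real n"] by simp
  then show ?case using Suc by simp
qed simp

lemma lprod_rev_uminus: "lprod (rev (map uminus xs)) = - lprod xs"
  by (induction xs) (simp_all add: lprod_append minus_bch)

text \<open>Adding the same vector to all edges changes the endpoint, up to the factor \<open>n \<alpha> a\<close>, only by
brackets \<open>[x\<^sub>i, \<alpha> a]\<close>; there is no quadratic term since \<open>[a, a] = 0\<close>.\<close>

lemma lprod_shift:
  "\<exists>\<zeta>\<in>Z. \<forall>\<alpha>. lprod (map (\<lambda>x. x + \<alpha> *\<^sub>R a) xs) = (lprod xs \<odot> ((\<alpha> * real (length xs)) *\<^sub>R a)) + \<alpha> *\<^sub>R \<zeta>"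
proof (induction xs)
  case Nil
  show ?case by (auto intro!: bexI[of _ 0] simp: subspace_0[OF Z_subspace])
next
  case (Cons x xs)
  then obtain \<zeta> where z: "\<zeta> \<in> Z" and
    e: "\<And>\<alpha>. lprod (map (\<lambda>x. x + \<alpha> *\<^sub>R a) xs) = (lprod xs \<odot> ((\<alpha> * real (length xs)) *\<^sub>R a)) + \<alpha> *\<^sub>R \<zeta>"
    by blast
  let ?p = "lprod xs"
  define \<eta> where "\<eta> = \<zeta> + (br a ?p + (1/2) *\<^sub>R br a x)"
  have "\<eta> \<in> Z" unfolding \<eta>_def using z br_in_Z Z_subspace by (simp add: subspace_add subspace_scale)
  moreover have "lprod (map (\<lambda>x. x + \<alpha> *\<^sub>R a) (x # xs)) =
     (lprod (x # xs) \<odot> ((\<alpha> * real (length (x # xs))) *\<^sub>R a)) + \<alpha> *\<^sub>R \<eta>" for \<alpha>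
  proof -
    have zz: "\<alpha> *\<^sub>R \<zeta> \<in> Z" using z Z_subspace by (simp add: subspace_scale)
    show ?thesis
      apply (simp add: e bch_Z[OF zz] \<eta>_def)
      apply (simp add: bch_def br_simps skew[of a ?p] skew[of a x] algebra_simps)
      apply (simp flip: scaleR_add_left)
      done
  qed
  ultimately show ?case by blast
qed

end

section \<open>Polygons and the cost of a displacement along a bracket\<close>

lemma nontrivial_relation:
  fixes w :: "nat \<Rightarrow> 'v::euclidean_space"
  assumes "DIM('v) < M"
  obtains \<alpha> i where "i < M" "\<alpha> i \<noteq> 0" "(\<Sum>j<M. \<alpha> j *\<^sub>R w j) = 0"
proof (cases "inj_on w {..<M}")
  case True
  have "card (w ` {..<M}) = M" using True by (simp add: card_image)
  then have "dependent (w ` {..<M})" using assms by (intro dependent_biggerset) auto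
  then obtain u v where "v \<in> w ` {..<M}" "u v \<noteq> 0" "(\<Sum>v\<in>w ` {..<M}. u v *\<^sub>R v) = 0"
    by (subst (asm) dependent_finite) auto
  moreover then obtain i where "i < M" "v = w i" by auto
  ultimately show ?thesis
    using that[of i "u \<circ> w"] by (simp add: sum.reindex[OF True])
next
  case False
  then obtain i j where ij: "i < M" "j < M" "i \<noteq> j" "w i = w j" by (auto simp: inj_on_def)
  let ?a = "\<lambda>k. if k = i then 1 else if k = j then -1 else (0::real)"
  have "(\<Sum>k<M. ?a k *\<^sub>R w k) = (\<Sum>k\<in>{i,j}. ?a k *\<^sub>R w k)"
    using ij by (intro sum.mono_neutral_right) auto
  also have "\<dots> = 0" using ij by simp
  finally show ?thesis using that[of i ?a] ij by simp
qed

text \<open>The infinitesimal data. The metric of the fibre \<open>\<Delta>\<close> is the restriction of a positive semidefinite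
form \<open>r\<close> on the whole algebra, which makes \<open>r\<close> bilinear and continuous without reference to \<open>\<Delta>\<close>;
\<open>decomp\<close> is the bracket-generating condition in step two.\<close>

locale sub_riem_model = two_step_bracket br
  for br :: "'e::euclidean_space \<Rightarrow> 'e \<Rightarrow> 'e" +
  fixes r :: "'e \<Rightarrow> 'e \<Rightarrow> real" and \<Delta> :: "'e set"
  assumes r_bilinear: "bounded_bilinear r"
    and r_sym: "r x y = r y x"
    and r_nonneg: "0 \<le> r x x"
    and \<Delta>_subspace: "subspace \<Delta>"
    and r_pos: "x \<in> \<Delta> \<Longrightarrow> x \<noteq> 0 \<Longrightarrow> 0 < r x x"
    and decomp: "\<exists>u\<in>\<Delta>. \<exists>z\<in>Z. x = u + z"
begin

sublocale r: bounded_bilinear r by (rule r_bilinear)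

lemmas r_simps = r.add_left r.add_right r.diff_left r.diff_right r.minus_left r.minus_right
  r.scaleR_left r.scaleR_right r.zero_left r.zero_right

lemma r_Cauchy_Schwarz: "(r x y)\<^sup>2 \<le> r x x * r y y"
proof (cases "r y y = 0")
  case True
  have q: "0 \<le> r x x + 2 * t * r x y" for t
    using r_nonneg[of "x + t *\<^sub>R y"] by (simp add: r_simps True r_sym[of y x])
  have "r x y = 0"
  proof (rule ccontr)
    assume n: "r x y \<noteq> 0"
    have "r x x + 2 * (- (r x x + 1) / r x y) * r x y = r x x - 2 * (r x x + 1)"
      using n by (simp add: field_simps)
    then show False using q[of "- (r x x + 1) / r x y"] r_nonneg[of x] by simp
  qed
  then show ?thesis using True by simp
next
  case False
  then have p: "r y y > 0" using r_nonneg[of y] by linarith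
  have "0 \<le> r (r y y *\<^sub>R x - r x y *\<^sub>R y) (r y y *\<^sub>R x - r x y *\<^sub>R y)" by (rule r_nonneg)
  also have "\<dots> = r y y * (r y y * r x x - (r x y)\<^sup>2)"
    by (simp add: r_simps r_sym[of y x] power2_eq_square algebra_simps)
  finally show ?thesis using p by (simp add: zero_le_mult_iff algebra_simps)
qed

definition nrm :: "'e \<Rightarrow> real" where "nrm x = sqrt (r x x)"

lemma nrm_nonneg [simp]: "0 \<le> nrm x" by (simp add: nrm_def r_nonneg)
lemma nrm_sq: "(nrm x)\<^sup>2 = r x x" by (simp add: nrm_def r_nonneg)
lemma nrm_zero [simp]: "nrm 0 = 0" by (simp add: nrm_def r_simps)
lemma nrm_minus [simp]: "nrm (- x) = nrm x" by (simp add: nrm_def r_simps)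
lemma nrm_scaleR: "nrm (c *\<^sub>R x) = \<bar>c\<bar> * nrm x"
  by (simp add: nrm_def r_simps real_sqrt_mult flip: mult.assoc power2_eq_square)

lemma r_le_nrm: "\<bar>r x y\<bar> \<le> nrm x * nrm y"
  using real_sqrt_le_mono[OF r_Cauchy_Schwarz[of x y]] by (simp add: nrm_def real_sqrt_mult)

lemma nrm_triangle: "nrm (x + y) \<le> nrm x + nrm y"
proof (rule power2_le_imp_le)
  have "(nrm (x + y))\<^sup>2 = r x x + 2 * r x y + r y y"
    by (simp add: nrm_sq r_simps r_sym[of y x])
  also have "\<dots> \<le> (nrm x + nrm y)\<^sup>2"
    using r_le_nrm[of x y] by (simp add: power2_sum nrm_sq)
  finally show "(nrm (x + y))\<^sup>2 \<le> (nrm x + nrm y)\<^sup>2" .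
qed simp

lemma nrm_upper: obtains B where "B > 0" "\<And>x. nrm x \<le> B * norm x"
proof -
  obtain K where K: "K > 0" "\<And>a b. norm (r a b) \<le> norm a * norm b * K"
    using r.pos_bounded by blast
  have "nrm x \<le> sqrt K * norm x" for x
    using real_sqrt_le_mono[OF order_trans[OF abs_ge_self, OF K(2)[of x x, simplified]]]
    by (simp add: nrm_def real_sqrt_mult mult.commute)
  then show ?thesis using that[of "sqrt K"] K by simp
qed

lemma nrm_lower: obtains c where "c > 0" "\<And>x. x \<in> \<Delta> \<Longrightarrow> c * norm x \<le> nrm x"
proof -
  let ?S = "sphere 0 1 \<inter> \<Delta>"
  have comp: "compact ?S" by (intro compact_Int_closed compact_sphere closed_subspace \<Delta>_subspace)
  have cont: "continuous_on ?S nrm"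
    unfolding nrm_def by (intro continuous_intros r.continuous_on)
  obtain c where c: "c > 0" "\<And>x. x \<in> ?S \<Longrightarrow> c \<le> nrm x"
  proof (cases "?S = {}")
    case True then show ?thesis using that[of 1] by simp
  next
    case False
    then obtain x where x: "x \<in> ?S" "\<And>y. y \<in> ?S \<Longrightarrow> nrm x \<le> nrm y"
      using continuous_attains_inf[OF comp _ cont] by blast
    have "nrm x > 0" proof -
      have "x \<noteq> 0" "x \<in> \<Delta>" using x(1) by auto
      then show ?thesis using r_pos[of x] by (simp add: nrm_def)
    qed
    then show ?thesis using that[of "nrm x"] x by blast
  qed
  have "c * norm x \<le> nrm x" if "x \<in> \<Delta>" for x
  proof (cases "x = 0")
    case False
    then have "(1 / norm x) *\<^sub>R x \<in> ?S" using that \<Delta>_subspace by (simp add: subspace_scale)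
    from c(2)[OF this] show ?thesis using False by (simp add: nrm_scaleR field_simps)
  qed simp
  then show ?thesis using that c by blast
qed

definition plen :: "'e list \<Rightarrow> real" where "plen xs = (\<Sum>x\<leftarrow>xs. nrm x)"
text \<open>The energy of the polygon. Unlike the length it is a polynomial in the edges, which allows the
linear and quadratic effects of a perturbation to be separated; \<open>plen_Cauchy_Schwarz\<close> leads back
to the length.\<close>

definition sqlen :: "'e list \<Rightarrow> real" where "sqlen xs = (\<Sum>x\<leftarrow>xs. r x x)"

lemma plen_simps [simp]: "plen [] = 0" "plen (x # xs) = nrm x + plen xs" "plen (xs @ ys) = plen xs + plen ys"
  by (simp_all add: plen_def)
lemma sqlen_simps [simp]: "sqlen [] = 0" "sqlen (x # xs) = r x x + sqlen xs" "sqlen (xs @ ys) = sqlen xs + sqlen ys"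
  by (simp_all add: sqlen_def)
lemma plen_nonneg [simp]: "0 \<le> plen xs" by (induction xs) auto
lemma plen_rev_uminus: "plen (rev (map uminus xs)) = plen xs" by (induction xs) auto

lemma plen_Cauchy_Schwarz: "(plen xs)\<^sup>2 \<le> real (length xs) * sqlen xs"
proof -
  have "plen xs = (\<Sum>i<length xs. 1 * nrm (xs ! i))"
    by (simp add: plen_def sum_list_sum_nth atLeast0LessThan)
  moreover have "sqlen xs = (\<Sum>i<length xs. (nrm (xs ! i))\<^sup>2)"
    by (simp add: sqlen_def sum_list_sum_nth atLeast0LessThan nrm_sq)
  ultimately show ?thesis
    using Cauchy_Schwarz_ineq_sum[of "\<lambda>_. 1" "\<lambda>i. nrm (xs ! i)" "{..<length xs}"] by simp
qed

text \<open>Collinear vectors multiply additively, so an edge may be cut without moving the endpoint. For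
edges of nearly equal length the Cauchy-Schwarz inequality between length and energy is nearly sharp;
zero edges fill up the number of edges to a multiple of \<open>m\<close>.\<close>

lemma uniform_subdivision:
  assumes W: "subspace W" and xs: "xs \<in> lists W" and "\<epsilon> > 0" "m > 0"
  obtains us k \<eta> where "us \<in> lists W" "length us = m * k" "k > 0" "\<eta> > 0" "\<And>u. u \<in> set us \<Longrightarrow> nrm u \<le> \<eta>"
    "real (length us) * \<eta> \<le> plen xs + \<epsilon>" "lprod us = lprod xs"
proof -
  define \<eta> where "\<eta> = \<epsilon> / real (length xs + m)"
  have \<eta>: "\<eta> > 0" using assms by (simp add: \<eta>_def)
  \<comment> \<open>one more than the integer part, so that a zero edge is kept as one edge\<close>
  define q where "q x = Suc (nat \<lfloor>nrm x / \<eta>\<rfloor>)" for x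
  have q1: "nrm x / real (q x) \<le> \<eta>" for x
  proof -
    have "nrm x / \<eta> \<le> real (q x)" unfolding q_def using \<eta> by simp linarith
    then have "nrm x \<le> \<eta> * real (q x)" using \<eta> by (simp add: field_simps)
    then show ?thesis by (simp add: q_def divide_le_eq)
  qed
  have q2: "real (q x) * \<eta> \<le> nrm x + \<eta>" for x
  proof -
    have "real (q x) \<le> nrm x / \<eta> + 1" unfolding q_def using \<eta> by simp
    then show ?thesis using \<eta> by (simp add: field_simps)
  qed
  have q0: "q x \<noteq> 0" for x by (simp add: q_def)
  define vs where "vs = concat (map (\<lambda>x. replicate (q x) ((1 / real (q x)) *\<^sub>R x)) xs)"
  have vsW: "vs \<in> lists W" using xs W unfolding vs_def by (induction xs) (auto simp: subspace_scale)
  have vsn: "nrm u \<le> \<eta>" if "u \<in> set vs" for u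
    using that q1 unfolding vs_def by (auto simp: nrm_scaleR)
  have vsl: "real (length vs) * \<eta> \<le> plen xs + real (length xs) * \<eta>"
    unfolding vs_def
  proof (induction xs)
    case (Cons x xs) then show ?case using q2[of x] by (simp add: algebra_simps)
  qed simp
  have vsp: "lprod vs = lprod xs"
    unfolding vs_def by (induction xs) (auto simp: lprod_append lprod_replicate q0)
  define j where "j = m - length vs mod m"
  have j: "j \<le> m" "j > 0" using \<open>m > 0\<close> by (auto simp: j_def)
  define us where "us = vs @ replicate j 0"
  have "length us = m * (length vs div m + 1)"
    using mod_less_divisor[OF \<open>m > 0\<close>, of "length vs"] minus_mod_eq_mult_div[of "length vs" m]
    unfolding us_def j_def by simp (use mod_less_eq_dividend[of "length vs" m] in linarith)
  moreover have "us \<in> lists W" using vsW W by (auto simp: us_def subspace_0)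
  moreover have "nrm u \<le> \<eta>" if "u \<in> set us" for u using that vsn \<eta> by (auto simp: us_def)
  moreover have "real (length us) * \<eta> \<le> plen xs + \<epsilon>"
  proof -
    have "real (length us) * \<eta> = real (length vs) * \<eta> + real j * \<eta>" by (simp add: us_def algebra_simps)
    also have "\<dots> \<le> plen xs + real (length xs) * \<eta> + real m * \<eta>"
      using vsl j \<eta> by (intro add_mono mult_right_mono) auto
    also have "\<dots> = plen xs + real (length xs + m) * \<eta>" by (simp add: algebra_simps)
    also have "\<dots> = plen xs + \<epsilon>" using assms(4) by (simp add: \<eta>_def)
    finally show ?thesis .
  qed
  moreover have "lprod us = lprod xs" by (simp add: us_def lprod_append lprod_replicate vsp)
  ultimately show ?thesis using that[of us "length vs div m + 1" \<eta>] \<eta> by simp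
qed

lemma sqlen_shift: "sqlen (map (\<lambda>x. x + \<alpha> *\<^sub>R a) xs) =
  sqlen xs + 2 * \<alpha> * r a (sum_list xs) + real (length xs) * \<alpha>\<^sup>2 * r a a"
  by (induction xs) (auto simp: r_simps r_sym algebra_simps power2_eq_square)

lemma quarter_shift:
  assumes "subspace W" "xs \<in> lists W" "a \<in> W"
  obtains \<zeta> \<beta> where "\<zeta> \<in> Z" "\<And>\<alpha>. \<exists>ys\<in>lists W. length ys = length xs \<and>
     lprod ys = (lprod xs \<odot> ((\<alpha> * real (length xs)) *\<^sub>R a)) + \<alpha> *\<^sub>R \<zeta> \<and>
     sqlen ys = sqlen xs + 2 * \<alpha> * \<beta> + real (length xs) * \<alpha>\<^sup>2 * r a a"
proof -
  obtain \<zeta> where z: "\<zeta> \<in> Z" and e: "\<And>\<alpha>. lprod (map (\<lambda>x. x + \<alpha> *\<^sub>R a) xs) =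
      (lprod xs \<odot> ((\<alpha> * real (length xs)) *\<^sub>R a)) + \<alpha> *\<^sub>R \<zeta>"
    using lprod_shift by blast
  have "map (\<lambda>x. x + \<alpha> *\<^sub>R a) xs \<in> lists W" for \<alpha>
    using assms by (auto simp: subspace_add subspace_scale)
  then show ?thesis
    by (intro that[OF z, of "r a (sum_list xs)"] bexI[of _ "map (\<lambda>x. x + _ *\<^sub>R a) xs"])
       (simp_all add: e sqlen_shift)
qed

text \<open>The commutator identity behind the blocks: moving the four factors \<open>s a, s b, - s a, - s b\<close> past the
\<open>p\<^sub>i\<close> costs brackets that are linear in \<open>s\<close>, and their own product is \<open>s\<^sup>2 [a, b]\<close>.\<close>

lemma loop_identity:
  assumes "z1 \<in> Z" "z2 \<in> Z" "z3 \<in> Z" "z4 \<in> Z"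
  shows "((p1 \<odot> (s *\<^sub>R a)) + z1) \<odot> (((p2 \<odot> (s *\<^sub>R b)) + z2) \<odot> (((p3 \<odot> (- s *\<^sub>R a)) + z3) \<odot> ((p4 \<odot> (- s *\<^sub>R b)) + z4))) =
    (p1 \<odot> (p2 \<odot> (p3 \<odot> p4))) + s\<^sup>2 *\<^sub>R br a b + (z1 + z2 + z3 + z4) +
     s *\<^sub>R (br a p2 + br a p3 + br b p3 + br b p4)"
  using skew[of b a] skew[of p2 a] skew[of p3 a] skew[of p4 a] skew[of p3 b] skew[of p4 b]
  by (simp add: bch_def br_simps Z_central[OF assms(1)] Z_central[OF assms(2)] Z_central[OF assms(3)]
      Z_central[OF assms(4)] power2_eq_square algebra_simps)
    (simp flip: scaleR_add_left)

text \<open>The four quarters of a block receive the additional velocities \<open>\<alpha> a, \<alpha> b, - \<alpha> a, - \<alpha> b\<close>. The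
result depends on \<open>\<alpha>\<close> only through a quadratic term and a linear one, whose coefficients \<open>\<zeta>\<close>
and \<open>\<beta>\<close> depend on the polygon but will be made to cancel.\<close>

lemma block_perturbation:
  assumes W: "subspace W" and xs: "xs \<in> lists W" and ab: "a \<in> W" "b \<in> W" and len: "length xs = 4 * k"
    and B: "r a a \<le> B" "r b b \<le> B"
  obtains \<zeta> \<beta> where "\<zeta> \<in> Z" "\<And>\<alpha>. \<exists>ys\<in>lists W. length ys = length xs \<and>
     lprod ys = lprod xs + (\<alpha> * real k)\<^sup>2 *\<^sub>R br a b + \<alpha> *\<^sub>R \<zeta> \<and>
     sqlen ys \<le> sqlen xs + 2 * \<alpha> * \<beta> + real (4 * k) * \<alpha>\<^sup>2 * B"
proof -
  define x1 x2 x3 x4 where "x1 = take k xs" "x2 = take k (drop k xs)" "x3 = take k (drop (2*k) xs)" "x4 = drop (3*k) xs"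
  have xs_eq: "xs = x1 @ x2 @ x3 @ x4"
    using append_take_drop_id[of k "drop k xs"] append_take_drop_id[of k "drop (2 * k) xs"]
    unfolding x1_x2_x3_x4_def by (simp flip: mult_2)
  have l: "length x1 = k" "length x2 = k" "length x3 = k" "length x4 = k"
    using len by (auto simp: x1_x2_x3_x4_def)
  have in_lists: "x1 \<in> lists W" "x2 \<in> lists W" "x3 \<in> lists W" "x4 \<in> lists W"
    using xs by (simp_all add: xs_eq)
  have ab': "- a \<in> W" "- b \<in> W" using ab W by (auto simp: subspace_neg)
  obtain z1 b1 where 1: "z1 \<in> Z" "\<And>\<alpha>. \<exists>ys\<in>lists W. length ys = k \<and>
     lprod ys = (lprod x1 \<odot> ((\<alpha> * real k) *\<^sub>R a)) + \<alpha> *\<^sub>R z1 \<and>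
     sqlen ys = sqlen x1 + 2 * \<alpha> * b1 + real k * \<alpha>\<^sup>2 * r a a"
    using quarter_shift[OF W in_lists(1) ab(1)] unfolding l by blast
  obtain z2 b2 where 2: "z2 \<in> Z" "\<And>\<alpha>. \<exists>ys\<in>lists W. length ys = k \<and>
     lprod ys = (lprod x2 \<odot> ((\<alpha> * real k) *\<^sub>R b)) + \<alpha> *\<^sub>R z2 \<and>
     sqlen ys = sqlen x2 + 2 * \<alpha> * b2 + real k * \<alpha>\<^sup>2 * r b b"
    using quarter_shift[OF W in_lists(2) ab(2)] unfolding l by blast
  obtain z3 b3 where 3: "z3 \<in> Z" "\<And>\<alpha>. \<exists>ys\<in>lists W. length ys = k \<and>
     lprod ys = (lprod x3 \<odot> ((\<alpha> * real k) *\<^sub>R - a)) + \<alpha> *\<^sub>R z3 \<and>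
     sqlen ys = sqlen x3 + 2 * \<alpha> * b3 + real k * \<alpha>\<^sup>2 * r (- a) (- a)"
    using quarter_shift[OF W in_lists(3) ab'(1)] unfolding l by blast
  obtain z4 b4 where 4: "z4 \<in> Z" "\<And>\<alpha>. \<exists>ys\<in>lists W. length ys = k \<and>
     lprod ys = (lprod x4 \<odot> ((\<alpha> * real k) *\<^sub>R - b)) + \<alpha> *\<^sub>R z4 \<and>
     sqlen ys = sqlen x4 + 2 * \<alpha> * b4 + real k * \<alpha>\<^sup>2 * r (- b) (- b)"
    using quarter_shift[OF W in_lists(4) ab'(2)] unfolding l by blast
  define p where "p = br a (lprod x2) + br a (lprod x3) + br b (lprod x3) + br b (lprod x4)"
  define \<zeta> where "\<zeta> = z1 + z2 + z3 + z4 + real k *\<^sub>R p"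
  have "\<zeta> \<in> Z"
    unfolding \<zeta>_def p_def using 1(1) 2(1) 3(1) 4(1) br_in_Z Z_subspace
    by (simp add: subspace_add subspace_scale)
  moreover have "\<exists>ys\<in>lists W. length ys = length xs \<and>
     lprod ys = lprod xs + (\<alpha> * real k)\<^sup>2 *\<^sub>R br a b + \<alpha> *\<^sub>R \<zeta> \<and>
     sqlen ys \<le> sqlen xs + 2 * \<alpha> * (b1 + b2 + b3 + b4) + real (4 * k) * \<alpha>\<^sup>2 * B" for \<alpha>
  proof -
    from 1(2)[of \<alpha>] obtain y1 where y1: "y1 \<in> lists W" "length y1 = k"
       "lprod y1 = (lprod x1 \<odot> ((\<alpha> * real k) *\<^sub>R a)) + \<alpha> *\<^sub>R z1"
       "sqlen y1 = sqlen x1 + 2 * \<alpha> * b1 + real k * \<alpha>\<^sup>2 * r a a" by blast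
    from 2(2)[of \<alpha>] obtain y2 where y2: "y2 \<in> lists W" "length y2 = k"
       "lprod y2 = (lprod x2 \<odot> ((\<alpha> * real k) *\<^sub>R b)) + \<alpha> *\<^sub>R z2"
       "sqlen y2 = sqlen x2 + 2 * \<alpha> * b2 + real k * \<alpha>\<^sup>2 * r b b" by blast
    from 3(2)[of \<alpha>] obtain y3 where y3: "y3 \<in> lists W" "length y3 = k"
       "lprod y3 = (lprod x3 \<odot> ((\<alpha> * real k) *\<^sub>R - a)) + \<alpha> *\<^sub>R z3"
       "sqlen y3 = sqlen x3 + 2 * \<alpha> * b3 + real k * \<alpha>\<^sup>2 * r (-a) (-a)" by blast
    from 4(2)[of \<alpha>] obtain y4 where y4: "y4 \<in> lists W" "length y4 = k"
       "lprod y4 = (lprod x4 \<odot> ((\<alpha> * real k) *\<^sub>R - b)) + \<alpha> *\<^sub>R z4"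
       "sqlen y4 = sqlen x4 + 2 * \<alpha> * b4 + real k * \<alpha>\<^sup>2 * r (-b) (-b)" by blast
    have zz: "\<alpha> *\<^sub>R z1 \<in> Z" "\<alpha> *\<^sub>R z2 \<in> Z" "\<alpha> *\<^sub>R z3 \<in> Z" "\<alpha> *\<^sub>R z4 \<in> Z"
      using 1(1) 2(1) 3(1) 4(1) Z_subspace by (simp_all add: subspace_scale)
    have "lprod (y1 @ y2 @ y3 @ y4) = lprod xs + (\<alpha> * real k)\<^sup>2 *\<^sub>R br a b + \<alpha> *\<^sub>R \<zeta>"
      using loop_identity[OF zz, of "lprod x1" "\<alpha> * real k" a "lprod x2" b "lprod x3" "lprod x4"]
      by (simp add: lprod_append y1 y2 y3 y4 xs_eq \<zeta>_def p_def scaleR_add_right)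
    moreover have "sqlen (y1 @ y2 @ y3 @ y4) \<le> sqlen xs + 2 * \<alpha> * (b1 + b2 + b3 + b4) + real (4 * k) * \<alpha>\<^sup>2 * B"
    proof -
      have "(real k * \<alpha>\<^sup>2) * r a a \<le> (real k * \<alpha>\<^sup>2) * B" "(real k * \<alpha>\<^sup>2) * r b b \<le> (real k * \<alpha>\<^sup>2) * B"
        using B by (simp_all add: mult_left_mono)
      then show ?thesis by (simp add: y1 y2 y3 y4 xs_eq r_simps algebra_simps)
    qed
    ultimately show ?thesis using y1 y2 y3 y4 l
      by (intro bexI[of _ "y1 @ y2 @ y3 @ y4"]) (auto simp: xs_eq)
  qed
  ultimately show ?thesis using that by blast
qed

lemma blocks_perturbation:
  assumes W: "subspace W" and ab: "a \<in> W" "b \<in> W" and B: "r a a \<le> B" "r b b \<le> B"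
  shows "xs \<in> lists W \<Longrightarrow> length xs = M * (4 * k) \<Longrightarrow>
    \<exists>\<zeta> \<beta>. (\<forall>m. \<zeta> m \<in> Z) \<and> (\<forall>\<alpha>. \<exists>ys\<in>lists W. length ys = length xs \<and>
     lprod ys = lprod xs + ((\<Sum>m<M. (\<alpha> m)\<^sup>2) * (real k)\<^sup>2) *\<^sub>R br a b + (\<Sum>m<M. \<alpha> m *\<^sub>R \<zeta> m) \<and>
     sqlen ys \<le> sqlen xs + 2 * (\<Sum>m<M. \<alpha> m * \<beta> m) + real (4 * k) * (\<Sum>m<M. (\<alpha> m)\<^sup>2) * B)"
proof (induction M arbitrary: xs)
  case 0
  then show ?case using subspace_0[OF Z_subspace] by (intro exI[of _ "\<lambda>_. 0"]) auto
next
  case (Suc M)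
  define us vs where "us = take (M * (4 * k)) xs" "vs = drop (M * (4 * k)) xs"
  have xs_eq: "xs = us @ vs" by (simp add: us_vs_def)
  have W': "us \<in> lists W" "vs \<in> lists W" using Suc.prems(1) by (simp_all add: xs_eq)
  have l: "length us = M * (4 * k)" "length vs = 4 * k" using Suc.prems(2) by (auto simp: us_vs_def)
  obtain \<zeta> \<beta> where zb: "\<And>m. \<zeta> m \<in> Z" "\<And>\<alpha>. \<exists>ys\<in>lists W. length ys = length us \<and>
     lprod ys = lprod us + ((\<Sum>m<M. (\<alpha> m)\<^sup>2) * (real k)\<^sup>2) *\<^sub>R br a b + (\<Sum>m<M. \<alpha> m *\<^sub>R \<zeta> m) \<and>
     sqlen ys \<le> sqlen us + 2 * (\<Sum>m<M. \<alpha> m * \<beta> m) + real (4 * k) * (\<Sum>m<M. (\<alpha> m)\<^sup>2) * B"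
    using Suc.IH[OF W'(1) l(1)] by blast
  obtain \<zeta>' \<beta>' where zb': "\<zeta>' \<in> Z" "\<And>\<alpha>. \<exists>ys\<in>lists W. length ys = length vs \<and>
     lprod ys = lprod vs + (\<alpha> * real k)\<^sup>2 *\<^sub>R br a b + \<alpha> *\<^sub>R \<zeta>' \<and>
     sqlen ys \<le> sqlen vs + 2 * \<alpha> * \<beta>' + real (4 * k) * \<alpha>\<^sup>2 * B"
    using block_perturbation[OF W W'(2) ab l(2) B] by blast
  let ?\<zeta> = "\<zeta>(M := \<zeta>')" and ?\<beta> = "\<beta>(M := \<beta>')"
  have "\<exists>ys\<in>lists W. length ys = length xs \<and>
     lprod ys = lprod xs + ((\<Sum>m<Suc M. (\<alpha> m)\<^sup>2) * (real k)\<^sup>2) *\<^sub>R br a b + (\<Sum>m<Suc M. \<alpha> m *\<^sub>R ?\<zeta> m) \<and>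
     sqlen ys \<le> sqlen xs + 2 * (\<Sum>m<Suc M. \<alpha> m * ?\<beta> m) + real (4 * k) * (\<Sum>m<Suc M. (\<alpha> m)\<^sup>2) * B" for \<alpha>
  proof -
    from zb(2)[of \<alpha>] obtain y1 where y1: "y1 \<in> lists W" "length y1 = length us"
      "lprod y1 = lprod us + ((\<Sum>m<M. (\<alpha> m)\<^sup>2) * (real k)\<^sup>2) *\<^sub>R br a b + (\<Sum>m<M. \<alpha> m *\<^sub>R \<zeta> m)"
      "sqlen y1 \<le> sqlen us + 2 * (\<Sum>m<M. \<alpha> m * \<beta> m) + real (4 * k) * (\<Sum>m<M. (\<alpha> m)\<^sup>2) * B" by blast
    from zb'(2)[of "\<alpha> M"] obtain y2 where y2: "y2 \<in> lists W" "length y2 = length vs"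
      "lprod y2 = lprod vs + (\<alpha> M * real k)\<^sup>2 *\<^sub>R br a b + \<alpha> M *\<^sub>R \<zeta>'"
      "sqlen y2 \<le> sqlen vs + 2 * \<alpha> M * \<beta>' + real (4 * k) * (\<alpha> M)\<^sup>2 * B" by blast
    have z1: "((\<Sum>m<M. (\<alpha> m)\<^sup>2) * (real k)\<^sup>2) *\<^sub>R br a b + (\<Sum>m<M. \<alpha> m *\<^sub>R \<zeta> m) \<in> Z"
      using Z_subspace zb(1) by (auto intro!: subspace_add subspace_scale subspace_sum br_in_Z)
    have z2: "(\<alpha> M * real k)\<^sup>2 *\<^sub>R br a b + \<alpha> M *\<^sub>R \<zeta>' \<in> Z"
      using Z_subspace zb' by (auto intro!: subspace_add subspace_scale br_in_Z)
    have "lprod (y1 @ y2) = lprod xs + ((\<Sum>m<Suc M. (\<alpha> m)\<^sup>2) * (real k)\<^sup>2) *\<^sub>R br a b + (\<Sum>m<Suc M. \<alpha> m *\<^sub>R ?\<zeta> m)"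
      using bch_Z(1)[OF z1, of "lprod us" "lprod y2"] bch_Z(2)[OF z2, of "lprod us" "lprod vs"]
      by (simp add: lprod_append y1(3) y2(3) xs_eq add.assoc distrib_right scaleR_add_left power_mult_distrib)
    moreover have "sqlen (y1 @ y2) \<le> sqlen xs + 2 * (\<Sum>m<Suc M. \<alpha> m * ?\<beta> m) + real (4 * k) * (\<Sum>m<Suc M. (\<alpha> m)\<^sup>2) * B"
      using y1(4) y2(4) by (simp add: xs_eq algebra_simps)
    ultimately show ?thesis using y1 y2 by (intro bexI[of _ "y1 @ y2"]) (auto simp: xs_eq)
  qed
  moreover have "?\<zeta> m \<in> Z" for m using zb(1) zb'(1) by simp
  ultimately show ?case by blast
qed

text \<open>With \<open>DIM('e) + 2\<close> blocks there are more parameters \<open>\<alpha>\<^sub>m\<close> than the \<open>DIM('e) + 1\<close> linear conditions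
\<open>\<Sum> \<alpha>\<^sub>m \<zeta>\<^sub>m = 0\<close> and \<open>\<Sum> \<alpha>\<^sub>m \<beta>\<^sub>m = 0\<close>, so some nonzero \<open>\<alpha>\<close> satisfies them all. Scaling it produces any
prescribed multiple of \<open>[a, b]\<close>. The number of blocks, hence the constant, does not depend on the
polygon: this is what makes the estimate uniform.\<close>

lemma bracket_correction:
  assumes W: "subspace W" and ab: "a \<in> W" "b \<in> W" and B: "r a a \<le> B" "r b b \<le> B"
    and xs: "xs \<in> lists W" and "c \<ge> 0" "\<epsilon> > 0"
  shows "\<exists>ys\<in>lists W. lprod ys = lprod xs + c *\<^sub>R br a b \<and>
    (plen ys)\<^sup>2 \<le> (plen xs + \<epsilon>)\<^sup>2 + 16 * real (DIM('e) + 2) * B * c"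
proof -
  define M where "M = DIM('e) + 2"
  obtain us k \<eta> where us: "us \<in> lists W" "length us = (M * 4) * k" "k > 0" "\<eta> > 0"
    and n: "\<And>u. u \<in> set us \<Longrightarrow> nrm u \<le> \<eta>"
    and len: "real (length us) * \<eta> \<le> plen xs + \<epsilon>" and p: "lprod us = lprod xs"
    using uniform_subdivision[OF W xs \<open>\<epsilon> > 0\<close>, of "M * 4"] by (auto simp: M_def)
  obtain \<zeta> \<beta> where pert: "\<And>\<alpha>. \<exists>ys\<in>lists W. length ys = length us \<and>
     lprod ys = lprod us + ((\<Sum>m<M. (\<alpha> m)\<^sup>2) * (real k)\<^sup>2) *\<^sub>R br a b + (\<Sum>m<M. \<alpha> m *\<^sub>R \<zeta> m) \<and>
     sqlen ys \<le> sqlen us + 2 * (\<Sum>m<M. \<alpha> m * \<beta> m) + real (4 * k) * (\<Sum>m<M. (\<alpha> m)\<^sup>2) * B"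
    using blocks_perturbation[OF W ab B us(1), of M k] us(2) by (auto simp: mult.assoc)
  obtain \<alpha>' i where i: "i < M" "\<alpha>' i \<noteq> 0" and rel: "(\<Sum>j<M. \<alpha>' j *\<^sub>R (\<zeta> j, \<beta> j :: real)) = 0"
    by (rule nontrivial_relation[of M "\<lambda>j. (\<zeta> j, \<beta> j)"]) (auto simp: M_def)
  have rel1: "(\<Sum>j<M. \<alpha>' j *\<^sub>R \<zeta> j) = 0" using arg_cong[OF rel, of fst] by (simp add: fst_sum)
  have rel2: "(\<Sum>j<M. \<alpha>' j * \<beta> j) = 0" using arg_cong[OF rel, of snd] by (simp add: snd_sum)
  \<comment> \<open>the scale \<open>t\<close> makes the total area equal to \<open>c\<close>\<close>
  define S where "S = (\<Sum>m<M. (\<alpha>' m)\<^sup>2)"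
  have S: "S > 0" unfolding S_def using i by (intro sum_pos2[of _ i]) auto
  define t where "t = sqrt (c / (S * (real k)\<^sup>2))"
  have t2: "t\<^sup>2 * S * (real k)\<^sup>2 = c" using S us(3) \<open>c \<ge> 0\<close> by (simp add: t_def)
  define \<alpha> where "\<alpha> m = t * \<alpha>' m" for m
  have a1: "(\<Sum>m<M. (\<alpha> m)\<^sup>2) = t\<^sup>2 * S" by (simp add: \<alpha>_def S_def power_mult_distrib sum_distrib_left)
  have a2: "(\<Sum>m<M. \<alpha> m *\<^sub>R \<zeta> m) = 0" using rel1 by (simp add: \<alpha>_def flip: scaleR_scaleR scaleR_sum_right)
  have a3: "(\<Sum>m<M. \<alpha> m * \<beta> m) = 0" using rel2 by (simp add: \<alpha>_def mult.assoc flip: sum_distrib_left)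
  obtain ys where ys: "ys \<in> lists W" "length ys = length us" "lprod ys = lprod us + c *\<^sub>R br a b"
     "sqlen ys \<le> sqlen us + real (4 * k) * (t\<^sup>2 * S) * B"
    using pert[of \<alpha>] by (auto simp: a1 a2 a3 t2)
  have squs: "sqlen us \<le> real (length us) * \<eta>\<^sup>2"
  proof -
    have "sqlen vs \<le> real (length vs) * \<eta>\<^sup>2" if "\<And>u. u \<in> set vs \<Longrightarrow> nrm u \<le> \<eta>" for vs
      using that
    proof (induction vs)
      case (Cons v vs)
      then have "r v v \<le> \<eta>\<^sup>2" using power_mono[of "nrm v" \<eta> 2] by (simp add: nrm_sq)
      then show ?case using Cons by (simp add: algebra_simps)
    qed simp
    then show ?thesis using n by blast
  qed
  have "(plen ys)\<^sup>2 \<le> real (length us) * (real (length us) * \<eta>\<^sup>2 + real (4 * k) * (t\<^sup>2 * S) * B)"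
    by (rule order_trans[OF plen_Cauchy_Schwarz]) (use ys squs in \<open>auto intro!: mult_left_mono\<close>)
  also have "\<dots> = (real (length us) * \<eta>)\<^sup>2 + 16 * real M * B * (t\<^sup>2 * S * (real k)\<^sup>2)"
    by (simp add: us(2) power2_eq_square algebra_simps)
  also have "\<dots> \<le> (plen xs + \<epsilon>)\<^sup>2 + 16 * real M * B * c"
    using len us(4) unfolding t2 by (intro add_right_mono power_mono) auto
  finally show ?thesis using ys p by (intro bexI[of _ ys]) (auto simp: M_def)
qed

end

section \<open>The asymptotic fibre and central displacements\<close>

context sub_riem_model
begin

text \<open>The fibre at the identity of \<open>\<Delta>\<^sub>\<infinity>\<close>.\<close>

definition V :: "'e set" where "V = {v \<in> \<Delta>. \<forall>w \<in> \<Delta> \<inter> Z. r v w = 0}"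

lemma V_subset: "V \<subseteq> \<Delta>" by (auto simp: V_def)

lemma V_subspace: "subspace V"
proof (rule subspaceI)
  show "0 \<in> V" using subspace_0[OF \<Delta>_subspace] by (simp add: V_def r.zero_left)
next
  fix x y assume "x \<in> V" "y \<in> V"
  then show "x + y \<in> V" using subspace_add[OF \<Delta>_subspace, of x y] by (auto simp: V_def r.add_left)
next
  fix c x assume "x \<in> V"
  then show "c *\<^sub>R x \<in> V" using subspace_scale[OF \<Delta>_subspace, of x c] by (auto simp: V_def r.scaleR_left)
qed

text \<open>Orthogonal projection for \<open>r\<close> onto a subspace on which \<open>r\<close> is definite: the map \<open>w \<mapsto> \<Sum> r(w, b) b\<close> over
a basis is injective on the subspace by definiteness, hence onto.\<close>

lemma r_projection:
  assumes S: "subspace S" "S \<subseteq> \<Delta>"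
  obtains w where "w \<in> S" "\<And>s. s \<in> S \<Longrightarrow> r (d - w) s = 0"
proof -
  obtain B where B: "B \<subseteq> S" "independent B" "S \<subseteq> span B"
    by (rule basis_exists[of S])
  have fin: "finite B" using B by (simp add: independent_imp_finite)
  have SB: "S = span B" using B S by (simp add: subset_antisym span_minimal)
  define T where "T w = (\<Sum>b\<in>B. r w b *\<^sub>R b)" for w
  have lin: "linear T" unfolding T_def
    by (auto intro!: linearI simp: r_simps scaleR_add_left sum.distrib scaleR_sum_right)
  have TS: "T w \<in> S" for w unfolding T_def SB by (intro span_sum span_scale span_base)
  have coeff: "r w b = 0" if "T w = 0" "b \<in> B" for w b
    using independentD[OF B(2) fin order_refl, of "\<lambda>b. r w b" b] that by (simp add: T_def)
  have orth: "r w s = 0" if "T w = 0" "s \<in> S" for w s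
    using that(2) unfolding SB by (induction rule: span_induct_alt) (auto simp: r_simps coeff that(1))
  have "inj_on T S"
  proof (rule inj_onI)
    fix x y assume xy: "x \<in> S" "y \<in> S" "T x = T y"
    have 1: "T (x - y) = 0" using xy lin by (simp add: linear_diff)
    have 2: "x - y \<in> S" using xy S by (simp add: subspace_diff)
    from orth[OF 1 2] r_pos[of "x - y"] 2 S show "x = y" by force
  qed
  then have "dim (T ` S) = dim S" using S by (intro dim_image_eq[OF lin]) (simp add: span_eq_iff[THEN iffD2])
  moreover have "subspace (T ` S)" using lin S by (simp add: linear_subspace_image)
  ultimately have "T ` S = S" using TS S by (intro subspace_dim_equal) auto
  then obtain w where w: "w \<in> S" "T w = T d" using TS[of d] by force
  then have "T (d - w) = 0" using lin by (simp add: linear_diff)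
  then show ?thesis using that[OF w(1)] orth by blast
qed

lemma orthogonal_decomposition:
  assumes "d \<in> \<Delta>"
  obtains v w where "v \<in> V" "w \<in> \<Delta> \<inter> Z" "d = v + w"
proof -
  obtain w where w: "w \<in> \<Delta> \<inter> Z" "\<And>s. s \<in> \<Delta> \<inter> Z \<Longrightarrow> r (d - w) s = 0"
    using r_projection[of "\<Delta> \<inter> Z" d] subspace_inter[OF \<Delta>_subspace Z_subspace] by auto
  have "d - w \<in> V" using w assms \<Delta>_subspace by (auto simp: V_def subspace_diff)
  then show ?thesis using that[of "d - w" w] w by simp
qed

lemma V_plus_Z: "\<exists>v\<in>V. \<exists>z\<in>Z. x = v + z"
proof -
  obtain u z where uz: "u \<in> \<Delta>" "z \<in> Z" "x = u + z" using decomp[of x] by blast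
  obtain v w where vw: "v \<in> V" "w \<in> \<Delta> \<inter> Z" "u = v + w" using orthogonal_decomposition[OF uz(1)] .
  have "w + z \<in> Z" using vw uz Z_subspace by (simp add: subspace_add)
  then show ?thesis using uz vw by (metis add.assoc)
qed

lemma Z_eq_span_V: "Z = span {br a b | a b. a \<in> V \<and> b \<in> V}"
proof
  show "Z \<subseteq> span {br a b | a b. a \<in> V \<and> b \<in> V}" unfolding Z_def
  proof (rule span_minimal)
    show "{br a b |a b. True} \<subseteq> span {br a b | a b. a \<in> V \<and> b \<in> V}"
    proof clarify
      fix a b
      obtain v z v' z' where "v \<in> V" "z \<in> Z" "a = v + z" "v' \<in> V" "z' \<in> Z" "b = v' + z'"
        using V_plus_Z by metis
      then have "br a b = br v v'" by (simp add: br_simps Z_central)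
      then show "br a b \<in> span {br a b | a b. a \<in> V \<and> b \<in> V}"
        using \<open>v \<in> V\<close> \<open>v' \<in> V\<close> by (auto intro: span_base)
    qed
  qed simp
qed (auto simp: Z_def intro!: span_mono)

text \<open>The fibres for which all estimates are made simultaneously. The two that matter are \<open>V\<close> and \<open>\<Delta>\<close>.\<close>

definition admissible :: "'e set \<Rightarrow> bool" where
  "admissible W \<longleftrightarrow> subspace W \<and> V \<subseteq> W \<and> W \<subseteq> \<Delta>"

lemma admissible_V: "admissible V" and admissible_\<Delta>: "admissible \<Delta>"
  using V_subset V_subspace \<Delta>_subspace by (auto simp: admissible_def)

text \<open>Multiples of \<open>\<zeta>\<close> can be reached at linear cost for the square of the length. Stated for squares, the
costs of successive corrections simply add up.\<close>

definition correctable :: "'e \<Rightarrow> real \<Rightarrow> bool" where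
  "correctable \<zeta> C \<longleftrightarrow> (\<forall>W xs c \<epsilon>. admissible W \<and> xs \<in> lists W \<and> \<epsilon> > 0 \<longrightarrow>
     (\<exists>ys\<in>lists W. lprod ys = lprod xs + c *\<^sub>R \<zeta> \<and> (plen ys)\<^sup>2 \<le> (plen xs)\<^sup>2 + \<epsilon> + C * \<bar>c\<bar>))"

lemma correctableE:
  assumes "correctable \<zeta> C" "admissible W" "xs \<in> lists W" "\<epsilon> > 0"
  obtains ys where "ys \<in> lists W" "lprod ys = lprod xs + c *\<^sub>R \<zeta>" "(plen ys)\<^sup>2 \<le> (plen xs)\<^sup>2 + \<epsilon> + C * \<bar>c\<bar>"
  using assms unfolding correctable_def by blast

lemma correctable_bracket:
  assumes "a \<in> V" "b \<in> V"
  shows "\<exists>C\<ge>0. correctable (br a b) C"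
proof -
  define B where "B = max (r a a) (r b b)"
  define C where "C = 16 * real (DIM('e) + 2) * B"
  have B: "r a a \<le> B" "r b b \<le> B" "B \<ge> 0" using r_nonneg[of a] by (auto simp: B_def)
  have "correctable (br a b) C"
    unfolding correctable_def
  proof clarify
    fix W xs and c \<epsilon> :: real
    assume W: "admissible W" and xs: "\<forall>x\<in>set xs. x \<in> W" and \<epsilon>: "\<epsilon> > 0"
    have W': "subspace W" "a \<in> W" "b \<in> W" using W assms by (auto simp: admissible_def)
    have xs': "xs \<in> lists W" using xs by auto
    \<comment> \<open>chosen so that \<open>(plen xs + \<epsilon>)\<^sup>2 \<le> (plen xs)\<^sup>2 + \<epsilon>\<close>\<close>
    define \<epsilon>' where "\<epsilon>' = min 1 (\<epsilon> / (2 * plen xs + 1))"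
    have \<epsilon>': "\<epsilon>' > 0" "\<epsilon>' \<le> 1" "\<epsilon>' * (2 * plen xs + 1) \<le> \<epsilon>"
    proof -
      have p: "2 * plen xs + 1 > 0" using plen_nonneg[of xs] by linarith
      show "\<epsilon>' > 0" "\<epsilon>' \<le> 1" using \<epsilon> p by (auto simp: \<epsilon>'_def)
      have "\<epsilon>' \<le> \<epsilon> / (2 * plen xs + 1)" by (simp add: \<epsilon>'_def)
      then show "\<epsilon>' * (2 * plen xs + 1) \<le> \<epsilon>" using p by (simp add: pos_le_divide_eq)
    qed
    have "(plen xs + \<epsilon>')\<^sup>2 = (plen xs)\<^sup>2 + \<epsilon>' * (2 * plen xs + \<epsilon>')"
      by (simp add: power2_eq_square algebra_simps)
    also have "\<dots> \<le> (plen xs)\<^sup>2 + \<epsilon>' * (2 * plen xs + 1)"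
      using \<epsilon>' by (intro add_left_mono mult_left_mono) auto
    finally have e: "(plen xs + \<epsilon>')\<^sup>2 \<le> (plen xs)\<^sup>2 + \<epsilon>" using \<epsilon>' by linarith
    show "\<exists>ys\<in>lists W. lprod ys = lprod xs + c *\<^sub>R br a b \<and> (plen ys)\<^sup>2 \<le> (plen xs)\<^sup>2 + \<epsilon> + C * \<bar>c\<bar>"
    proof (cases "c \<ge> 0")
      case True
      obtain ys where "ys \<in> lists W" "lprod ys = lprod xs + c *\<^sub>R br a b"
        "(plen ys)\<^sup>2 \<le> (plen xs + \<epsilon>')\<^sup>2 + 16 * real (DIM('e) + 2) * B * c"
        using bracket_correction[OF W' B(1,2) xs' True \<epsilon>'(1)] by blast
      then show ?thesis using e True by (intro bexI[of _ ys]) (auto simp: C_def)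
    next
      case False
      then have "- c \<ge> 0" by simp
      obtain ys where "ys \<in> lists W" "lprod ys = lprod xs + (- c) *\<^sub>R br b a"
        "(plen ys)\<^sup>2 \<le> (plen xs + \<epsilon>')\<^sup>2 + 16 * real (DIM('e) + 2) * B * (- c)"
        using bracket_correction[OF W'(1,3,2) B(2,1) xs' \<open>- c \<ge> 0\<close> \<epsilon>'(1)] by blast
      then show ?thesis using e False skew[of a b] by (intro bexI[of _ ys]) (auto simp: C_def)
    qed
  qed
  moreover have "C \<ge> 0" using B by (simp add: C_def)
  ultimately show ?thesis by blast
qed

lemma correctable_add_scale:
  assumes 1: "correctable \<zeta> C" and 2: "correctable \<zeta>' C'"
  shows "correctable (s *\<^sub>R \<zeta> + \<zeta>') (C * \<bar>s\<bar> + C')"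
  unfolding correctable_def
proof clarify
  fix W xs and c \<epsilon> :: real
  assume W: "admissible W" and xs: "\<forall>x\<in>set xs. x \<in> W" and \<epsilon>: "\<epsilon> > 0"
  have xs': "xs \<in> lists W" using xs by auto
  obtain ys where ys: "ys \<in> lists W" "lprod ys = lprod xs + (c * s) *\<^sub>R \<zeta>" "(plen ys)\<^sup>2 \<le> (plen xs)\<^sup>2 + \<epsilon>/2 + C * \<bar>c * s\<bar>"
    using correctableE[OF 1 W xs', of "\<epsilon>/2"] \<epsilon> by auto
  obtain zs where zs: "zs \<in> lists W" "lprod zs = lprod ys + c *\<^sub>R \<zeta>'" "(plen zs)\<^sup>2 \<le> (plen ys)\<^sup>2 + \<epsilon>/2 + C' * \<bar>c\<bar>"
    using correctableE[OF 2 W ys(1), of "\<epsilon>/2"] \<epsilon> by auto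
  show "\<exists>ys\<in>lists W. lprod ys = lprod xs + c *\<^sub>R (s *\<^sub>R \<zeta> + \<zeta>') \<and> (plen ys)\<^sup>2 \<le> (plen xs)\<^sup>2 + \<epsilon> + (C * \<bar>s\<bar> + C') * \<bar>c\<bar>"
    using ys zs by (intro bexI[of _ zs]) (auto simp: algebra_simps abs_mult)
qed

lemma correctable_zero: "correctable 0 0"
  unfolding correctable_def by (auto intro!: bexI)

lemma correctable_Z:
  assumes "\<zeta> \<in> Z"
  shows "\<exists>C\<ge>0. correctable \<zeta> C"
  using assms unfolding Z_eq_span_V
proof (induction rule: span_induct_alt)
  case base then show ?case using correctable_zero by blast
next
  case (step c x y)
  then obtain C C' where "C \<ge> 0" "correctable x C" "C' \<ge> 0" "correctable y C'"
    using correctable_bracket by force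
  then show ?case by (intro exI[of _ "C * \<bar>c\<bar> + C'"]) (simp add: correctable_add_scale)
qed

text \<open>The constant must be uniform in the coefficients; this is why a basis of \<open>Z\<close> is treated at once
and \<open>correctable_Z\<close> is not applied to the sum.\<close>

lemma correctable_sum:
  assumes "finite B" "B \<subseteq> Z"
  shows "\<exists>C\<ge>0. \<forall>f. correctable (\<Sum>b\<in>B. f b *\<^sub>R b) (C * (\<Sum>b\<in>B. \<bar>f b\<bar>))"
  using assms
proof (induction rule: finite_induct)
  case empty then show ?case using correctable_zero by auto
next
  case (insert b B)
  then obtain C C' where C: "C \<ge> 0" "\<And>f. correctable (\<Sum>b\<in>B. f b *\<^sub>R b) (C * (\<Sum>b\<in>B. \<bar>f b\<bar>))"
    and C': "C' \<ge> 0" "correctable b C'" using correctable_Z[of b] by auto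
  have "correctable (\<Sum>b\<in>insert b B. f b *\<^sub>R b) (max C C' * (\<Sum>b\<in>insert b B. \<bar>f b\<bar>))" for f
  proof -
    have "correctable (f b *\<^sub>R b + (\<Sum>b\<in>B. f b *\<^sub>R b)) (C' * \<bar>f b\<bar> + C * (\<Sum>b\<in>B. \<bar>f b\<bar>))"
      by (intro correctable_add_scale C C')
    moreover have "C' * \<bar>f b\<bar> + C * (\<Sum>b\<in>B. \<bar>f b\<bar>) \<le> max C C' * (\<Sum>b\<in>insert b B. \<bar>f b\<bar>)"
      using insert.hyps by (simp add: distrib_left add_mono mult_right_mono sum_nonneg)
    ultimately show ?thesis using insert.hyps unfolding correctable_def
      by (simp) (meson order_trans add_left_mono mult_right_mono abs_ge_zero)
  qed
  then show ?case using C by (intro exI[of _ "max C C'"]) auto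
qed

theorem center_correction:
  obtains C where "C \<ge> 0"
    "\<And>W xs \<zeta> \<epsilon>. admissible W \<Longrightarrow> xs \<in> lists W \<Longrightarrow> \<zeta> \<in> Z \<Longrightarrow> \<epsilon> > 0 \<Longrightarrow>
      \<exists>ys\<in>lists W. lprod ys = lprod xs + \<zeta> \<and> (plen ys)\<^sup>2 \<le> (plen xs)\<^sup>2 + \<epsilon> + C * norm \<zeta>"
proof -
  obtain B where B: "B \<subseteq> Z" "pairwise orthogonal B" "\<And>x. x \<in> B \<Longrightarrow> norm x = 1"
    "independent B" "span B = Z"
    using orthonormal_basis_subspace[OF Z_subspace] by metis
  have fin: "finite B" using B by (simp add: independent_imp_finite)
  obtain C where C: "C \<ge> 0" "\<And>f. correctable (\<Sum>b\<in>B. f b *\<^sub>R b) (C * (\<Sum>b\<in>B. \<bar>f b\<bar>))"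
    using correctable_sum[OF fin B(1)] by blast
  have "\<exists>ys\<in>lists W. lprod ys = lprod xs + \<zeta> \<and> (plen ys)\<^sup>2 \<le> (plen xs)\<^sup>2 + \<epsilon> + (C * card B) * norm \<zeta>"
    if hyps: "admissible W" "xs \<in> lists W" "\<zeta> \<in> Z" "\<epsilon> > 0" for W xs \<zeta> \<epsilon>
  proof -
    have e: "(\<Sum>b\<in>B. (\<zeta> \<bullet> b) *\<^sub>R b) = \<zeta>"
      using hyps(3) B fin by (intro orthonormal_basis_expand) auto
    have "(\<Sum>b\<in>B. \<bar>\<zeta> \<bullet> b\<bar>) \<le> (\<Sum>b\<in>B. norm \<zeta>)"
      by (intro sum_mono) (use Cauchy_Schwarz_ineq2 B(3) in \<open>metis mult.right_neutral\<close>)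
    then have le: "C * (\<Sum>b\<in>B. \<bar>\<zeta> \<bullet> b\<bar>) \<le> (C * card B) * norm \<zeta>"
      using C(1) mult_left_mono by fastforce
    obtain ys where "ys \<in> lists W" "lprod ys = lprod xs + 1 *\<^sub>R (\<Sum>b\<in>B. (\<zeta> \<bullet> b) *\<^sub>R b)"
      "(plen ys)\<^sup>2 \<le> (plen xs)\<^sup>2 + \<epsilon> + C * (\<Sum>b\<in>B. \<bar>\<zeta> \<bullet> b\<bar>) * \<bar>1\<bar>"
      using correctableE[OF C(2) hyps(1,2,4)] by blast
    then show ?thesis using le e by (intro bexI[of _ ys]) auto
  qed
  then show ?thesis using that[of "C * card B"] C(1) by simp
qed

end

section \<open>The infimum of the lengths of polygons\<close>

context sub_riem_model
begin

text \<open>Each edge is split orthogonally into its parts in \<open>V\<close> and in \<open>\<Delta> \<inter> Z\<close>. The central parts can be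
collected at the end of the product, and the lengths of the two families are compared with Minkowski's
inequality in the plane.\<close>

lemma \<Delta>_polygon_decomposition:
  assumes "xs \<in> lists \<Delta>"
  shows "\<exists>vs\<in>lists V. \<exists>w\<in>\<Delta> \<inter> Z. lprod xs = lprod vs + w \<and> (plen vs)\<^sup>2 + (nrm w)\<^sup>2 \<le> (plen xs)\<^sup>2"
  using assms
proof (induction xs)
  case Nil
  have "0 \<in> \<Delta> \<inter> Z" using subspace_0[OF \<Delta>_subspace] subspace_0[OF Z_subspace] by simp
  then show ?case by (intro bexI[of _ "[]"] bexI[of _ 0]) auto
next
  case (Cons x xs)
  then have xs: "xs \<in> lists \<Delta>" and x: "x \<in> \<Delta>" by simp_all
  obtain vs w where IH: "vs \<in> lists V" "w \<in> \<Delta> \<inter> Z" "lprod xs = lprod vs + w"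
    "(plen vs)\<^sup>2 + (nrm w)\<^sup>2 \<le> (plen xs)\<^sup>2"
    using Cons.IH by blast
  obtain v u where vu: "v \<in> V" "u \<in> \<Delta> \<inter> Z" "x = v + u"
    using orthogonal_decomposition[OF x] .
  have "r v u = 0" using vu by (auto simp: V_def)
  then have nx: "(nrm v)\<^sup>2 + (nrm u)\<^sup>2 = (nrm x)\<^sup>2"
    by (simp add: nrm_sq vu(3) r_simps r_sym[of u v])
  have "lprod (x # xs) = lprod (v # vs) + (u + w)"
    using vu(2) IH(2) by (simp add: IH(3) vu(3) bch_Z)
  moreover have "u + w \<in> \<Delta> \<inter> Z"
    using vu(2) IH(2) \<Delta>_subspace Z_subspace by (auto simp: subspace_add)
  moreover have "(plen (v # vs))\<^sup>2 + (nrm (u + w))\<^sup>2 \<le> (plen (x # xs))\<^sup>2"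
  proof -
    have "(nrm v + plen vs)\<^sup>2 + (nrm (u + w))\<^sup>2 \<le> (nrm v + plen vs)\<^sup>2 + (nrm u + nrm w)\<^sup>2"
      by (intro add_left_mono power_mono nrm_triangle nrm_nonneg)
    also have "sqrt \<dots> \<le> sqrt ((nrm v)\<^sup>2 + (nrm u)\<^sup>2) + sqrt ((plen vs)\<^sup>2 + (nrm w)\<^sup>2)"
      by (rule real_sqrt_sum_squares_triangle_ineq)
    also have "\<dots> \<le> nrm x + plen xs"
      using IH(4) by (simp add: nx real_le_lsqrt)
    finally have "sqrt ((plen (v # vs))\<^sup>2 + (nrm (u + w))\<^sup>2) \<le> plen (x # xs)" by simp
    then show ?thesis
      using sqrt_le_D by blast
  qed
  ultimately show ?case using IH(1) vu(1) by (intro bexI[of _ "v # vs"] bexI[of _ "u + w"]) auto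
qed

lemma bounded_projection:
  obtains P K where "linear P" "K \<ge> 0" "\<And>x. P x \<in> V" "\<And>x. x - P x \<in> Z" "\<And>x. norm (P x) \<le> K * norm x"
    "\<And>x. norm (x - P x) \<le> K * norm x"
proof -
  obtain p where p: "\<And>b. p b \<in> V \<and> b - p b \<in> Z"
  proof -
    have "\<exists>v. v \<in> V \<and> b - v \<in> Z" for b
    proof -
      obtain v z where "v \<in> V" "z \<in> Z" "b = v + z" using V_plus_Z[of b] by blast
      then show ?thesis by (intro exI[of _ v]) simp
    qed
    then show ?thesis using that by metis
  qed
  define P where "P x = (\<Sum>b\<in>Basis. (x \<bullet> b) *\<^sub>R p b)" for x
  have lin: "linear P" unfolding P_def
    by (auto intro!: linearI simp: inner_add_left scaleR_add_left sum.distrib scaleR_sum_right)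
  have 1: "P x \<in> V" for x
    unfolding P_def using V_subspace p by (auto intro!: subspace_sum subspace_scale)
  have 2: "x - P x \<in> Z" for x
  proof -
    have "x - P x = (\<Sum>b\<in>Basis. (x \<bullet> b) *\<^sub>R (b - p b))"
      by (simp add: P_def scaleR_diff_right sum_subtractf euclidean_representation)
    then show ?thesis using Z_subspace p by (auto intro!: subspace_sum subspace_scale)
  qed
  obtain K where K: "\<And>x. norm (P x) \<le> K * norm x" using linear_bounded[OF lin] by blast
  have "norm (x - P x) \<le> (1 + \<bar>K\<bar>) * norm x" for x
    using norm_triangle_ineq4[of x "P x"] K[of x] abs_ge_self[of K] mult_right_mono[of K "\<bar>K\<bar>" "norm x"]
    by (simp add: algebra_simps)
  moreover have "norm (P x) \<le> (1 + \<bar>K\<bar>) * norm x" for x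
    using K[of x] mult_right_mono[of K "1 + \<bar>K\<bar>" "norm x"] by force
  ultimately show ?thesis using that[OF lin _ 1 2, of "1 + \<bar>K\<bar>"] by simp
qed

text \<open>The first term bounds the sum of the edges, the second the sum of the brackets of pairs of edges.\<close>

lemma polygon_endpoint_bound:
  obtains A where "A \<ge> 0" "\<And>xs. xs \<in> lists \<Delta> \<Longrightarrow> norm (lprod xs) \<le> A * plen xs + A * (plen xs)\<^sup>2"
proof -
  obtain c where c: "c > 0" "\<And>x. x \<in> \<Delta> \<Longrightarrow> c * norm x \<le> nrm x" by (rule nrm_lower, rule that)
  obtain K where K: "K > 0" "\<And>a b. norm (br a b) \<le> norm a * norm b * K"
    using br.pos_bounded by blast
  let ?S = "\<lambda>xs. \<Sum>x\<leftarrow>xs. norm x"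
  have S: "c * ?S xs \<le> plen xs" if "xs \<in> lists \<Delta>" for xs
    using that
  proof (induction xs)
    case (Cons x xs) then show ?case using c(2)[of x] by (auto simp: algebra_simps)
  qed simp
  have S0: "0 \<le> ?S xs" for xs :: "'e list" by (intro sum_list_nonneg) auto
  have br_sum: "norm (br x (lprod xs)) \<le> K * norm x * ?S xs" for x xs
  proof (induction xs)
    case (Cons y xs)
    have "br x (lprod (y # xs)) = br x y + br x (lprod xs)" by (simp add: bch_def br_simps)
    then have "norm (br x (lprod (y # xs))) \<le> norm (br x y) + norm (br x (lprod xs))"
      by (simp add: norm_triangle_ineq)
    then show ?case using Cons K(2)[of x y] by (simp add: algebra_simps)
  qed (simp add: br_simps)
  have main: "norm (lprod xs) \<le> ?S xs + K * (?S xs)\<^sup>2" for xs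
  proof (induction xs)
    case (Cons x xs)
    have "norm (lprod (x # xs)) \<le> norm x + norm (lprod xs) + (1/2) * norm (br x (lprod xs))"
      unfolding lprod.simps bch_def
      by (rule order_trans[OF norm_triangle_ineq]) (use norm_triangle_ineq[of x "lprod xs"] in auto)
    also have "\<dots> \<le> norm x + (?S xs + K * (?S xs)\<^sup>2) + K * norm x * ?S xs"
      using Cons br_sum[of x xs] norm_ge_zero[of "br x (lprod xs)"] by linarith
    also have "\<dots> \<le> ?S (x # xs) + K * (?S (x # xs))\<^sup>2"
    proof -
      have "0 \<le> K * (norm x)\<^sup>2" "0 \<le> K * norm x * ?S xs" using K S0[of xs] by auto
      then show ?thesis by (simp add: power2_eq_square algebra_simps)
    qed
    finally show ?case .
  qed simp
  define A where "A = max (1 / c) (K / c\<^sup>2)"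
  have "norm (lprod xs) \<le> A * plen xs + A * (plen xs)\<^sup>2" if "xs \<in> lists \<Delta>" for xs
  proof -
    have S': "?S xs \<le> plen xs / c" using S[OF that] c by (simp add: field_simps)
    have "norm (lprod xs) \<le> ?S xs + K * (?S xs)\<^sup>2" by (rule main)
    also have "\<dots> \<le> plen xs / c + K * (plen xs / c)\<^sup>2"
      using S' S0[of xs] K by (intro add_mono mult_left_mono power_mono) auto
    also have "\<dots> = (1 / c) * plen xs + (K / c\<^sup>2) * (plen xs)\<^sup>2" by (simp add: power_divide)
    also have "\<dots> \<le> A * plen xs + A * (plen xs)\<^sup>2"
      by (intro add_mono mult_right_mono) (auto simp: A_def)
    finally show ?thesis .
  qed
  then show ?thesis using that[of A] c by (simp add: A_def le_max_iff_disj)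
qed

lemma polygon_split:
  assumes W: "subspace W"
  shows "xs \<in> lists W \<Longrightarrow> 0 \<le> s \<Longrightarrow> s \<le> plen xs \<Longrightarrow>
    \<exists>as\<in>lists W. \<exists>bs\<in>lists W. lprod as \<odot> lprod bs = lprod xs \<and> plen as = s \<and> plen bs = plen xs - s"
proof (induction xs arbitrary: s)
  case Nil then show ?case by (intro bexI[of _ "[]"]) auto
next
  case (Cons x xs)
  show ?case
  proof (cases "s \<le> nrm x")
    case True
    define t where "t = (if nrm x = 0 then 0 else s / nrm x)"
    have t: "0 \<le> t" "t \<le> 1" "t * nrm x = s" using True Cons.prems by (auto simp: t_def)
    have "lprod [t *\<^sub>R x] \<odot> lprod ((1 - t) *\<^sub>R x # xs) = lprod (x # xs)"
      by (simp add: bch_scaleR flip: bch_assoc)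
    moreover have "plen ((1 - t) *\<^sub>R x # xs) = plen (x # xs) - s" "plen [t *\<^sub>R x] = s"
      using t by (simp_all add: nrm_scaleR left_diff_distrib)
    ultimately show ?thesis using Cons.prems W
      by (intro bexI[of _ "[t *\<^sub>R x]"] bexI[of _ "(1 - t) *\<^sub>R x # xs"]) (auto simp: subspace_scale)
  next
    case False
    then obtain as bs where "as \<in> lists W" "bs \<in> lists W" "lprod as \<odot> lprod bs = lprod xs"
      "plen as = s - nrm x" "plen bs = plen xs - (s - nrm x)"
      using Cons.IH[of "s - nrm x"] Cons.prems by auto
    then show ?thesis using Cons.prems
      by (intro bexI[of _ "x # as"] bexI[of _ bs]) (auto simp: bch_assoc)
  qed
qed

text \<open>The distance from \<open>0\<close> to \<open>y\<close> in the group \<open>(\<gg>, \<odot>)\<close> with the left-invariant distance given by \<open>W\<close>.\<close>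

definition polygon_norm :: "'e set \<Rightarrow> 'e \<Rightarrow> real" where
  "polygon_norm W y = Inf {plen xs | xs. xs \<in> lists W \<and> lprod xs = y}"

lemma polygon_norm_bdd_below: "bdd_below {plen xs | xs. xs \<in> lists W \<and> lprod xs = y}"
  by (rule bdd_belowI[of _ 0]) auto

lemma polygon_norm_le_plen: "xs \<in> lists W \<Longrightarrow> polygon_norm W (lprod xs) \<le> plen xs"
  unfolding polygon_norm_def by (intro cInf_lower polygon_norm_bdd_below) auto

lemma polygon_exists:
  assumes "admissible W" shows "\<exists>xs\<in>lists W. lprod xs = y"
proof -
  obtain C where C: "C \<ge> 0" "\<And>W xs \<zeta> \<epsilon>. admissible W \<Longrightarrow> xs \<in> lists W \<Longrightarrow> \<zeta> \<in> Z \<Longrightarrow> \<epsilon> > 0 \<Longrightarrow>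
      \<exists>ys\<in>lists W. lprod ys = lprod xs + \<zeta> \<and> (plen ys)\<^sup>2 \<le> (plen xs)\<^sup>2 + \<epsilon> + C * norm \<zeta>"
    by (rule center_correction, rule that)
  obtain v z where "v \<in> V" "z \<in> Z" "y = v + z" using V_plus_Z by blast
  then show ?thesis using C(2)[OF assms, of "[v]" z 1] assms by (auto simp: admissible_def)
qed

lemma polygon_norm_approx:
  assumes "admissible W" "e > 0"
  shows "\<exists>xs\<in>lists W. lprod xs = y \<and> plen xs < polygon_norm W y + e"
proof -
  let ?S = "{plen xs | xs. xs \<in> lists W \<and> lprod xs = y}"
  have "?S \<noteq> {}" using polygon_exists[OF assms(1), of y] by blast
  moreover have "Inf ?S < polygon_norm W y + e" using assms(2) by (simp add: polygon_norm_def)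
  ultimately have "\<exists>l\<in>?S. l < polygon_norm W y + e" by (rule cInf_lessD)
  then show ?thesis by blast
qed

lemma le_polygon_norm:
  assumes "admissible W" "\<And>xs. xs \<in> lists W \<Longrightarrow> lprod xs = y \<Longrightarrow> c \<le> plen xs"
  shows "c \<le> polygon_norm W y"
  unfolding polygon_norm_def using polygon_exists[OF assms(1), of y] assms(2) by (intro cInf_greatest) auto

lemma polygon_norm_nonneg: "admissible W \<Longrightarrow> 0 \<le> polygon_norm W y"
  by (rule le_polygon_norm) auto

lemma polygon_norm_zero: "admissible W \<Longrightarrow> polygon_norm W 0 = 0"
  using polygon_norm_le_plen[of "[]" W] polygon_norm_nonneg[of W 0] by simp

lemma polygon_norm_minus_le: assumes "admissible W" shows "polygon_norm W (- y) \<le> polygon_norm W y"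
proof (rule le_polygon_norm[OF assms])
  fix xs assume xs: "xs \<in> lists W" "lprod xs = y"
  then have "rev (map uminus xs) \<in> lists W"
    using assms by (auto simp: admissible_def subspace_neg)
  from polygon_norm_le_plen[OF this] show "polygon_norm W (- y) \<le> plen xs"
    by (simp add: lprod_rev_uminus plen_rev_uminus xs)
qed

lemma polygon_norm_minus: "admissible W \<Longrightarrow> polygon_norm W (- y) = polygon_norm W y"
  using polygon_norm_minus_le[of W y] polygon_norm_minus_le[of W "- y"] by simp

lemma polygon_norm_triangle: assumes "admissible W" shows "polygon_norm W (x \<odot> y) \<le> polygon_norm W x + polygon_norm W y"
proof (rule field_le_epsilon)
  fix e :: real assume "e > 0"
  then have e: "e/2 > 0" by simp
  obtain xs where xs: "xs \<in> lists W" "lprod xs = x" "plen xs < polygon_norm W x + e/2" using polygon_norm_approx[OF assms e] by blast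
  obtain ys where ys: "ys \<in> lists W" "lprod ys = y" "plen ys < polygon_norm W y + e/2" using polygon_norm_approx[OF assms e] by blast
  have "polygon_norm W (lprod (xs @ ys)) \<le> plen (xs @ ys)" using xs ys by (intro polygon_norm_le_plen) auto
  then show "polygon_norm W (x \<odot> y) \<le> polygon_norm W x + polygon_norm W y + e" using xs ys by (simp add: lprod_append)
qed

lemma polygon_norm_split:
  assumes "admissible W" "0 \<le> s" "s \<le> polygon_norm W y" "e > 0"
  shows "\<exists>x. polygon_norm W x \<le> s \<and> polygon_norm W (- x \<odot> y) \<le> polygon_norm W y - s + e"
proof -
  obtain xs where xs: "xs \<in> lists W" "lprod xs = y" "plen xs < polygon_norm W y + e" using polygon_norm_approx[OF assms(1,4)] by blast
  have "s \<le> plen xs" using polygon_norm_le_plen[OF xs(1)] xs(2) assms by simp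
  then obtain as bs where ab: "as \<in> lists W" "bs \<in> lists W" "lprod as \<odot> lprod bs = lprod xs"
    "plen as = s" "plen bs = plen xs - s"
    using polygon_split[of W xs s] assms xs by (auto simp: admissible_def)
  have "- lprod as \<odot> y = lprod bs" using ab(3) xs(2) by (metis bch_cancel(1))
  then show ?thesis
    using polygon_norm_le_plen[OF ab(1)] polygon_norm_le_plen[OF ab(2)] ab xs by (intro exI[of _ "lprod as"]) simp
qed

lemma polygon_norm_coercive:
  obtains A where "A \<ge> 0" "\<And>W y. admissible W \<Longrightarrow> norm y \<le> A * (polygon_norm W y + 1) + A * (polygon_norm W y + 1)\<^sup>2"
proof -
  obtain A where A: "A \<ge> 0" "\<And>xs. xs \<in> lists \<Delta> \<Longrightarrow> norm (lprod xs) \<le> A * plen xs + A * (plen xs)\<^sup>2"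
    by (rule polygon_endpoint_bound, rule that)
  have "norm y \<le> A * (polygon_norm W y + 1) + A * (polygon_norm W y + 1)\<^sup>2" if W: "admissible W" for W y
  proof -
    obtain xs where xs: "xs \<in> lists W" "lprod xs = y" "plen xs < polygon_norm W y + 1" using polygon_norm_approx[OF W zero_less_one] by blast
    have "norm (lprod xs) \<le> A * plen xs + A * (plen xs)\<^sup>2" using xs(1) W by (intro A) (auto simp: admissible_def)
    also have "\<dots> \<le> A * (polygon_norm W y + 1) + A * (polygon_norm W y + 1)\<^sup>2"
      using xs(3) A by (intro add_mono mult_left_mono power_mono) auto
    finally show ?thesis using xs by simp
  qed
  then show ?thesis using that A by blast
qed

lemma polygon_norm_correction:
  obtains C where "C \<ge> 0" "\<And>W xs \<zeta>. admissible W \<Longrightarrow> xs \<in> lists W \<Longrightarrow> \<zeta> \<in> Z \<Longrightarrow>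
    (polygon_norm W (lprod xs + \<zeta>))\<^sup>2 \<le> (plen xs)\<^sup>2 + C * norm \<zeta>"
proof -
  obtain C where C: "C \<ge> 0" "\<And>W xs \<zeta> \<epsilon>. admissible W \<Longrightarrow> xs \<in> lists W \<Longrightarrow> \<zeta> \<in> Z \<Longrightarrow> \<epsilon> > 0 \<Longrightarrow>
      \<exists>ys\<in>lists W. lprod ys = lprod xs + \<zeta> \<and> (plen ys)\<^sup>2 \<le> (plen xs)\<^sup>2 + \<epsilon> + C * norm \<zeta>"
    by (rule center_correction, rule that)
  have "(polygon_norm W (lprod xs + \<zeta>))\<^sup>2 \<le> (plen xs)\<^sup>2 + C * norm \<zeta>"
    if "admissible W" "xs \<in> lists W" "\<zeta> \<in> Z" for W xs \<zeta>
  proof (rule field_le_epsilon)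
    fix e :: real assume "e > 0"
    then obtain ys where ys: "ys \<in> lists W" "lprod ys = lprod xs + \<zeta>" "(plen ys)\<^sup>2 \<le> (plen xs)\<^sup>2 + e + C * norm \<zeta>"
      using C(2) \<open>admissible W\<close> \<open>xs \<in> lists W\<close> \<open>\<zeta> \<in> Z\<close> by blast
    have "(polygon_norm W (lprod ys))\<^sup>2 \<le> (plen ys)\<^sup>2"
      using polygon_norm_le_plen[OF ys(1)] polygon_norm_nonneg[OF \<open>admissible W\<close>] by (intro power_mono) auto
    then show "(polygon_norm W (lprod xs + \<zeta>))\<^sup>2 \<le> (plen xs)\<^sup>2 + C * norm \<zeta> + e" using ys by simp
  qed
  then show ?thesis using that C by blast
qed

text \<open>A point near \<open>0\<close> is reached by one short edge in \<open>V\<close> followed by a small central displacement, whose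
cost is of the order of the square root of its size.\<close>

lemma polygon_norm_small:
  assumes W: "admissible W" and "e > 0"
  obtains \<delta> where "\<delta> > 0" "\<And>y. norm y < \<delta> \<Longrightarrow> polygon_norm W y < e"
proof -
  obtain C where C: "C \<ge> 0" "\<And>W xs \<zeta>. admissible W \<Longrightarrow> xs \<in> lists W \<Longrightarrow> \<zeta> \<in> Z \<Longrightarrow>
    (polygon_norm W (lprod xs + \<zeta>))\<^sup>2 \<le> (plen xs)\<^sup>2 + C * norm \<zeta>" by (rule polygon_norm_correction, rule that)
  obtain P K where P: "linear P" "K \<ge> 0" "\<And>x. P x \<in> V" "\<And>x. x - P x \<in> Z" "\<And>x. norm (P x) \<le> K * norm x"
    "\<And>x. norm (x - P x) \<le> K * norm x" by (rule bounded_projection, rule that)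
  obtain B where B: "B > 0" "\<And>x. nrm x \<le> B * norm x" by (rule nrm_upper, rule that)
  have bound: "(polygon_norm W y)\<^sup>2 \<le> (B * (K * norm y))\<^sup>2 + C * (K * norm y)" for y
  proof -
    have "(polygon_norm W (lprod [P y] + (y - P y)))\<^sup>2 \<le> (plen [P y])\<^sup>2 + C * norm (y - P y)"
      using W P(3,4)[of y] by (intro C) (auto simp: admissible_def)
    also have "\<dots> \<le> (B * (K * norm y))\<^sup>2 + C * (K * norm y)"
    proof (intro add_mono power_mono mult_left_mono)
      show "plen [P y] \<le> B * (K * norm y)"
        using order_trans[OF B(2)[of "P y"] mult_left_mono[OF P(5)[of y] less_imp_le[OF B(1)]]] by simp
    qed (use P C in auto)
    finally show ?thesis by simp
  qed
  have "isCont (\<lambda>y::'e. (B * (K * norm y))\<^sup>2 + C * (K * norm y)) 0"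
    by (intro continuous_intros)
  then have "\<forall>\<^sub>F y in at (0::'e). (B * (K * norm y))\<^sup>2 + C * (K * norm y) < e\<^sup>2"
    using \<open>e > 0\<close> unfolding isCont_def by (intro order_tendstoD(2)) auto
  then obtain \<delta> where \<delta>: "\<delta> > 0" "\<And>y::'e. y \<noteq> 0 \<Longrightarrow> norm y < \<delta> \<Longrightarrow> (B * (K * norm y))\<^sup>2 + C * (K * norm y) < e\<^sup>2"
    by (auto simp: eventually_at dist_norm)
  have "polygon_norm W y < e" if "norm y < \<delta>" for y
  proof (cases "y = 0")
    case True then show ?thesis using polygon_norm_zero[OF W] \<open>e > 0\<close> by simp
  next
    case False
    have "(polygon_norm W y)\<^sup>2 < e\<^sup>2" using bound[of y] \<delta>(2)[OF False that] by linarith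
    then show ?thesis using \<open>e > 0\<close> by (simp add: power2_less_imp_less)
  qed
  then show ?thesis using that \<delta> by blast
qed

lemma polygon_norm_antimono:
  assumes "admissible W" "admissible W'" "W \<subseteq> W'"
  shows "polygon_norm W' y \<le> polygon_norm W y"
  by (rule le_polygon_norm[OF assms(1)]) (use polygon_norm_le_plen[of _ W'] assms(3) in auto)

text \<open>The gain \<open>r(w, w)\<close> of a polygon in \<open>\<Delta>\<close> over its projection to \<open>V\<close> is quadratic in the central part
\<open>w\<close>, the cost of restoring \<open>w\<close> is linear, and \<open>2 s t \<le> s\<^sup>2 + t\<^sup>2\<close> bounds the difference.\<close>

theorem polygon_norm_V_le_\<Delta>:
  obtains C where "\<And>y. (polygon_norm V y)\<^sup>2 \<le> (polygon_norm \<Delta> y)\<^sup>2 + C"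
proof -
  obtain C where C: "C \<ge> 0" "\<And>W xs \<zeta>. admissible W \<Longrightarrow> xs \<in> lists W \<Longrightarrow> \<zeta> \<in> Z \<Longrightarrow>
    (polygon_norm W (lprod xs + \<zeta>))\<^sup>2 \<le> (plen xs)\<^sup>2 + C * norm \<zeta>" by (rule polygon_norm_correction, rule that)
  obtain c where c: "c > 0" "\<And>x. x \<in> \<Delta> \<Longrightarrow> c * norm x \<le> nrm x" by (rule nrm_lower, rule that)
  define t where "t = C / c"
  have t: "t \<ge> 0" using C(1) c(1) by (simp add: t_def)
  \<comment> \<open>an upper bound of \<open>C \<bar>w\<bar> - (nrm w)\<^sup>2\<close>\<close>
  define D where "D = (C / c)\<^sup>2"
  have poly: "(polygon_norm V (lprod xs))\<^sup>2 \<le> (plen xs)\<^sup>2 + D" if xs: "xs \<in> lists \<Delta>" for xs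
  proof -
    obtain vs w where vw: "vs \<in> lists V" "w \<in> \<Delta> \<inter> Z" "lprod xs = lprod vs + w"
      "(plen vs)\<^sup>2 + (nrm w)\<^sup>2 \<le> (plen xs)\<^sup>2"
      using \<Delta>_polygon_decomposition[OF xs] by blast
    have "C * norm w \<le> C * (nrm w / c)"
      using c vw(2) C(1) by (intro mult_left_mono) (auto simp: pos_le_divide_eq mult.commute)
    also have "\<dots> = nrm w * t" by (simp add: t_def)
    also have "\<dots> \<le> 2 * nrm w * t"
      using mult_nonneg_nonneg[OF nrm_nonneg[of w] t] by linarith
    also have "\<dots> \<le> (nrm w)\<^sup>2 + D" unfolding D_def t_def by (rule sum_squares_bound)
    finally have "C * norm w \<le> (nrm w)\<^sup>2 + D" .
    then show ?thesis using C(2)[OF admissible_V vw(1), of w] vw by auto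
  qed
  have "(polygon_norm V y)\<^sup>2 \<le> (polygon_norm \<Delta> y)\<^sup>2 + D" for y
  proof -
    have "sqrt ((polygon_norm V y)\<^sup>2 - D) \<le> polygon_norm \<Delta> y"
    proof (rule le_polygon_norm[OF admissible_\<Delta>])
      fix xs assume "xs \<in> lists \<Delta>" "lprod xs = y"
      then show "sqrt ((polygon_norm V y)\<^sup>2 - D) \<le> plen xs" using poly[of xs] by (intro real_le_lsqrt) auto
    qed
    then show ?thesis using sqrt_le_D by fastforce
  qed
  then show ?thesis using that by blast
qed

end

section \<open>Horofunctions of proper length distances\<close>

lemma topspace_compact_convergence:
  "topspace (compact_convergence :: ('g::topological_space \<Rightarrow> real) topology) = {f. continuous_on UNIV f}"
proof -
  let ?B = "\<lambda>f K \<epsilon>. {g. continuous_on UNIV g \<and> (\<forall>y\<in>K. \<bar>g y - f y\<bar> < \<epsilon>)}"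
  show ?thesis
    unfolding compact_convergence_def topology_generated_by_topspace
  proof (intro equalityI subsetI)
    fix f :: "'g \<Rightarrow> real" assume "f \<in> {f. continuous_on UNIV f}"
    then show "f \<in> \<Union> {?B f K \<epsilon> |f K \<epsilon>. continuous_on UNIV f \<and> compact K \<and> \<epsilon> > 0}"
      by (intro UnionI[of "?B f {} 1"] CollectI exI[of _ f] exI[of _ "{}"] exI[of _ "1::real"]) auto
  qed blast
qed

text \<open>The generating sets are centred at arbitrary functions \<open>f\<close>. By compactness of \<open>K\<close> the strict
inequality \<open>\<bar>h - f\<bar> < \<epsilon>\<close> leaves room for a neighbourhood centred at \<open>h\<close> itself.\<close>

lemma compact_convergence_neighbourhood:
  fixes h :: "'g::topological_space \<Rightarrow> real"
  assumes "generate_topology_on {{g. continuous_on UNIV g \<and> (\<forall>y\<in>K. \<bar>g y - f y\<bar> < \<epsilon>)} | f K \<epsilon>.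
        continuous_on UNIV f \<and> compact K \<and> \<epsilon> > 0} T"
    and "continuous_on UNIV h" "h \<in> T"
  shows "\<exists>K \<epsilon>. compact K \<and> \<epsilon> > 0 \<and> {g. continuous_on UNIV g \<and> (\<forall>y\<in>K. \<bar>g y - h y\<bar> < \<epsilon>)} \<subseteq> T"
  using assms(1,3)
proof (induction rule: generate_topology_on.induct)
  case Empty then show ?case by simp
next
  case (Int S T)
  have hST: "h \<in> S" "h \<in> T" using Int.prems by auto
  obtain K \<epsilon> where 1: "compact K" "\<epsilon> > 0" "{g. continuous_on UNIV g \<and> (\<forall>y\<in>K. \<bar>g y - h y\<bar> < \<epsilon>)} \<subseteq> S"
    using Int.IH(1)[OF hST(1)] by blast
  obtain K' \<epsilon>' where 2: "compact K'" "\<epsilon>' > 0" "{g. continuous_on UNIV g \<and> (\<forall>y\<in>K'. \<bar>g y - h y\<bar> < \<epsilon>')} \<subseteq> T"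
    using Int.IH(2)[OF hST(2)] by blast
  have "{g. continuous_on UNIV g \<and> (\<forall>y\<in>K \<union> K'. \<bar>g y - h y\<bar> < min \<epsilon> \<epsilon>')} \<subseteq> S \<inter> T"
    using 1(3) 2(3) by fastforce
  moreover have "compact (K \<union> K')" "min \<epsilon> \<epsilon>' > 0" using 1 2 by (auto intro: compact_Un)
  ultimately show ?case by blast
next
  case (UN K)
  then obtain S where S: "S \<in> K" "h \<in> S" by blast
  then show ?case using UN.IH[OF S] by (meson Union_upper order_trans)
next
  case (Basis S)
  then obtain f K \<epsilon> where S: "S = {g. continuous_on UNIV g \<and> (\<forall>y\<in>K. \<bar>g y - f y\<bar> < \<epsilon>)}"
    "continuous_on UNIV f" "compact K" "\<epsilon> > 0" by blast
  have hf: "\<bar>h y - f y\<bar> < \<epsilon>" if "y \<in> K" for y using Basis.prems S(1) that by blast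
  have "\<exists>\<delta>>0. \<forall>y\<in>K. \<bar>h y - f y\<bar> + \<delta> \<le> \<epsilon>"
  proof (cases "K = {}")
    case True then show ?thesis by (intro exI[of _ 1]) simp
  next
    case False
    have "continuous_on K (\<lambda>y. \<bar>h y - f y\<bar>)"
      by (intro continuous_intros continuous_on_subset[OF S(2)] continuous_on_subset[OF assms(2)]) auto
    then obtain y0 where "y0 \<in> K" "\<And>y. y \<in> K \<Longrightarrow> \<bar>h y - f y\<bar> \<le> \<bar>h y0 - f y0\<bar>"
      using continuous_attains_sup[OF S(3) False] by blast
    then show ?thesis using hf[of y0] by (intro exI[of _ "\<epsilon> - \<bar>h y0 - f y0\<bar>"]) auto
  qed
  then obtain \<delta> where \<delta>: "\<delta> > 0" "\<And>y. y \<in> K \<Longrightarrow> \<bar>h y - f y\<bar> + \<delta> \<le> \<epsilon>" by blast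
  have "{g. continuous_on UNIV g \<and> (\<forall>y\<in>K. \<bar>g y - h y\<bar> < \<delta>)} \<subseteq> S"
    unfolding S(1) using \<delta>(2) by (smt (verit) Collect_mono)
  then show ?case using S(3) \<delta>(1) by blast
qed

lemma in_closure_compact_convergence:
  "h \<in> compact_convergence closure_of S \<longleftrightarrow> continuous_on UNIV h \<and>
    (\<forall>K \<epsilon>. compact K \<and> \<epsilon> > 0 \<longrightarrow> (\<exists>g\<in>S. continuous_on UNIV g \<and> (\<forall>y\<in>K. \<bar>g y - h y\<bar> < \<epsilon>)))"
  (is "_ \<longleftrightarrow> ?c \<and> ?R")
proof (intro iffI conjI)
  assume h: "h \<in> compact_convergence closure_of S"
  then show c: ?c using topspace_compact_convergence by (auto simp: in_closure_of)
  show ?R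
  proof (intro allI impI)
    fix K :: "'a set" and \<epsilon> :: real assume K: "compact K \<and> \<epsilon> > 0"
    let ?T = "{g. continuous_on UNIV g \<and> (\<forall>y\<in>K. \<bar>g y - h y\<bar> < \<epsilon>)}"
    have T: "openin compact_convergence ?T"
      unfolding compact_convergence_def openin_topology_generated_by_iff
      using c K by (intro generate_topology_on.Basis) blast
    have "h \<in> ?T" using c K by simp
    then have "\<exists>g. g \<in> S \<and> g \<in> ?T"
      using h[unfolded in_closure_of, THEN conjunct2, THEN spec, THEN mp, OF conjI, OF _ T] by simp
    then show "\<exists>g\<in>S. continuous_on UNIV g \<and> (\<forall>y\<in>K. \<bar>g y - h y\<bar> < \<epsilon>)" by blast
  qed
next
  assume *: "?c \<and> ?R"
  show "h \<in> compact_convergence closure_of S"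
    unfolding in_closure_of topspace_compact_convergence
  proof (intro conjI allI impI)
    fix T assume "h \<in> T \<and> openin compact_convergence T"
    then have T: "h \<in> T" "generate_topology_on {{g. continuous_on UNIV g \<and> (\<forall>y\<in>K. \<bar>g y - f y\<bar> < \<epsilon>)} | f K \<epsilon>.
        continuous_on UNIV f \<and> compact K \<and> \<epsilon> > 0} T"
      unfolding compact_convergence_def openin_topology_generated_by_iff by simp_all
    obtain K \<epsilon> where K: "compact K" "\<epsilon> > 0" "{g. continuous_on UNIV g \<and> (\<forall>y\<in>K. \<bar>g y - h y\<bar> < \<epsilon>)} \<subseteq> T"
      using compact_convergence_neighbourhood[OF T(2) conjunct1[OF *] T(1)] by blast
    obtain g where "g \<in> S" "continuous_on UNIV g \<and> (\<forall>y\<in>K. \<bar>g y - h y\<bar> < \<epsilon>)"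
      using conjunct2[OF *] K(1,2) by blast
    then show "\<exists>y. y \<in> S \<and> y \<in> T" using K(3) by blast
  qed (use * in simp)
qed

text \<open>The properties of a proper length distance which induces the topology, as far as horofunctions are
concerned; \<open>split\<close> expresses that there are almost minimizing paths.\<close>

locale proper_length_distance =
  fixes d :: "'g::{t2_space, first_countable_topology} \<Rightarrow> 'g \<Rightarrow> real" and o\<^sub>0 :: 'g
  assumes refl: "d x x = 0" and sym: "d x y = d y x" and triangle: "d x z \<le> d x y + d y z"
    and cont: "continuous_on UNIV (d x)"
    and proper: "\<exists>K. compact K \<and> {x. d o\<^sub>0 x \<le> R} \<subseteq> K"
    and split: "0 \<le> t \<Longrightarrow> t \<le> d x y \<Longrightarrow> \<epsilon> > 0 \<Longrightarrow> \<exists>z. d x z \<le> t \<and> d z y \<le> d x y - t + \<epsilon>"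
begin

lemma nonneg: "0 \<le> d x y"
  using triangle[of x x y] refl[of x] sym[of x y] by simp

lemma horo_continuous: "continuous_on UNIV (horo_embedding o\<^sub>0 d x)"
  unfolding horo_embedding_def by (intro continuous_intros cont)

lemma compact_ball: "compact {x. d o\<^sub>0 x \<le> R}"
proof -
  obtain K where K: "compact K" "{x. d o\<^sub>0 x \<le> R} \<subseteq> K" using proper by blast
  have "closed {x. d o\<^sub>0 x \<le> R}" by (intro closed_Collect_le cont continuous_on_const)
  then show ?thesis using K by (metis compact_Int_closed inf.absorb2)
qed

lemma compact_bounded:
  assumes "compact K" obtains R where "R \<ge> 0" "\<And>x. x \<in> K \<Longrightarrow> d o\<^sub>0 x \<le> R"
proof (cases "K = {}")
  case True then show ?thesis using that[of 0] by simp
next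
  case False
  then obtain x where "x \<in> K" "\<And>y. y \<in> K \<Longrightarrow> d o\<^sub>0 y \<le> d o\<^sub>0 x"
    using continuous_attains_sup[OF assms False continuous_on_subset[OF cont subset_UNIV]] by blast
  then show ?thesis using that[of "d o\<^sub>0 x"] nonneg by blast
qed

text \<open>If all good approximations of \<open>h\<close> stayed in a ball, a subsequence of their base points would converge
to some \<open>l\<close>, and \<open>h\<close> would be the function of \<open>l\<close>, which the horoboundary excludes.\<close>

lemma horoboundary_escape:
  assumes h: "h \<in> horoboundary o\<^sub>0 d" and K: "compact K" and \<epsilon>: "\<epsilon> > 0"
  shows "\<exists>x. d o\<^sub>0 x > R \<and> (\<forall>y\<in>K. \<bar>horo_embedding o\<^sub>0 d x y - h y\<bar> < \<epsilon>)"
proof (rule ccontr)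
  assume contr: "\<not> ?thesis"
  have hc: "\<And>K \<epsilon>. compact K \<Longrightarrow> \<epsilon> > 0 \<Longrightarrow> \<exists>x. \<forall>y\<in>K. \<bar>horo_embedding o\<^sub>0 d x y - h y\<bar> < \<epsilon>"
    and hr: "h \<notin> range (horo_embedding o\<^sub>0 d)"
    using h unfolding horoboundary_def Diff_iff in_closure_compact_convergence by blast+
  define B where "B n = {x. d o\<^sub>0 x \<le> real n}" for n
  have "\<exists>x. \<forall>y\<in>K \<union> B n. \<bar>horo_embedding o\<^sub>0 d x y - h y\<bar> < min \<epsilon> (1 / real (Suc n))" for n
    using K \<epsilon> compact_ball[of "real n"] by (intro hc compact_Un) (auto simp: B_def)
  then obtain x where x: "\<And>n y. y \<in> K \<union> B n \<Longrightarrow> \<bar>horo_embedding o\<^sub>0 d (x n) y - h y\<bar> < min \<epsilon> (1 / real (Suc n))"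
    by metis
  have "x n \<in> {x. d o\<^sub>0 x \<le> R}" for n
  proof (rule ccontr)
    assume "x n \<notin> {x. d o\<^sub>0 x \<le> R}"
    then show False using contr x[of _ n] by (auto simp: not_le)
  qed
  then obtain l \<sigma> where l: "strict_mono \<sigma>" "((x \<circ> \<sigma>) \<longlongrightarrow> l) sequentially"
    using compact_imp_seq_compact[OF compact_ball[of R]] unfolding seq_compact_def by metis
  have "h y = horo_embedding o\<^sub>0 d l y" for y
  proof -
    have lim: "(\<lambda>n. d z (x (\<sigma> n))) \<longlonglongrightarrow> d z l" for z
      using continuous_on_tendsto_compose[OF cont[of z] l(2)] by (simp add: o_def)
    have "(\<lambda>n. horo_embedding o\<^sub>0 d (x (\<sigma> n)) y) \<longlonglongrightarrow> horo_embedding o\<^sub>0 d l y"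
      unfolding horo_embedding_def sym[of _ y] sym[of _ o\<^sub>0] by (intro tendsto_diff lim)
    moreover have "(\<lambda>n. horo_embedding o\<^sub>0 d (x (\<sigma> n)) y) \<longlonglongrightarrow> h y"
    proof -
      obtain m where m: "d o\<^sub>0 y \<le> real m" using real_arch_simple by blast
      have "(\<lambda>n. horo_embedding o\<^sub>0 d (x n) y - h y) \<longlonglongrightarrow> 0"
      proof (rule Lim_null_comparison)
        show "(\<lambda>n. 1 / real (Suc n)) \<longlonglongrightarrow> 0" using LIMSEQ_inverse_real_of_nat by (simp add: inverse_eq_divide)
        show "\<forall>\<^sub>F n in sequentially. norm (horo_embedding o\<^sub>0 d (x n) y - h y) \<le> 1 / real (Suc n)"
          using eventually_ge_at_top[of m]
        proof (rule eventually_mono)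
          fix n assume "m \<le> n"
          then have "y \<in> K \<union> B n" using m by (auto simp: B_def)
          from x[OF this] show "norm (horo_embedding o\<^sub>0 d (x n) y - h y) \<le> 1 / real (Suc n)" by simp
        qed
      qed
      then have "(\<lambda>n. horo_embedding o\<^sub>0 d (x n) y) \<longlonglongrightarrow> h y" by (simp add: LIM_zero_iff)
      from LIMSEQ_subseq_LIMSEQ[OF this l(1)] show ?thesis by (simp add: o_def)
    qed
    ultimately show ?thesis using LIMSEQ_unique by blast
  qed
  then have "h = horo_embedding o\<^sub>0 d l" by blast
  then show False using hr by blast
qed

text \<open>Going a distance \<open>R\<close> from \<open>o\<^sub>0\<close> towards a far away base point lowers the function of that point by
almost \<open>R\<close>. This separates horofunctions from the functions \<open>d x y - d x o\<^sub>0\<close> of any distance, which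
are bounded below.\<close>

lemma horoboundary_unbounded_below:
  assumes h: "h \<in> horoboundary o\<^sub>0 d"
  shows "\<exists>y. h y < - t"
proof -
  \<comment> \<open>two units are lost to the approximations, the third makes the inequality strict\<close>
  define R where "R = max 0 t + 3"
  obtain x where x: "d o\<^sub>0 x > R" "\<And>y. d o\<^sub>0 y \<le> R \<Longrightarrow> \<bar>horo_embedding o\<^sub>0 d x y - h y\<bar> < 1"
    using horoboundary_escape[OF h compact_ball[of R] zero_less_one, of R] by auto
  obtain z where z: "d o\<^sub>0 z \<le> R" "d z x \<le> d o\<^sub>0 x - R + 1"
    using split[of R o\<^sub>0 x 1] x(1) by (auto simp: R_def)
  have "horo_embedding o\<^sub>0 d x z \<le> - R + 1" using z(2) by (simp add: horo_embedding_def sym[of x])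
  then have "h z < - t" using x(2)[OF z(1)] by (auto simp: R_def)
  then show ?thesis by blast
qed

end

lemma horoboundary_subset:
  assumes d: "proper_length_distance d o\<^sub>0" and d': "proper_length_distance d' o\<^sub>0"
    and C: "\<And>x y. \<bar>(d x y)\<^sup>2 - (d' x y)\<^sup>2\<bar> \<le> C"
  shows "horoboundary o\<^sub>0 d \<subseteq> horoboundary o\<^sub>0 d'"
proof
  interpret d: proper_length_distance d o\<^sub>0 by (rule d)
  interpret d': proper_length_distance d' o\<^sub>0 by (rule d')
  fix h assume h: "h \<in> horoboundary o\<^sub>0 d"
  have "0 \<le> C" using order_trans[OF abs_ge_zero C] .
  have close: "\<bar>d x y - d' x y\<bar> \<le> C / R" if "R > 0" "d x y \<ge> R" for R x y
  proof -
    have p: "d x y + d' x y \<ge> R" using that d'.nonneg[of x y] by simp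
    have "\<bar>d x y - d' x y\<bar> * R \<le> \<bar>d x y - d' x y\<bar> * (d x y + d' x y)"
      using p by (intro mult_left_mono) auto
    also have "\<dots> = \<bar>(d x y)\<^sup>2 - (d' x y)\<^sup>2\<bar>"
      using p that(1) by (simp add: power2_eq_square square_diff_square_factored abs_mult mult.commute)
    also have "\<dots> \<le> C" by (rule C)
    finally show ?thesis using that(1) by (simp add: pos_le_divide_eq)
  qed
  have approx: "\<exists>x. \<forall>y\<in>K. \<bar>horo_embedding o\<^sub>0 d' x y - h y\<bar> < \<epsilon>" if K: "compact K" and \<epsilon>: "\<epsilon> > 0" for K \<epsilon>
  proof -
    obtain R0 where R0: "R0 \<ge> 0" "\<And>y. y \<in> K \<Longrightarrow> d o\<^sub>0 y \<le> R0" by (rule d.compact_bounded[OF K], rule that)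
    define R where "R = 4 * C / \<epsilon> + 1"
    have R: "R > 0" "C / R < \<epsilon> / 4" using \<epsilon> \<open>0 \<le> C\<close> by (auto simp: R_def add_nonneg_pos field_simps)
    obtain x where x: "d o\<^sub>0 x > R + R0" "\<And>y. y \<in> K \<Longrightarrow> \<bar>horo_embedding o\<^sub>0 d x y - h y\<bar> < \<epsilon> / 2"
      using d.horoboundary_escape[OF h K, of "\<epsilon> / 2" "R + R0"] \<epsilon> by auto
    have "\<bar>horo_embedding o\<^sub>0 d' x y - h y\<bar> < \<epsilon>" if y: "y \<in> K" for y
    proof -
      have "d x y \<ge> R" using d.triangle[of o\<^sub>0 x y] d.sym[of x y] R0(2)[OF y] x(1) by linarith
      then have 1: "\<bar>d x y - d' x y\<bar> \<le> C / R" using close R(1) by blast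
      have "d x o\<^sub>0 \<ge> R" using x(1) R0(1) d.sym[of x o\<^sub>0] by linarith
      then have 2: "\<bar>d x o\<^sub>0 - d' x o\<^sub>0\<bar> \<le> C / R" using close R(1) by blast
      show ?thesis using 1 2 R(2) x(2)[OF y] unfolding horo_embedding_def by linarith
    qed
    then show ?thesis by blast
  qed
  have hc: "continuous_on UNIV h" using h unfolding horoboundary_def Diff_iff in_closure_compact_convergence by blast
  have "h \<in> compact_convergence closure_of range (horo_embedding o\<^sub>0 d')"
    unfolding in_closure_compact_convergence
  proof (intro conjI allI impI)
    fix K :: "'a set" and \<epsilon> :: real assume K: "compact K \<and> \<epsilon> > 0"
    obtain x where "\<forall>y\<in>K. \<bar>horo_embedding o\<^sub>0 d' x y - h y\<bar> < \<epsilon>"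
      using approx[OF conjunct1[OF K] conjunct2[OF K]] by (rule exE)
    then show "\<exists>g\<in>range (horo_embedding o\<^sub>0 d'). continuous_on UNIV g \<and> (\<forall>y\<in>K. \<bar>g y - h y\<bar> < \<epsilon>)"
      using d'.horo_continuous[of x] by (intro bexI[of _ "horo_embedding o\<^sub>0 d' x"]) auto
  qed (rule hc)
  moreover have "h \<notin> range (horo_embedding o\<^sub>0 d')"
  proof
    assume "h \<in> range (horo_embedding o\<^sub>0 d')"
    then obtain x where "h = horo_embedding o\<^sub>0 d' x" by blast
    then have "h y \<ge> - d' x o\<^sub>0" for y using d'.nonneg[of x y] by (simp add: horo_embedding_def)
    then show False using d.horoboundary_unbounded_below[OF h, of "d' x o\<^sub>0"] by (metis not_le)
  qed
  ultimately show "h \<in> horoboundary o\<^sub>0 d'" by (simp add: horoboundary_def)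
qed

theorem horoboundary_eq:
  assumes "proper_length_distance d o\<^sub>0" "proper_length_distance d' o\<^sub>0"
    and "\<And>x y. \<bar>(d x y)\<^sup>2 - (d' x y)\<^sup>2\<bar> \<le> C"
  shows "horoboundary o\<^sub>0 d = horoboundary o\<^sub>0 d'"
  using horoboundary_subset[OF assms] horoboundary_subset[OF assms(2,1), of C] assms(3)
  by (simp add: abs_minus_commute subset_antisym)

section \<open>Differential calculus\<close>

lemma projection_along_subspace:
  assumes S: "subspace (S :: 'a::euclidean_space set)"
  shows "\<exists>P. linear P \<and> (\<forall>z\<in>S. P z = 0) \<and> (\<forall>x. x - P x \<in> S)"
proof -
  have "\<exists>z. b - z \<in> S \<and> (\<forall>w\<in>S. orthogonal z w)" for b
  proof -
    obtain y z where "y \<in> span S" "\<And>w. w \<in> span S \<Longrightarrow> orthogonal z w" "b = y + z"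
      by (rule orthogonal_subspace_decomp_exists[of S b], rule that)
    then show ?thesis using span_eq_iff[THEN iffD2, OF S] by (intro exI[of _ z]) simp
  qed
  then obtain p where p: "\<And>b. b - p b \<in> S" "\<And>b w. w \<in> S \<Longrightarrow> orthogonal (p b) w" by metis
  define P where "P x = (\<Sum>b\<in>Basis. (x \<bullet> b) *\<^sub>R p b)" for x
  have lin: "linear P" unfolding P_def
    by (auto intro!: linearI simp: inner_add_left scaleR_add_left sum.distrib scaleR_sum_right)
  have 2: "x - P x \<in> S" for x
  proof -
    have "x - P x = (\<Sum>b\<in>Basis. (x \<bullet> b) *\<^sub>R (b - p b))"
      by (simp add: P_def scaleR_diff_right sum_subtractf euclidean_representation)
    then show ?thesis using S p by (auto intro!: subspace_sum subspace_scale)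
  qed
  have orth: "orthogonal (P x) w" if "w \<in> S" for x w
    unfolding P_def orthogonal_def using p(2)[OF that] by (simp add: inner_sum_left orthogonal_def)
  have "P z = 0" if "z \<in> S" for z
  proof -
    have "z - (z - P z) \<in> S" using subspace_diff[OF S that 2] .
    then have "P z \<in> S" by simp
    then show ?thesis using orth[of "P z" z] by (simp add: orthogonal_def)
  qed
  then show ?thesis using lin 2 by blast
qed

text \<open>The unfolded form of smoothness in which it is used: derivatives exist, and are smooth again.\<close>

lemma smooth_onD:
  assumes "smooth_on S f"
  shows "open S" "continuous_on S f"
    "x \<in> S \<Longrightarrow> (f has_derivative frechet_derivative f (at x)) (at x)"
    "smooth_on S (\<lambda>x. frechet_derivative f (at x) v)"
proof -
  have *: "open S" "\<And>k. C_k_on k f S" using assms by (auto simp: smooth_on_def)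
  show "open S" by (rule *)
  show "continuous_on S f" using *(2)[of 0] by simp
  show "(f has_derivative frechet_derivative f (at x)) (at x)" if "x \<in> S"
    using *(2)[of 1] that by (auto simp: frechet_derivative_works)
  show "smooth_on S (\<lambda>x. frechet_derivative f (at x) v)"
    unfolding smooth_on_def
  proof (intro conjI allI)
    fix k show "C_k_on k (\<lambda>x. frechet_derivative f (at x) v) S" using *(2)[of "Suc k"] by simp
  qed (rule *)
qed

lemma continuous_on_Blinfun_componentwise:
  fixes D :: "'a::t2_space \<Rightarrow> 'b::euclidean_space \<Rightarrow> 'c::euclidean_space"
  assumes "\<And>x. x \<in> S \<Longrightarrow> bounded_linear (D x)" "\<And>v. continuous_on S (\<lambda>x. D x v)"
  shows "continuous_on S (\<lambda>x. Blinfun (D x))"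
proof (rule continuous_on_blinfun_componentwise)
  fix i :: 'b
  show "continuous_on S (\<lambda>x. blinfun_apply (Blinfun (D x)) i)"
    using assms(2)[of i] by (rule continuous_on_eq) (simp add: bounded_linear_Blinfun_apply assms(1))
qed

lemma C1_locally_lipschitz:
  fixes f :: "'a::euclidean_space \<Rightarrow> 'b::euclidean_space"
  assumes "open S" "z \<in> S"
    and der: "\<And>x. x \<in> S \<Longrightarrow> (f has_derivative D x) (at x)"
    and cont: "\<And>v. continuous_on S (\<lambda>x. D x v)"
  obtains r L where "r > 0" "ball z r \<subseteq> S" "L \<ge> 0" "L-lipschitz_on (ball z r) f"
proof -
  have bl: "bounded_linear (D x)" if "x \<in> S" for x using der[OF that] by (rule has_derivative_bounded_linear)
  let ?B = "\<lambda>x. Blinfun (D x)"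
  have "continuous_on S ?B" using bl cont by (rule continuous_on_Blinfun_componentwise)
  then have "isCont ?B z" using assms by (simp add: continuous_on_eq_continuous_at)
  then obtain d where d: "d > 0" "\<And>x. dist x z < d \<Longrightarrow> dist (?B x) (?B z) < 1"
    by (auto simp: continuous_at_eps_delta dest!: spec[of _ 1])
  obtain e where e: "e > 0" "ball z e \<subseteq> S" using assms open_contains_ball by blast
  define r L where "r = min d e" and "L = norm (?B z) + 1"
  have sub: "ball z r \<subseteq> S" using e by (auto simp: r_def)
  have on: "onorm (D x) \<le> L" if "x \<in> ball z r" for x
  proof -
    have "dist (?B x) (?B z) < 1" using that by (intro d) (auto simp: r_def dist_commute)
    then have "norm (?B x) \<le> L" unfolding L_def using norm_triangle_sub[of "?B x" "?B z"] by (simp add: dist_norm)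
    moreover have "x \<in> S" using that sub by auto
    ultimately show ?thesis using bl by (simp add: norm_blinfun.rep_eq bounded_linear_Blinfun_apply)
  qed
  have "L-lipschitz_on (ball z r) f"
  proof (rule lipschitz_onI)
    fix x y assume xy: "x \<in> ball z r" "y \<in> ball z r"
    have "norm (f x - f y) \<le> L * norm (x - y)"
    proof (rule differentiable_bound[of "ball z r" f D L])
      show "(f has_derivative D w) (at w within ball z r)" if "w \<in> ball z r" for w
        using has_derivative_at_withinI[OF der[of w]] that sub by blast
    qed (use xy on in auto)
    then show "dist (f x) (f y) \<le> L * dist x y" by (simp add: dist_norm)
  qed (simp add: L_def)
  then show ?thesis using that[of r L] d e sub by (simp add: r_def L_def)
qed

text \<open>A product rule for \<open>T(y)(g(y))\<close> in which only the evaluations of the linear maps \<open>T(y)\<close> at fixed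
vectors are known to be differentiable.\<close>

lemma has_derivative_linear_family:
  fixes T :: "'a::real_normed_vector \<Rightarrow> 'b::euclidean_space \<Rightarrow> 'c::real_normed_vector"
  assumes S: "open S" "x \<in> S" and lin: "\<And>y. y \<in> S \<Longrightarrow> linear (T y)"
    and T': "\<And>b. ((\<lambda>y. T y b) has_derivative T' b) (at x)"
    and g: "(g has_derivative g') (at x)"
  shows "((\<lambda>y. T y (g y)) has_derivative (\<lambda>h. T' (g x) h + T x (g' h))) (at x)"
proof -
  have expand: "T y b = (\<Sum>i\<in>Basis. (b \<bullet> i) *\<^sub>R T y i)" if "y \<in> S" for y b
  proof -
    have "T y (\<Sum>i\<in>Basis. (b \<bullet> i) *\<^sub>R i) = (\<Sum>i\<in>Basis. (b \<bullet> i) *\<^sub>R T y i)"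
      using lin[OF that] by (simp add: linear_sum linear_cmul)
    then show ?thesis by (simp add: euclidean_representation)
  qed
  have T'_expand: "T' b h = (\<Sum>i\<in>Basis. (b \<bullet> i) *\<^sub>R T' i h)" for b h
  proof -
    have "((\<lambda>y. \<Sum>i\<in>Basis. (b \<bullet> i) *\<^sub>R T y i) has_derivative (\<lambda>h. \<Sum>i\<in>Basis. (b \<bullet> i) *\<^sub>R T' i h)) (at x)"
      by (intro has_derivative_sum has_derivative_scaleR_right T')
    then have "((\<lambda>y. T y b) has_derivative (\<lambda>h. \<Sum>i\<in>Basis. (b \<bullet> i) *\<^sub>R T' i h)) (at x)"
      by (rule has_derivative_transform_within_open[OF _ S]) (simp add: expand[of _ b])
    from has_derivative_unique[OF this T'] show ?thesis by (simp add: fun_eq_iff)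
  qed
  have "((\<lambda>y. \<Sum>i\<in>Basis. (g y \<bullet> i) *\<^sub>R T y i) has_derivative
      (\<lambda>h. \<Sum>i\<in>Basis. (g x \<bullet> i) *\<^sub>R T' i h + (g' h \<bullet> i) *\<^sub>R T x i)) (at x)"
    by (intro has_derivative_sum has_derivative_scaleR has_derivative_inner_left T' g)
  then have "((\<lambda>y. T y (g y)) has_derivative
      (\<lambda>h. \<Sum>i\<in>Basis. (g x \<bullet> i) *\<^sub>R T' i h + (g' h \<bullet> i) *\<^sub>R T x i)) (at x)"
    by (rule has_derivative_transform_within_open[OF _ S]) (simp add: expand[of _ "g _"])
  then show ?thesis
    by (simp add: sum.distrib T'_expand[of "g x"] expand[OF S(2), of "g' _"])
qed

text \<open>The second difference quotient is a second derivative at an intermediate point. The quotient is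
symmetric in \<open>a\<close> and \<open>b\<close>, which gives the symmetry of second derivatives.\<close>

lemma second_difference_mean_value:
  fixes f :: "'a::real_normed_vector \<Rightarrow> real"
  assumes h: "h > 0" and sub: "cball x (h * (norm a + norm b)) \<subseteq> S"
    and D: "\<And>y. y \<in> S \<Longrightarrow> (f has_derivative D y) (at y)"
    and D2: "\<And>y. y \<in> S \<Longrightarrow> ((\<lambda>y. D y a) has_derivative D2 y) (at y)"
  shows "\<exists>y. dist x y \<le> h * (norm a + norm b) \<and>
    f (x + h *\<^sub>R a + h *\<^sub>R b) - f (x + h *\<^sub>R a) - f (x + h *\<^sub>R b) + f x = h\<^sup>2 * D2 y b"
proof -
  have inS: "x + s *\<^sub>R a + t *\<^sub>R b \<in> cball x (h * (norm a + norm b))" if "0 \<le> s" "s \<le> h" "0 \<le> t" "t \<le> h" for s t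
  proof -
    have "norm (s *\<^sub>R a + t *\<^sub>R b) \<le> s * norm a + t * norm b"
      using norm_triangle_ineq[of "s *\<^sub>R a" "t *\<^sub>R b"] that by simp
    also have "\<dots> \<le> h * norm a + h * norm b" using that by (intro add_mono mult_right_mono) auto
    finally show ?thesis by (simp add: dist_norm norm_minus_commute algebra_simps)
  qed
  define g where "g s = f (x + s *\<^sub>R a + h *\<^sub>R b) - f (x + s *\<^sub>R a)" for s
  have shift: "((\<lambda>s. x + s *\<^sub>R a + c) has_derivative (\<lambda>s. s *\<^sub>R a)) (at s)" for s c
    by (auto intro!: derivative_eq_intros)
  have f_shift: "((\<lambda>s. f (x + s *\<^sub>R a + t *\<^sub>R b)) has_derivative (\<lambda>u. D (x + s *\<^sub>R a + t *\<^sub>R b) (u *\<^sub>R a))) (at s)"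
    if "0 \<le> s" "s \<le> h" "0 \<le> t" "t \<le> h" for s t
    using has_derivative_compose[OF shift D] inS[OF that] sub by blast
  have gD: "(g has_real_derivative (D (x + s *\<^sub>R a + h *\<^sub>R b) a - D (x + s *\<^sub>R a) a)) (at s)"
    if s: "0 \<le> s" "s \<le> h" for s
  proof -
    have in1: "x + s *\<^sub>R a + h *\<^sub>R b \<in> S" "x + s *\<^sub>R a \<in> S"
      using inS[of s h] inS[of s 0] sub s h by auto
    have l: "linear (D (x + s *\<^sub>R a + h *\<^sub>R b))" "linear (D (x + s *\<^sub>R a))"
      using D[OF in1(1)] D[OF in1(2)] by (auto dest: has_derivative_linear)
    have "(g has_derivative (\<lambda>u. D (x + s *\<^sub>R a + h *\<^sub>R b) (u *\<^sub>R a) - D (x + s *\<^sub>R a) (u *\<^sub>R a))) (at s)"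
      unfolding g_def using f_shift[of s h] f_shift[of s 0] s h by (auto intro!: has_derivative_diff)
    then show ?thesis
      unfolding has_field_derivative_def
      by (rule has_derivative_eq_rhs) (simp add: fun_eq_iff linear_cmul[OF l(1)] linear_cmul[OF l(2)] right_diff_distrib left_diff_distrib mult.commute)
  qed
  obtain \<xi> where \<xi>: "0 < \<xi>" "\<xi> < h" "g h - g 0 = h * (D (x + \<xi> *\<^sub>R a + h *\<^sub>R b) a - D (x + \<xi> *\<^sub>R a) a)"
    using MVT2[of 0 h g, OF h gD] by auto
  define k where "k t = D (x + \<xi> *\<^sub>R a + t *\<^sub>R b) a" for t
  have kD: "(k has_real_derivative D2 (x + \<xi> *\<^sub>R a + t *\<^sub>R b) b) (at t)" if "0 \<le> t" "t \<le> h" for t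
  proof -
    have in1: "x + \<xi> *\<^sub>R a + t *\<^sub>R b \<in> S" using inS[of \<xi> t] sub \<xi> that by auto
    have l: "linear (D2 (x + \<xi> *\<^sub>R a + t *\<^sub>R b))" using D2[OF in1] by (rule has_derivative_linear)
    have "((\<lambda>t. x + \<xi> *\<^sub>R a + t *\<^sub>R b) has_derivative (\<lambda>t. t *\<^sub>R b)) (at t)"
      by (auto intro!: derivative_eq_intros)
    from has_derivative_compose[OF this D2[OF in1]] show ?thesis
      unfolding k_def has_field_derivative_def
      by (rule has_derivative_eq_rhs) (simp add: fun_eq_iff linear_cmul[OF l])
  qed
  obtain \<eta> where \<eta>: "0 < \<eta>" "\<eta> < h" "k h - k 0 = h * D2 (x + \<xi> *\<^sub>R a + \<eta> *\<^sub>R b) b"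
    using MVT2[of 0 h k, OF h kD] by auto
  have "g h - g 0 = h * (h * D2 (x + \<xi> *\<^sub>R a + \<eta> *\<^sub>R b) b)"
    using \<xi>(3) \<eta>(3) by (simp add: k_def)
  moreover have "f (x + h *\<^sub>R a + h *\<^sub>R b) - f (x + h *\<^sub>R a) - f (x + h *\<^sub>R b) + f x = g h - g 0"
    by (simp add: g_def)
  moreover have "dist x (x + \<xi> *\<^sub>R a + \<eta> *\<^sub>R b) \<le> h * (norm a + norm b)"
    using inS[of \<xi> \<eta>] \<xi> \<eta> by simp
  ultimately show ?thesis
    by (intro exI[of _ "x + \<xi> *\<^sub>R a + \<eta> *\<^sub>R b"]) (simp add: power2_eq_square)
qed

lemma symmetric_second_derivative_real:
  fixes f :: "'a::real_normed_vector \<Rightarrow> real"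
  assumes S: "open S" "x \<in> S"
    and D: "\<And>y. y \<in> S \<Longrightarrow> (f has_derivative D y) (at y)"
    and D2: "\<And>v y. y \<in> S \<Longrightarrow> ((\<lambda>y. D y v) has_derivative D2 v y) (at y)"
    and cont: "\<And>u v. continuous_on S (\<lambda>y. D2 u y v)"
  shows "D2 a x b = D2 b x a"
proof (rule ccontr)
  assume "D2 a x b \<noteq> D2 b x a"
  define e where "e = \<bar>D2 a x b - D2 b x a\<bar> / 2"
  have e: "e > 0" using \<open>D2 a x b \<noteq> D2 b x a\<close> by (simp add: e_def)
  have c: "isCont (\<lambda>y. D2 u y v) x" for u v using cont[of u v] S by (simp add: continuous_on_eq_continuous_at)
  obtain d1 where d1: "d1 > 0" "\<And>y. dist y x < d1 \<Longrightarrow> \<bar>D2 a y b - D2 a x b\<bar> < e"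
    using c[of a b] e unfolding continuous_at_eps_delta dist_real_def by blast
  obtain d2 where d2: "d2 > 0" "\<And>y. dist y x < d2 \<Longrightarrow> \<bar>D2 b y a - D2 b x a\<bar> < e"
    using c[of b a] e unfolding continuous_at_eps_delta dist_real_def by blast
  obtain d3 where d3: "d3 > 0" "ball x d3 \<subseteq> S" using S open_contains_ball by blast
  define d where "d = min d1 (min d2 d3)"
  have d: "d > 0" using d1 d2 d3 by (simp add: d_def)
  define q where "q = norm a + norm b + 1"
  define h where "h = d / (2 * q)"
  have p: "q > 0" by (simp add: q_def add_nonneg_pos)
  have h: "h > 0" using d p by (simp add: h_def)
  have "h * (norm a + norm b) \<le> h * q" using h by (simp add: q_def)
  also have "\<dots> = d / 2" using p by (simp add: h_def)
  finally have hd: "h * (norm a + norm b) < d" using d by linarith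
  have sub: "cball x (h * (norm a + norm b)) \<subseteq> S" "cball x (h * (norm b + norm a)) \<subseteq> S"
    using hd d3(2) by (auto simp: d_def add.commute subset_iff)
  obtain y where y: "dist x y \<le> h * (norm a + norm b)"
    "f (x + h *\<^sub>R a + h *\<^sub>R b) - f (x + h *\<^sub>R a) - f (x + h *\<^sub>R b) + f x = h\<^sup>2 * D2 a y b"
    using second_difference_mean_value[OF h sub(1) D D2] by blast
  obtain z where z: "dist x z \<le> h * (norm b + norm a)"
    "f (x + h *\<^sub>R b + h *\<^sub>R a) - f (x + h *\<^sub>R b) - f (x + h *\<^sub>R a) + f x = h\<^sup>2 * D2 b z a"
    using second_difference_mean_value[OF h sub(2) D D2] by blast
  have "h\<^sup>2 * D2 a y b = h\<^sup>2 * D2 b z a"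
    using y(2) z(2) by (simp add: algebra_simps)
  then have "D2 a y b = D2 b z a" using h by simp
  moreover have "\<bar>D2 a y b - D2 a x b\<bar> < e" using y(1) hd by (intro d1) (simp add: dist_commute d_def)
  moreover have "\<bar>D2 b z a - D2 b x a\<bar> < e" using z(1) hd by (intro d2) (simp add: dist_commute d_def add.commute)
  ultimately show False unfolding e_def by (simp add: abs_if split: if_splits)
qed

lemma symmetric_second_derivative:
  fixes f :: "'a::real_normed_vector \<Rightarrow> 'b::euclidean_space"
  assumes S: "open S" "x \<in> S"
    and D: "\<And>y. y \<in> S \<Longrightarrow> (f has_derivative D y) (at y)"
    and D2: "\<And>v y. y \<in> S \<Longrightarrow> ((\<lambda>y. D y v) has_derivative D2 v y) (at y)"
    and cont: "\<And>u v. continuous_on S (\<lambda>y. D2 u y v)"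
  shows "D2 a x b = D2 b x a"
proof (rule euclidean_eqI)
  fix i :: 'b
  show "D2 a x b \<bullet> i = D2 b x a \<bullet> i"
    by (rule symmetric_second_derivative_real[of S x "\<lambda>y. f y \<bullet> i" "\<lambda>y v. D y v \<bullet> i" "\<lambda>v y u. D2 v y u \<bullet> i"])
      (auto intro!: S has_derivative_inner_left D D2 continuous_on_inner continuous_on_const cont)
qed

text \<open>The primitive is \<open>F(x) = \<integral>\<^sub>0\<^sup>1 \<omega>(x\<^sub>0 + t (x - x\<^sub>0)) (x - x\<^sub>0) dt\<close>. Closedness turns the derivative of
the integrand in a direction \<open>h\<close> into \<open>d/dt (t \<omega>(x\<^sub>0 + t (x - x\<^sub>0)) h)\<close>.\<close>

theorem Poincare_lemma_ball:
  fixes \<omega> :: "'a::euclidean_space \<Rightarrow> 'a \<Rightarrow> 'b::euclidean_space"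
  assumes r: "r > 0"
    and lin: "\<And>x. x \<in> ball x0 r \<Longrightarrow> linear (\<omega> x)"
    and der: "\<And>x b. x \<in> ball x0 r \<Longrightarrow> ((\<lambda>x. \<omega> x b) has_derivative \<omega>' b x) (at x)"
    and cont: "\<And>b c. continuous_on (ball x0 r) (\<lambda>x. \<omega>' b x c)"
    and closed: "\<And>x b c. x \<in> ball x0 r \<Longrightarrow> \<omega>' b x c = \<omega>' c x b"
  obtains F where "F x0 = 0" "\<And>x. x \<in> ball x0 r \<Longrightarrow> (F has_derivative \<omega> x) (at x)"
proof -
  let ?B = "ball x0 r"
  define p where "p x t = x0 + t *\<^sub>R (x - x0)" for x and t :: real
  have pB: "p x t \<in> ?B" if "x \<in> ?B" "t \<in> cbox 0 1" for x t
  proof -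
    have "dist x0 (p x t) = t * dist x0 x" using that by (simp add: p_def dist_norm norm_minus_commute)
    also have "\<dots> \<le> dist x0 x" using that by (simp add: mult_left_le_one_le)
    finally show ?thesis using that by simp
  qed
  have lin_expand: "\<omega> x b = (\<Sum>i\<in>Basis. (b \<bullet> i) *\<^sub>R \<omega> x i)" if "x \<in> ?B" for x b
  proof -
    have "\<omega> x (\<Sum>i\<in>Basis. (b \<bullet> i) *\<^sub>R i) = (\<Sum>i\<in>Basis. (b \<bullet> i) *\<^sub>R \<omega> x i)"
      using lin[OF that] by (simp add: linear_sum linear_cmul)
    then show ?thesis by (simp add: euclidean_representation)
  qed
  have lin': "linear (\<omega>' b x)" if "x \<in> ?B" for b x using der[OF that] by (rule has_derivative_linear)
  have lin'_expand: "\<omega>' b x c = (\<Sum>i\<in>Basis. (b \<bullet> i) *\<^sub>R \<omega>' i x c)" if "x \<in> ?B" for x b c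
  proof -
    have "\<omega>' b x c = \<omega>' c x b" by (rule closed[OF that])
    also have "\<dots> = \<omega>' c x (\<Sum>i\<in>Basis. (b \<bullet> i) *\<^sub>R i)" by (simp add: euclidean_representation)
    also have "\<dots> = (\<Sum>i\<in>Basis. (b \<bullet> i) *\<^sub>R \<omega>' c x i)"
      using lin'[OF that, of c] by (simp add: linear_sum linear_cmul)
    finally show ?thesis by (simp add: closed[OF that, of c])
  qed
  have cont_\<omega>: "continuous_on ?B (\<lambda>x. \<omega> x b)" for b
    by (rule has_derivative_continuous_on[of _ _ "\<omega>' b"], rule has_derivative_at_withinI, rule der)
  define f where "f x t = \<omega> (p x t) (x - x0)" for x t
  define fx where "fx x t h = t *\<^sub>R \<omega>' (x - x0) (p x t) h + \<omega> (p x t) h" for x t h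
  have fx_bl: "bounded_linear (fx x t)" if "x \<in> ?B" "t \<in> cbox 0 1" for x t
    unfolding fx_def using lin[OF pB[OF that]] lin'[OF pB[OF that]]
    by (intro bounded_linear_add bounded_linear_scaleR_right[THEN bounded_linear_compose] ) (auto simp: linear_conv_bounded_linear)
  have f_der: "((\<lambda>x. f x t) has_derivative fx x t) (at x)" if "x \<in> ?B" "t \<in> cbox 0 1" for x t
  proof -
    have pd: "((\<lambda>x. p x t) has_derivative (\<lambda>h. t *\<^sub>R h)) (at x)" unfolding p_def
      by (auto intro!: derivative_eq_intros)
    have T: "((\<lambda>x. \<omega> (p x t) b) has_derivative (\<lambda>h. \<omega>' b (p x t) (t *\<^sub>R h))) (at x)" for b
      using has_derivative_compose[OF pd der[OF pB[OF that]]] .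
    have "((\<lambda>x. \<omega> (p x t) (x - x0)) has_derivative (\<lambda>h. \<omega>' (x - x0) (p x t) (t *\<^sub>R h) + \<omega> (p x t) h)) (at x)"
      by (rule has_derivative_linear_family[OF open_ball that(1) lin[OF pB[OF _ that(2)]] T])
        (auto intro!: derivative_eq_intros)
    then show ?thesis
      unfolding f_def fx_def using lin'[OF pB[OF that]] by (simp add: linear_cmul)
  qed
  have cont_p: "continuous_on (?B \<times> cbox 0 1) (\<lambda>z. p (fst z) (snd z))"
    unfolding p_def by (intro continuous_intros)
  have p_im: "(\<lambda>z. p (fst z) (snd z)) ` (?B \<times> cbox 0 1) \<subseteq> ?B" using pB by auto
  have cont_fx: "continuous_on (?B \<times> cbox 0 1) (\<lambda>(x, t). Blinfun (fx x t))"
    unfolding case_prod_unfold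
  proof (rule continuous_on_Blinfun_componentwise)
    fix v
    have "continuous_on (?B \<times> cbox 0 1) (\<lambda>z. snd z *\<^sub>R (\<Sum>i\<in>Basis. ((fst z - x0) \<bullet> i) *\<^sub>R \<omega>' i (p (fst z) (snd z)) v)
        + \<omega> (p (fst z) (snd z)) v)"
      by (intro continuous_intros continuous_on_compose2[OF cont cont_p p_im] continuous_on_compose2[OF cont_\<omega> cont_p p_im])
    then show "continuous_on (?B \<times> cbox 0 1) (\<lambda>x. fx (fst x) (snd x) v)"
      by (rule continuous_on_eq) (auto simp: fx_def lin'_expand[OF pB])
  qed (auto intro: fx_bl)
  define F where "F x = integral (cbox 0 1) (f x)" for x
  have cont_f: "continuous_on (cbox 0 1) (f x)" if "x \<in> ?B" for x
    unfolding f_def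
    by (rule continuous_on_compose2[OF cont_\<omega>]) (use pB that in \<open>auto simp: p_def intro!: continuous_intros\<close>)
  have F_der: "(F has_derivative \<omega> x) (at x)" if x: "x \<in> ?B" for x
  proof -
    have "(F has_derivative integral (cbox 0 1) (\<lambda>t. Blinfun (fx x t))) (at x within ?B)"
      unfolding F_def
    proof (rule leibniz_rule[OF _ _ cont_fx x convex_ball])
      fix y and t :: real assume yt: "y \<in> ?B" "t \<in> cbox 0 1"
      show "((\<lambda>x. f x t) has_derivative blinfun_apply (Blinfun (fx y t))) (at y within ?B)"
        using has_derivative_at_withinI[OF f_der[OF yt]] bounded_linear_Blinfun_apply[OF fx_bl[OF yt]] by metis
    qed (rule integrable_continuous, rule cont_f)
    then have 1: "(F has_derivative integral (cbox 0 1) (\<lambda>t. Blinfun (fx x t))) (at x)"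
      using x at_within_open[OF x open_ball] by simp
    have int_B: "(\<lambda>t. Blinfun (fx x t)) integrable_on cbox 0 1"
    proof (rule integrable_continuous)
      show "continuous_on (cbox 0 1) (\<lambda>t. Blinfun (fx x t))"
        using continuous_on_compose2[OF cont_fx, of "cbox 0 1" "\<lambda>t. (x, t)"] x
          continuous_on_Pair[OF continuous_on_const continuous_on_id, of "{0..1::real}" x]
        by (simp add: image_subset_iff)
    qed
    have "blinfun_apply (integral (cbox 0 1) (\<lambda>t. Blinfun (fx x t))) h = \<omega> x h" for h
    proof -
      have "blinfun_apply (integral (cbox 0 1) (\<lambda>t. Blinfun (fx x t))) h
          = integral (cbox 0 1) (\<lambda>t. blinfun_apply (Blinfun (fx x t)) h)"
        using blinfun_apply_integral[OF int_B] by metis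
      also have "\<dots> = integral (cbox 0 1) (\<lambda>t. fx x t h)"
        by (intro Henstock_Kurzweil_Integration.integral_cong) (metis bounded_linear_Blinfun_apply fx_bl[OF x])
      finally have 2: "blinfun_apply (integral (cbox 0 1) (\<lambda>t. Blinfun (fx x t))) h = integral (cbox 0 1) (\<lambda>t. fx x t h)" .
      have "((\<lambda>t. fx x t h) has_integral 1 *\<^sub>R \<omega> (p x 1) h - 0 *\<^sub>R \<omega> (p x 0) h) {0..1}"
      proof (rule fundamental_theorem_of_calculus)
        fix t :: real assume t: "t \<in> {0..1}"
        then have t': "t \<in> cbox 0 1" by simp
        have pd: "((\<lambda>t. p x t) has_derivative (\<lambda>s. s *\<^sub>R (x - x0))) (at t)" unfolding p_def
          by (auto intro!: derivative_eq_intros)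
        have "((\<lambda>t. \<omega> (p x t) h) has_derivative (\<lambda>s. \<omega>' h (p x t) (s *\<^sub>R (x - x0)))) (at t)"
          using has_derivative_compose[OF pd der[OF pB[OF x t']]] .
        then have "((\<lambda>t. \<omega> (p x t) h) has_vector_derivative \<omega>' (x - x0) (p x t) h) (at t)"
          unfolding has_vector_derivative_def
          using lin'[OF pB[OF x t'], of h] closed[OF pB[OF x t'], of "x - x0" h]
          by (simp add: linear_cmul)
        then have "((\<lambda>t. t *\<^sub>R \<omega> (p x t) h) has_vector_derivative fx x t h) (at t)"
          unfolding fx_def by (auto intro!: derivative_eq_intros)
        then show "((\<lambda>t. t *\<^sub>R \<omega> (p x t) h) has_vector_derivative fx x t h) (at t within {0..1})"
          by (rule has_vector_derivative_at_within)
      qed simp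
      then have "integral (cbox 0 1) (\<lambda>t. fx x t h) = \<omega> x h"
        by (simp add: p_def integral_unique)
      then show ?thesis using 2 by simp
    qed
    then have "blinfun_apply (integral (cbox 0 1) (\<lambda>t. Blinfun (fx x t))) = \<omega> x" by blast
    then show ?thesis using 1 by simp
  qed
  have "F x0 = 0"
  proof -
    have "f x0 t = 0" if "t \<in> cbox 0 1" for t
      using lin[OF pB[OF _ that], of x0] r by (simp add: f_def linear_0)
    then have "F x0 = integral (cbox (0::real) 1) (\<lambda>t. 0)" unfolding F_def
      by (intro Henstock_Kurzweil_Integration.integral_cong)
    then show ?thesis by simp
  qed
  then show ?thesis using F_der by (rule that)
qed

section \<open>Absolutely continuous curves\<close>

lemma abs_continuous_on_family:
  assumes "\<forall>(n::nat) u v. (\<forall>i<n. u i \<le> v i \<and> {u i..v i} \<subseteq> I) \<and> disjoint_family_on (\<lambda>i. {u i<..<v i}) {..<n} \<and>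
      (\<Sum>i<n. v i - u i) < \<delta> \<longrightarrow> (\<Sum>i<n. norm (f (v i) - f (u i))) < \<epsilon>"
    and J: "finite J" "\<And>j. j \<in> J \<Longrightarrow> u j \<le> v j \<and> {u j..v j} \<subseteq> I"
      "disjoint_family_on (\<lambda>j. {u j<..<v j :: real}) J" "(\<Sum>j\<in>J. v j - u j) < \<delta>"
  shows "(\<Sum>j\<in>J. norm (f (v j) - f (u j))) < \<epsilon>"
proof -
  obtain h where h: "bij_betw h {..<card J} J"
    using ex_bij_betw_nat_finite[OF J(1)] by (auto simp: atLeast0LessThan)
  have hJ: "h i \<in> J" if "i < card J" for i using h that by (auto simp: bij_betw_def)
  have "(\<Sum>i<card J. norm (f (v (h i)) - f (u (h i)))) < \<epsilon>"
  proof (rule assms(1)[rule_format, of "card J" "u \<circ> h" "v \<circ> h", unfolded o_def], intro conjI allI impI)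
    show "disjoint_family_on (\<lambda>i. {u (h i)<..<v (h i)}) {..<card J}"
      unfolding disjoint_family_on_def
    proof (intro ballI impI)
      fix i k assume ik: "i \<in> {..<card J}" "k \<in> {..<card J}" "i \<noteq> k"
      then have "h i \<noteq> h k" using h by (auto simp: bij_betw_def inj_on_def)
      then show "{u (h i)<..<v (h i)} \<inter> {u (h k)<..<v (h k)} = {}"
        using J(3) hJ ik by (auto simp: disjoint_family_on_def)
    qed
    show "(\<Sum>i<card J. v (h i) - u (h i)) < \<delta>"
      using J(4) sum.reindex_bij_betw[OF h, of "\<lambda>j. v j - u j"] by simp
  qed (use J(2) hJ in auto)
  then show ?thesis using sum.reindex_bij_betw[OF h, of "\<lambda>j. norm (f (v j) - f (u j))"] by simp
qed

lemma tagged_interval: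
  assumes "p tagged_division_of {a..b::real}" "(x, k) \<in> p"
  shows "k = {Inf k..Sup k}" "Inf k \<le> x" "x \<le> Sup k" "Inf k \<le> Sup k" "{Inf k..Sup k} \<subseteq> {a..b}"
proof -
  obtain c d where cd: "k = cbox c d" using tagged_division_ofD(4)[OF assms] by blast
  have x: "x \<in> k" "k \<subseteq> {a..b}" using tagged_division_ofD(2,3)[OF assms] .
  then have "c \<le> d" using cd by auto
  then have "Inf k = c" "Sup k = d" using cd by auto
  then show "k = {Inf k..Sup k}" "Inf k \<le> x" "x \<le> Sup k" "Inf k \<le> Sup k" "{Inf k..Sup k} \<subseteq> {a..b}"
    using cd x by auto
qed

lemma negligible_outer_open:
  assumes N: "negligible (N :: 'a::euclidean_space set)" and \<delta>: "\<delta> > 0"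
  shows "\<exists>Q. open Q \<and> N \<subseteq> Q \<and> Q \<in> lmeasurable \<and> measure lebesgue Q < \<delta>"
proof -
  obtain Q where Q: "open Q" "N \<subseteq> Q" "Q - N \<in> lmeasurable" "emeasure lebesgue (Q - N) < ennreal \<delta>"
    using sets_lebesgue_outer_open[OF negligible_imp_sets[OF N] \<delta>] by metis
  have NL: "N \<in> lmeasurable" "measure lebesgue N = 0"
    using N by (simp_all add: negligible_imp_measurable negligible_imp_measure0)
  have eq: "Q = (Q - N) \<union> N" using Q(2) by blast
  have "Q \<in> lmeasurable" using fmeasurable.Un[OF Q(3) NL(1)] eq by simp
  moreover have "measure lebesgue Q \<le> measure lebesgue (Q - N) + measure lebesgue N"
    using measure_Un_le[of "Q - N" lebesgue N] Q(3) NL(1) eq by (simp add: fmeasurableD)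
  moreover have "measure lebesgue (Q - N) < \<delta>"
    using Q(4) \<delta> by (simp add: emeasure_eq_measure2[OF Q(3)] ennreal_less_iff)
  ultimately show ?thesis using Q NL by auto
qed

text \<open>In a fine tagged division, the intervals with a tag outside the null set are controlled by the
derivative. Those with a tag in the null set lie in an open set of small measure, and absolute
continuity makes their contribution small.\<close>

theorem abs_continuous_fundamental_theorem:
  fixes f :: "real \<Rightarrow> 'a::euclidean_space"
  assumes ab: "a \<le> b" and ac: "abs_continuous_on I f" and sub: "{a..b} \<subseteq> I" and N: "negligible N"
    and der: "\<And>t. t \<in> {a..b} - N \<Longrightarrow> (f has_vector_derivative f' t) (at t within {a..b})"
  shows "(f' has_integral (f b - f a)) {a..b}"
proof -
  \<comment> \<open>with the value \<open>0\<close> on the null set, tags there contribute nothing to the Riemann sum\<close>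
  define g where "g t = (if t \<in> N then 0 else f' t)" for t
  have "(g has_integral (f b - f a)) {a..b}"
    unfolding has_integral_real
  proof (intro allI impI)
    fix e :: real assume e: "e > 0"
    define e1 where "e1 = e / (2 * (b - a + 1))"
    have e1: "e1 > 0" using e ab by (simp add: e1_def)
    obtain \<delta> where \<delta>: "\<delta> > 0" "\<forall>(n::nat) u v. (\<forall>i<n. u i \<le> v i \<and> {u i..v i} \<subseteq> I) \<and> disjoint_family_on (\<lambda>i. {u i<..<v i}) {..<n} \<and>
      (\<Sum>i<n. v i - u i) < \<delta> \<longrightarrow> (\<Sum>i<n. norm (f (v i) - f (u i))) < e / 2"
      using ac[unfolded abs_continuous_on_def, THEN spec, THEN mp, OF half_gt_zero[OF e]]
      by (elim exE conjE) (rule that)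
    obtain Q where Q: "open Q" "N \<subseteq> Q" "Q \<in> lmeasurable" "measure lebesgue Q < \<delta>"
      using negligible_outer_open[OF N \<delta>(1)] by metis
    have "\<exists>d>0. (t \<in> N \<longrightarrow> ball t d \<subseteq> Q) \<and>
      (t \<in> {a..b} - N \<longrightarrow> (\<forall>y\<in>{a..b}. \<bar>y - t\<bar> < d \<longrightarrow> norm (f y - f t - (y - t) *\<^sub>R f' t) \<le> e1 * \<bar>y - t\<bar>))" for t
    proof (cases "t \<in> N")
      case True
      then show ?thesis using Q by (meson Diff_iff openE subsetD)
    next
      case False
      show ?thesis
      proof (cases "t \<in> {a..b}")
        case True
        then have "(f has_derivative (\<lambda>h. h *\<^sub>R f' t)) (at t within {a..b})"
          using der False by (simp add: has_vector_derivative_def)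
        then obtain d where "d > 0" "\<forall>y\<in>{a..b}. norm (y - t) < d \<longrightarrow> norm (f y - f t - (y - t) *\<^sub>R f' t) \<le> e1 * norm (y - t)"
          using e1 unfolding has_derivative_within_alt by blast
        then show ?thesis using False by (intro exI[of _ d]) auto
      qed (use False in \<open>auto intro: zero_less_one\<close>)
    qed
    then obtain d where d: "\<And>t. d t > 0" "\<And>t. t \<in> N \<Longrightarrow> ball t (d t) \<subseteq> Q"
      "\<And>t y. t \<in> {a..b} - N \<Longrightarrow> y \<in> {a..b} \<Longrightarrow> \<bar>y - t\<bar> < d t \<Longrightarrow> norm (f y - f t - (y - t) *\<^sub>R f' t) \<le> e1 * \<bar>y - t\<bar>"
      by metis
    have "norm (sum (\<lambda>(x,k). measure lborel k *\<^sub>R g x) p - (f b - f a)) < e"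
      if p: "p tagged_division_of {a..b}" and fine: "(\<lambda>t. ball t (d t)) fine p" for p
    proof -
      note ti = tagged_interval[OF p]
      have fin: "finite p" using tagged_division_ofD(1)[OF p] .
      define p1 where "p1 = {xk \<in> p. fst xk \<in> N}"
      define q where "q = (\<lambda>(x,k). f (Sup k) - f (Inf k) - measure lborel k *\<^sub>R g x)"
      have cont: "measure lborel k = Sup k - Inf k" if "(x, k) \<in> p" for x k
        using ti(1,4)[OF that] by (metis measure_lborel_Icc)
      have kball: "{Inf k..Sup k} \<subseteq> ball x (d x)" if "(x, k) \<in> p" for x k
        using fineD[OF fine that] ti(1)[OF that] by metis
      have bad: "(\<Sum>xk\<in>p1. norm (q xk)) < e / 2"
      proof -
        have qeq: "norm (q xk) = norm (f (Sup (snd xk)) - f (Inf (snd xk)))" if "xk \<in> p1" for xk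
          using that by (cases xk) (auto simp: p1_def q_def g_def)
        have disj: "{Inf (snd xk)<..<Sup (snd xk)} \<inter> {Inf (snd xk')<..<Sup (snd xk')} = {}"
          if xk: "xk \<in> p" "xk' \<in> p" "xk \<noteq> xk'" for xk xk'
        proof -
          obtain x k x' k' where eq: "xk = (x, k)" "xk' = (x', k')" by (metis surj_pair)
          have "interior k \<inter> interior k' = {}" using tagged_division_ofD(5)[OF p] xk eq by auto
          moreover have "interior k = {Inf k<..<Sup k}" "interior k' = {Inf k'<..<Sup k'}"
            using ti(1) xk eq by (metis interior_atLeastAtMost_real)+
          ultimately show ?thesis by (simp add: eq)
        qed
        have "(\<Sum>xk\<in>p1. norm (f (Sup (snd xk)) - f (Inf (snd xk)))) < e / 2"
        proof (rule abs_continuous_on_family[OF \<delta>(2)])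
          show "finite p1" using fin by (simp add: p1_def)
          show "Inf (snd xk) \<le> Sup (snd xk) \<and> {Inf (snd xk)..Sup (snd xk)} \<subseteq> I" if "xk \<in> p1" for xk
            using that ti(4,5)[of "fst xk" "snd xk"] sub by (auto simp: p1_def)
          show "disjoint_family_on (\<lambda>xk. {Inf (snd xk)<..<Sup (snd xk)}) p1"
            using disj by (auto simp: disjoint_family_on_def p1_def)
          have "(\<Sum>xk\<in>p1. Sup (snd xk) - Inf (snd xk)) = (\<Sum>xk\<in>p1. measure lebesgue {Inf (snd xk)<..<Sup (snd xk)})"
            using ti(4) by (intro sum.cong) (auto simp: p1_def)
          also have "\<dots> = measure lebesgue (\<Union>xk\<in>p1. {Inf (snd xk)<..<Sup (snd xk)})"
            using fin disj by (intro measure_UNION'[symmetric]) (auto simp: p1_def pairwise_def disjnt_def)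
          also have "\<dots> \<le> measure lebesgue Q"
          proof (rule measure_mono_fmeasurable)
            show "(\<Union>xk\<in>p1. {Inf (snd xk)<..<Sup (snd xk)}) \<subseteq> Q"
            proof (rule UN_least)
              fix xk assume "xk \<in> p1"
              then have xk: "(fst xk, snd xk) \<in> p" "fst xk \<in> N" by (auto simp: p1_def)
              have "{Inf (snd xk)<..<Sup (snd xk)} \<subseteq> {Inf (snd xk)..Sup (snd xk)}" by auto
              then show "{Inf (snd xk)<..<Sup (snd xk)} \<subseteq> Q" using kball[OF xk(1)] d(2)[OF xk(2)] by blast
            qed
            show "(\<Union>xk\<in>p1. {Inf (snd xk)<..<Sup (snd xk)}) \<in> sets lebesgue"
              using fin by (intro sets.finite_UN) (auto simp: p1_def)
          qed (use Q in auto)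
          also have "\<dots> < \<delta>" by (rule Q)
          finally show "(\<Sum>xk\<in>p1. Sup (snd xk) - Inf (snd xk)) < \<delta>" .
        qed
        then show ?thesis using qeq by simp
      qed
      have good: "(\<Sum>xk\<in>p - p1. norm (q xk)) \<le> e / 2"
      proof -
        have "norm (q xk) \<le> e1 * measure lborel (snd xk)" if "xk \<in> p - p1" for xk
        proof -
          obtain x k where eq: "xk = (x, k)" by (metis surj_pair)
          have xk: "(x, k) \<in> p" "x \<notin> N" using that eq by (auto simp: p1_def)
          have xab: "x \<in> {a..b} - N" using ti(2,3,5)[OF xk(1)] xk(2) by auto
          have S: "Sup k \<in> {a..b}" "Inf k \<in> {a..b}" using ti(4,5)[OF xk(1)] by auto
          have "Sup k \<in> ball x (d x)" "Inf k \<in> ball x (d x)" using kball[OF xk(1)] ti(4)[OF xk(1)] by auto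
          then have S': "\<bar>Sup k - x\<bar> < d x" "\<bar>Inf k - x\<bar> < d x" by (auto simp: dist_real_def)
          have "q xk = (f (Sup k) - f x - (Sup k - x) *\<^sub>R f' x) - (f (Inf k) - f x - (Inf k - x) *\<^sub>R f' x)"
            using xk(2) by (simp add: q_def eq g_def cont[OF xk(1)] algebra_simps)
          also have "norm \<dots> \<le> e1 * \<bar>Sup k - x\<bar> + e1 * \<bar>Inf k - x\<bar>"
            by (rule order_trans[OF norm_triangle_ineq4 add_mono]) (rule d(3)[OF xab] S S')+
          also have "\<dots> = e1 * measure lborel k"
            using ti(2,3)[OF xk(1)] by (simp add: cont[OF xk(1)] algebra_simps)
          finally show ?thesis by (simp add: eq)
        qed
        then have "(\<Sum>xk\<in>p - p1. norm (q xk)) \<le> (\<Sum>xk\<in>p - p1. e1 * measure lborel (snd xk))" by (rule sum_mono)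
        also have "\<dots> \<le> (\<Sum>xk\<in>p. e1 * measure lborel (snd xk))"
          using fin e1 by (intro sum_mono2) auto
        also have "\<dots> = e1 * (b - a)"
          using additive_content_tagged_division[of p a b] p ab
          by (simp add: case_prod_unfold flip: sum_distrib_left)
        also have "\<dots> \<le> e / 2"
        proof -
          have "(b - a) * e \<le> (b - a + 1) * e" using e by (intro mult_right_mono) auto
          then show ?thesis using ab by (simp add: e1_def field_simps)
        qed
        finally show ?thesis .
      qed
      have "(f b - f a) - sum (\<lambda>(x,k). measure lborel k *\<^sub>R g x) p = sum q p"
        unfolding additive_tagged_division_1[OF ab p, symmetric] q_def
        by (simp add: case_prod_unfold sum_subtractf)
      then have "norm (sum (\<lambda>(x,k). measure lborel k *\<^sub>R g x) p - (f b - f a)) \<le> (\<Sum>xk\<in>p. norm (q xk))"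
        using norm_sum[of q p] by (simp add: norm_minus_commute)
      also have "\<dots> = (\<Sum>xk\<in>p - p1. norm (q xk)) + (\<Sum>xk\<in>p1. norm (q xk))"
        using fin by (intro sum.subset_diff) (auto simp: p1_def)
      also have "\<dots> < e" using bad good by linarith
      finally show ?thesis .
    qed
    moreover have "gauge (\<lambda>t. ball t (d t))" using d(1) by (auto simp: gauge_def)
    ultimately show "\<exists>\<gamma>. gauge \<gamma> \<and> (\<forall>\<D>. \<D> tagged_division_of {a..b} \<and> \<gamma> fine \<D> \<longrightarrow>
        norm (sum (\<lambda>(x,k). measure lborel k *\<^sub>R g x) \<D> - (f b - f a)) < e)" by blast
  qed
  then show ?thesis by (rule has_integral_spike[OF N, rotated]) (simp add: g_def)
qed

text \<open>On intervals shorter than the modulus belonging to \<open>\<epsilon> = 1\<close>, every division has variation less than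
\<open>1\<close>, so the derivative has bounded variation of its integral. Short intervals are enough because
integrability is a local matter.\<close>

lemma abs_continuous_derivative_integrable:
  fixes f :: "real \<Rightarrow> 'a::euclidean_space"
  assumes ac: "abs_continuous_on I f"
  shows "\<exists>\<delta>>0. \<forall>a b N f'. a \<le> b \<and> b - a < \<delta> \<and> {a..b} \<subseteq> I \<and> negligible N \<and>
    (\<forall>t\<in>{a..b} - N. (f has_vector_derivative f' t) (at t within {a..b})) \<longrightarrow>
    f' absolutely_integrable_on {a..b}"
proof -
  obtain \<delta> where \<delta>: "\<delta> > 0" "\<forall>(n::nat) u v. (\<forall>i<n. u i \<le> v i \<and> {u i..v i} \<subseteq> I) \<and> disjoint_family_on (\<lambda>i. {u i<..<v i}) {..<n} \<and>
      (\<Sum>i<n. v i - u i) < \<delta> \<longrightarrow> (\<Sum>i<n. norm (f (v i) - f (u i))) < 1"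
    using ac[unfolded abs_continuous_on_def, THEN spec, THEN mp, OF zero_less_one]
    by (elim exE conjE) (rule that)
  have "f' absolutely_integrable_on {a..b}"
    if ab: "a \<le> b" "b - a < \<delta>" "{a..b} \<subseteq> I" and N: "negligible N"
      and der: "\<And>t. t \<in> {a..b} - N \<Longrightarrow> (f has_vector_derivative f' t) (at t within {a..b})" for a b N f'
  proof -
    have ftc: "(f' has_integral (f d - f c)) {c..d}" if cd: "c \<le> d" "{c..d} \<subseteq> {a..b}" for c d
    proof (rule abs_continuous_fundamental_theorem[OF cd(1) ac _ N])
      show "{c..d} \<subseteq> I" using cd ab by blast
      fix t assume "t \<in> {c..d} - N"
      then show "(f has_vector_derivative f' t) (at t within {c..d})"
        using has_vector_derivative_within_subset[OF der cd(2)] cd by blast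
    qed
    have "f' absolutely_integrable_on cbox a b"
    proof (rule bounded_variation_absolutely_integrable_interval[of _ _ _ 1])
      show "f' integrable_on cbox a b" using ftc[of a b] ab by auto
      fix d assume d: "d division_of cbox a b"
      have k: "K = {Inf K..Sup K}" "Inf K \<le> Sup K" "{Inf K..Sup K} \<subseteq> {a..b}" if "K \<in> d" for K
      proof -
        obtain u v where uv: "K = cbox u v" using division_ofD(4)[OF d \<open>K \<in> d\<close>] by blast
        have ne: "K \<noteq> {}" and sub: "K \<subseteq> {a..b}" using division_ofD(2,3)[OF d \<open>K \<in> d\<close>] by auto
        then have "u \<le> v" using uv by auto
        then have "Inf K = u" "Sup K = v" using uv by auto
        then show "K = {Inf K..Sup K}" "Inf K \<le> Sup K" "{Inf K..Sup K} \<subseteq> {a..b}" using uv sub \<open>u \<le> v\<close> by auto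
      qed
      have int: "integral K f' = f (Sup K) - f (Inf K)" if "K \<in> d" for K
        using ftc[OF k(2,3)[OF that]] k(1)[OF that] by (metis integral_unique)
      have "(\<Sum>K\<in>d. norm (f (Sup K) - f (Inf K))) < 1"
      proof (rule abs_continuous_on_family[OF \<delta>(2)])
        show "finite d" by (rule division_ofD(1)[OF d])
        show "Inf K \<le> Sup K \<and> {Inf K..Sup K} \<subseteq> I" if "K \<in> d" for K using k(2,3)[OF that] ab(3) by blast
        show "disjoint_family_on (\<lambda>K. {Inf K<..<Sup K}) d"
          unfolding disjoint_family_on_def
        proof (intro ballI impI)
          fix K L assume KL: "K \<in> d" "L \<in> d" "K \<noteq> L"
          have "interior K \<inter> interior L = {}" using division_ofD(5)[OF d KL] .
          then show "{Inf K<..<Sup K} \<inter> {Inf L<..<Sup L} = {}"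
            using k(1) KL by (metis interior_atLeastAtMost_real)
        qed
        have "(\<Sum>K\<in>d. Sup K - Inf K) = (\<Sum>K\<in>d. measure lborel K)"
          using k(1,2) by (intro sum.cong refl) (metis measure_lborel_Icc)
        also have "\<dots> = b - a" using additive_content_division[OF d] ab(1) by simp
        finally show "(\<Sum>K\<in>d. Sup K - Inf K) < \<delta>" using ab(2) by simp
      qed
      then show "(\<Sum>K\<in>d. norm (integral K f')) \<le> 1" using int by simp
    qed
    then show ?thesis by simp
  qed
  note main = this
  show ?thesis
  proof (intro exI[of _ \<delta>] conjI allI impI)
    fix a b N f'
    assume *: "a \<le> b \<and> b - a < \<delta> \<and> {a..b} \<subseteq> I \<and> negligible N \<and>
      (\<forall>t\<in>{a..b} - N. (f has_vector_derivative f' t) (at t within {a..b}))"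
    show "f' absolutely_integrable_on {a..b}" by (rule main[of a b N]) (use * in blast)+
  qed (rule \<delta>(1))
qed

lemma lipschitz_imp_abs_continuous:
  assumes "L-lipschitz_on I f"
  shows "abs_continuous_on I f"
  unfolding abs_continuous_on_def
proof (intro allI impI)
  fix \<epsilon> :: real assume \<epsilon>: "\<epsilon> > 0"
  have L: "L \<ge> 0" using assms by (rule lipschitz_on_nonneg)
  have "(\<Sum>i<n. norm (f (v i) - f (u i))) < \<epsilon>"
    if "\<forall>i<n. u i \<le> v i \<and> {u i..v i} \<subseteq> I" "(\<Sum>i<n. v i - u i) < \<epsilon> / (L + 1)" for n :: nat and u v
  proof -
    have "norm (f (v i) - f (u i)) \<le> L * (v i - u i)" if "i < n" for i
    proof -
      have "u i \<le> v i" "{u i..v i} \<subseteq> I" using \<open>\<forall>i<n. u i \<le> v i \<and> {u i..v i} \<subseteq> I\<close> that by auto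
      then have "v i \<in> I" "u i \<in> I" by auto
      then show ?thesis using lipschitz_onD[OF assms, of "v i" "u i"] \<open>u i \<le> v i\<close> by (simp add: dist_norm)
    qed
    then have "(\<Sum>i<n. norm (f (v i) - f (u i))) \<le> (\<Sum>i<n. L * (v i - u i))" by (intro sum_mono) auto
    also have "\<dots> = L * (\<Sum>i<n. v i - u i)" by (simp add: sum_distrib_left)
    also have "\<dots> \<le> L * (\<epsilon> / (L + 1))" using that L by (intro mult_left_mono) auto
    also have "\<dots> < \<epsilon>" using L \<epsilon> by (simp add: field_simps)
    finally show ?thesis .
  qed
  then show "\<exists>\<delta>>0. \<forall>(n::nat) u v. (\<forall>i<n. u i \<le> v i \<and> {u i..v i} \<subseteq> I) \<and>
      disjoint_family_on (\<lambda>i. {u i<..<v i}) {..<n} \<and> (\<Sum>i<n. v i - u i) < \<delta> \<longrightarrow>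
      (\<Sum>i<n. norm (f (v i) - f (u i))) < \<epsilon>"
    using L \<epsilon> by (intro exI[of _ "\<epsilon> / (L + 1)"]) auto
qed

lemma abs_continuous_on_lipschitz_compose:
  assumes ac: "abs_continuous_on I f" and L: "L-lipschitz_on S g" and J: "J \<subseteq> I" "f ` J \<subseteq> S"
  shows "abs_continuous_on J (\<lambda>t. g (f t))"
  unfolding abs_continuous_on_def
proof (intro allI impI)
  fix \<epsilon> :: real assume \<epsilon>: "\<epsilon> > 0"
  have L0: "L \<ge> 0" using L by (rule lipschitz_on_nonneg)
  have e1: "\<epsilon> / (L + 1) > 0" using L0 \<epsilon> by simp
  obtain \<delta> where \<delta>: "\<delta> > 0" "\<forall>(n::nat) u v. (\<forall>i<n. u i \<le> v i \<and> {u i..v i} \<subseteq> I) \<and> disjoint_family_on (\<lambda>i. {u i<..<v i}) {..<n} \<and>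
      (\<Sum>i<n. v i - u i) < \<delta> \<longrightarrow> (\<Sum>i<n. norm (f (v i) - f (u i))) < \<epsilon> / (L + 1)"
    using ac[unfolded abs_continuous_on_def, THEN spec, THEN mp, OF e1]
    by (elim exE conjE) (rule that)
  have "(\<Sum>i<n. norm (g (f (v i)) - g (f (u i)))) < \<epsilon>"
    if h: "\<forall>i<n. u i \<le> v i \<and> {u i..v i} \<subseteq> J" "disjoint_family_on (\<lambda>i. {u i<..<v i}) {..<n}" "(\<Sum>i<n. v i - u i) < \<delta>"
    for n :: nat and u v
  proof -
    have "norm (g (f (v i)) - g (f (u i))) \<le> L * norm (f (v i) - f (u i))" if "i < n" for i
    proof -
      have "u i \<le> v i" "{u i..v i} \<subseteq> J" using h(1) that by auto
      then have "u i \<in> J" "v i \<in> J" by auto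
      then have "f (v i) \<in> S" "f (u i) \<in> S" using J(2) by auto
      then show ?thesis using lipschitz_onD[OF L] by (simp add: dist_norm)
    qed
    then have "(\<Sum>i<n. norm (g (f (v i)) - g (f (u i)))) \<le> L * (\<Sum>i<n. norm (f (v i) - f (u i)))"
      unfolding sum_distrib_left by (intro sum_mono) auto
    also have "\<dots> \<le> L * (\<epsilon> / (L + 1))"
    proof (rule mult_left_mono[OF less_imp_le L0])
      have "\<forall>i<n. u i \<le> v i \<and> {u i..v i} \<subseteq> I" using h(1) J(1) by blast
      then show "(\<Sum>i<n. norm (f (v i) - f (u i))) < \<epsilon> / (L + 1)" using \<delta>(2) h(2,3) by blast
    qed
    also have "\<dots> < \<epsilon>" using L0 \<epsilon> by (simp add: field_simps)
    finally show ?thesis .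
  qed
  then show "\<exists>\<delta>>0. \<forall>(n::nat) u v. (\<forall>i<n. u i \<le> v i \<and> {u i..v i} \<subseteq> J) \<and>
      disjoint_family_on (\<lambda>i. {u i<..<v i}) {..<n} \<and> (\<Sum>i<n. v i - u i) < \<delta> \<longrightarrow>
      (\<Sum>i<n. norm (g (f (v i)) - g (f (u i)))) < \<epsilon>"
    using \<delta>(1) by blast
qed

text \<open>The component of the integral orthogonal to the subspace is the integral of a function that vanishes
almost everywhere.\<close>

lemma integral_in_subspace:
  fixes f :: "real \<Rightarrow> 'a::euclidean_space"
  assumes S: "subspace S" and f: "(f has_integral w) {a..b}" and N: "negligible N"
    and fS: "\<And>t. t \<in> {a..b} - N \<Longrightarrow> f t \<in> S"
  shows "w \<in> S"
proof -
  obtain y z where yz: "y \<in> span S" "\<And>x. x \<in> span S \<Longrightarrow> orthogonal z x" "w = y + z"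
    by (rule orthogonal_subspace_decomp_exists[of S w], rule that)
  have "((\<lambda>t. z \<bullet> f t) has_integral z \<bullet> w) {a..b}"
    using has_integral_linear[OF f bounded_linear_inner_right[of z]] by (simp add: o_def)
  moreover have "((\<lambda>t. z \<bullet> f t) has_integral 0) {a..b}"
    by (rule has_integral_spike[OF N _ has_integral_0]) (use yz(2) fS span_base in \<open>auto simp: orthogonal_def\<close>)
  ultimately have "z \<bullet> w = 0" by (rule has_integral_unique)
  then have "z = 0" using yz(2)[OF yz(1)] yz(3) by (simp add: inner_add_right orthogonal_def)
  then show ?thesis using yz span_eq_iff[THEN iffD2, OF S] by simp
qed

lemma locally_lipschitz_interval:
  fixes f :: "real \<Rightarrow> 'a::metric_space"
  assumes ab: "a \<le> b"
    and loc: "\<And>t. t \<in> {a..b} \<Longrightarrow> \<exists>d>0. \<exists>L. L-lipschitz_on ({a..b} \<inter> {t - d<..<t + d}) f"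
  shows "\<exists>L. L-lipschitz_on {a..b} f"
proof -
  define P where "P u v \<longleftrightarrow> (\<exists>L. L-lipschitz_on ({a..b} \<inter> {u..v}) f)" for u v
  have "P a b" using ab
  proof (induction rule: Bolzano)
    case (trans u v w)
    then obtain L M where LM: "L-lipschitz_on ({a..b} \<inter> {u..v}) f" "M-lipschitz_on ({a..b} \<inter> {v..w}) f"
      by (auto simp: P_def)
    have LM0: "0 \<le> L" "0 \<le> M" using LM by (auto intro: lipschitz_on_nonneg)
    have le: "dist (f x) (f y) \<le> max L M * (y - x)" if xy: "x \<in> {a..b} \<inter> {u..w}" "y \<in> {a..b} \<inter> {u..w}" "x \<le> y" for x y
    proof -
      have 1: "dist (f x) (f y) \<le> max L M * (y - x)" if "x \<in> {a..b}" "y \<in> {a..b}" "x \<le> y" "u \<le> x" "y \<le> v" for x y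
        using lipschitz_onD[OF LM(1), of x y] that mult_right_mono[of L "max L M" "y - x"] by (auto simp: dist_real_def)
      have 2: "dist (f x) (f y) \<le> max L M * (y - x)" if "x \<in> {a..b}" "y \<in> {a..b}" "x \<le> y" "v \<le> x" "y \<le> w" for x y
        using lipschitz_onD[OF LM(2), of x y] that mult_right_mono[of M "max L M" "y - x"] by (auto simp: dist_real_def)
      consider "y \<le> v" | "v \<le> x" | "x \<le> v" "v \<le> y" by linarith
      then show ?thesis
      proof cases
        case 3
        have "dist (f x) (f y) \<le> dist (f x) (f v) + dist (f v) (f y)" by (rule dist_triangle)
        also have "\<dots> \<le> max L M * (v - x) + max L M * (y - v)" using xy 3 by (intro add_mono 1 2) auto
        finally show ?thesis by (simp add: algebra_simps)
      qed (use xy 1 2 in auto)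
    qed
    have "(max L M)-lipschitz_on ({a..b} \<inter> {u..w}) f"
    proof (rule lipschitz_onI)
      fix x y assume xy: "x \<in> {a..b} \<inter> {u..w}" "y \<in> {a..b} \<inter> {u..w}"
      show "dist (f x) (f y) \<le> max L M * dist x y"
        using le[OF xy] le[OF xy(2,1)] by (cases "x \<le> y") (auto simp: dist_real_def dist_commute)
    qed (use LM0 in auto)
    then show ?case unfolding P_def by blast
  next
    case (local t)
    then obtain d L where d: "d > 0" "L-lipschitz_on ({a..b} \<inter> {t - d<..<t + d}) f" using loc[of t] by auto
    have "P u v" if "u \<le> t" "t \<le> v" "v - u < d" for u v
      unfolding P_def using that by (intro exI[of _ L] lipschitz_on_subset[OF d(2)]) auto
    then show ?case using d(1) by blast
  qed
  then show ?thesis by (auto simp: P_def)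
qed

section \<open>The Maurer-Cartan form in a chart\<close>

lemma smooth_on_partial:
  fixes f :: "'a::euclidean_space \<times> 'b::euclidean_space \<Rightarrow> 'c::euclidean_space"
  assumes "smooth_on S f" "(x, y) \<in> S"
  shows "((\<lambda>y. f (x, y)) has_derivative (\<lambda>b. frechet_derivative f (at (x, y)) (0, b))) (at y)"
proof -
  have "((\<lambda>y. (x, y)) has_derivative (\<lambda>b. (0, b))) (at y)"
    by (auto intro!: derivative_eq_intros)
  from has_derivative_compose[OF this smooth_onD(3)[OF assms]] show ?thesis .
qed

lemma smooth_on_derivative_continuous:
  fixes f :: "'a::euclidean_space \<Rightarrow> 'b::euclidean_space" and p :: "'x::t2_space \<Rightarrow> 'a"
  assumes f: "smooth_on S f" and "continuous_on T p" "continuous_on T u" "p ` T \<subseteq> S"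
  shows "continuous_on T (\<lambda>x. frechet_derivative f (at (p x)) (u x))"
proof -
  let ?D = "\<lambda>x. frechet_derivative f (at x)"
  have bl: "bounded_linear (?D z)" if "z \<in> S" for z
    using smooth_onD(3)[OF f that] by (rule has_derivative_bounded_linear)
  have "continuous_on S (\<lambda>z. Blinfun (?D z))"
    using bl smooth_onD(2)[OF smooth_onD(4)[OF f]] by (rule continuous_on_Blinfun_componentwise)
  then have "continuous_on T (\<lambda>x. Blinfun (?D (p x)))"
    by (rule continuous_on_compose2[OF _ assms(2,4)])
  then have "continuous_on T (\<lambda>x. blinfun_apply (Blinfun (?D (p x))) (u x))"
    using assms(3) by (rule blinfun.continuous_on)
  then show ?thesis
    by (rule continuous_on_eq) (use bl assms(4) in \<open>auto simp: bounded_linear_Blinfun_apply\<close>)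
qed

lemma open_pair_slice:
  assumes "open (S :: ('a::topological_space \<times> 'b::topological_space) set)"
  shows "open {y. (x, y) \<in> S}"
proof -
  have "open ((\<lambda>y. (x, y)) -` S)"
    by (rule open_vimage[OF assms]) (intro continuous_intros)
  then show ?thesis by (simp add: vimage_def)
qed

text \<open>All calculations take place in the chart \<open>c\<^sub>0\<close>. Below, \<open>m\<close> and \<open>i\<close> are the multiplication and the
inversion read in this chart, on the open sets \<open>mdom\<close> and \<open>idom\<close> where the result stays in its domain,
and \<open>x\<^sub>0\<close> is the neutral element.\<close>

locale lie_chart =
  fixes G :: "('g::{t2_space, second_countable_topology}, 'e::euclidean_space) lie_struct"
    and c\<^sub>0 :: "('g, 'e) chart"
  assumes lie: "lie_group G" and c0: "c\<^sub>0 \<in> atlas G" and one_in: "gone G \<in> fst c\<^sub>0"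
begin

abbreviation gmult (infixl "\<cdot>" 70) where "p \<cdot> q \<equiv> gmul G p q"
abbreviation "\<kappa> \<equiv> chart_inv c\<^sub>0"
abbreviation "\<phi> \<equiv> snd c\<^sub>0"
abbreviation "x\<^sub>0 \<equiv> snd c\<^sub>0 (gone G)"
abbreviation "Om \<equiv> snd c\<^sub>0 ` fst c\<^sub>0"

sublocale gr: Groups.group "gmul G" "gone G" "ginv G"
  using lie unfolding lie_group_def by blast

lemma is_chart_atlas: "c \<in> atlas G \<Longrightarrow> is_chart c"
  using lie unfolding lie_group_def smooth_atlas_def by blast

lemma chart_facts:
  assumes "c \<in> atlas G"
  shows "open (fst c)" "open (snd c ` fst c)"
    "p \<in> fst c \<Longrightarrow> chart_inv c (snd c p) = p"
    "x \<in> snd c ` fst c \<Longrightarrow> chart_inv c x \<in> fst c"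
    "x \<in> snd c ` fst c \<Longrightarrow> snd c (chart_inv c x) = x"
    "continuous_on (fst c) (snd c)" "continuous_on (snd c ` fst c) (chart_inv c)"
  using is_chart_atlas[OF assms] unfolding is_chart_def homeomorphism_def by auto

lemma charts_cover: obtains c where "c \<in> atlas G" "p \<in> fst c"
proof -
  have "(\<Union>c\<in>atlas G. fst c) = UNIV" using lie unfolding lie_group_def smooth_atlas_def by blast
  then show ?thesis using that by blast
qed

lemmas c0_facts = chart_facts[OF c0]

lemma x0_in: "x\<^sub>0 \<in> Om" using one_in by blast
lemma \<kappa>_x0 [simp]: "\<kappa> x\<^sub>0 = gone G" using c0_facts(3)[OF one_in] .

lemma mult_continuous: "continuous_on UNIV (\<lambda>(x, y). x \<cdot> y)"
  using lie unfolding lie_group_def by blast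

lemma mult_smooth:
  assumes "a \<in> atlas G" "b \<in> atlas G" "c \<in> atlas G"
  shows "smooth_on {(x, y). x \<in> snd a ` fst a \<and> y \<in> snd b ` fst b \<and> chart_inv a x \<cdot> chart_inv b y \<in> fst c}
    (\<lambda>(x, y). snd c (chart_inv a x \<cdot> chart_inv b y))"
  using lie assms unfolding lie_group_def by blast

definition "mdom = {(x, y). x \<in> Om \<and> y \<in> Om \<and> \<kappa> x \<cdot> \<kappa> y \<in> fst c\<^sub>0}"
definition "m = (\<lambda>(x, y). \<phi> (\<kappa> x \<cdot> \<kappa> y))"
definition "idom = {x \<in> Om. ginv G (\<kappa> x) \<in> fst c\<^sub>0}"
definition "i x = \<phi> (ginv G (\<kappa> x))"

lemma m_smooth: "smooth_on mdom m"
  unfolding mdom_def m_def by (rule mult_smooth[OF c0 c0 c0])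

lemma i_smooth: "smooth_on idom i"
proof -
  have "smooth_on {x \<in> snd c\<^sub>0 ` fst c\<^sub>0. ginv G (chart_inv c\<^sub>0 x) \<in> fst c\<^sub>0} (\<lambda>x. snd c\<^sub>0 (ginv G (chart_inv c\<^sub>0 x)))"
    using lie c0 unfolding lie_group_def by blast
  then show ?thesis unfolding idom_def i_def .
qed

lemma mdomD: assumes "(x, y) \<in> mdom" shows "x \<in> Om" "y \<in> Om" "m (x, y) \<in> Om" "\<kappa> (m (x, y)) = \<kappa> x \<cdot> \<kappa> y"
  using assms c0_facts(3) by (auto simp: mdom_def m_def)

lemma idomD: assumes "x \<in> idom" shows "x \<in> Om" "i x \<in> Om" "\<kappa> (i x) = ginv G (\<kappa> x)"
  using assms c0_facts(3) by (auto simp: idom_def i_def)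

lemma mdom_x0: "x \<in> Om \<Longrightarrow> (x, x\<^sub>0) \<in> mdom" "y \<in> Om \<Longrightarrow> (x\<^sub>0, y) \<in> mdom"
  using c0_facts(4) x0_in by (auto simp: mdom_def)

lemma m_x0 [simp]: "x \<in> Om \<Longrightarrow> m (x, x\<^sub>0) = x" "y \<in> Om \<Longrightarrow> m (x\<^sub>0, y) = y"
  using c0_facts(5) by (auto simp: m_def)

lemma ginv_one: "ginv G (gone G) = gone G"
  by (metis gr.left_inverse gr.group_left_neutral gr.group_axioms group.right_inverse)

lemma x0_idom: "x\<^sub>0 \<in> idom" using one_in by (simp add: idom_def ginv_one)
lemma i_x0 [simp]: "i x\<^sub>0 = x\<^sub>0" by (simp add: i_def ginv_one)

lemma i_mdom: assumes "x \<in> idom" shows "(i x, x) \<in> mdom" "m (i x, x) = x\<^sub>0"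
  using idomD[OF assms] one_in by (auto simp: mdom_def m_def)

text \<open>The partial derivative of the product \<open>m (x, y)\<close> in \<open>y\<close>, that is, the differential of the left
translation by \<open>x\<close> at the point \<open>y\<close>.\<close>

definition A :: "'e \<Rightarrow> 'e \<Rightarrow> 'e \<Rightarrow> 'e" where
  "A x y b = frechet_derivative m (at (x, y)) (0, b)"

lemma A_derivative: "(x, y) \<in> mdom \<Longrightarrow> ((\<lambda>y. m (x, y)) has_derivative A x y) (at y)"
  unfolding A_def using smooth_on_partial[OF m_smooth] .

lemma A_smooth: "smooth_on mdom (\<lambda>z. A (fst z) (snd z) b)"
  unfolding A_def using smooth_onD(4)[OF m_smooth, of "(0, b)"] by simp

lemma A_linear: "(x, y) \<in> mdom \<Longrightarrow> linear (A x y)"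
  using A_derivative by (rule has_derivative_linear)

text \<open>The second partial derivative of \<open>m (x, y)\<close> in \<open>y\<close>.\<close>

definition A' :: "'e \<Rightarrow> 'e \<Rightarrow> 'e \<Rightarrow> 'e \<Rightarrow> 'e" where
  "A' b x y c = frechet_derivative (\<lambda>z. A (fst z) (snd z) b) (at (x, y)) (0, c)"

lemma A'_derivative: "(x, y) \<in> mdom \<Longrightarrow> ((\<lambda>y. A x y b) has_derivative A' b x y) (at y)"
  unfolding A'_def using smooth_on_partial[OF A_smooth] by simp

lemma open_mdom: "open mdom" and open_idom: "open idom"
  using smooth_onD(1)[OF m_smooth] smooth_onD(1)[OF i_smooth] .

lemma A'_symmetric:
  assumes "(x, y) \<in> mdom" shows "A' b x y c = A' c x y b"
proof (rule symmetric_second_derivative[of "{y. (x, y) \<in> mdom}" y "\<lambda>y. m (x, y)" "A x" "\<lambda>b. A' b x"])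
  show "open {y. (x, y) \<in> mdom}" by (rule open_pair_slice[OF open_mdom])
  show "continuous_on {y. (x, y) \<in> mdom} (\<lambda>y. A' u x y v)" for u v
    unfolding A'_def
    by (rule smooth_on_derivative_continuous[OF A_smooth]) (auto intro!: continuous_intros)
qed (use assms A_derivative A'_derivative in auto)

lemma A_x0_x0: "A x\<^sub>0 x\<^sub>0 b = b"
proof -
  have "((\<lambda>y. m (x\<^sub>0, y)) has_derivative (\<lambda>b. b)) (at x\<^sub>0)"
    by (rule has_derivative_transform_within_open[OF has_derivative_ident c0_facts(2) x0_in]) simp
  then have "A x\<^sub>0 x\<^sub>0 = (\<lambda>b. b)"
    using A_derivative[OF mdom_x0(1)[OF x0_in]] by (rule has_derivative_unique[symmetric])
  then show ?thesis by simp
qed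

text \<open>The left-invariant vector field with value \<open>v\<close> at the identity.\<close>

definition X :: "'e \<Rightarrow> 'e \<Rightarrow> 'e" where "X v x = A x x\<^sub>0 v"

lemma left_inv_field_eq: "x \<in> Om \<Longrightarrow> left_inv_field G c\<^sub>0 v x = X v x"
  unfolding left_inv_field_def left_diff_def X_def
  using frechet_derivative_at[OF A_derivative[OF mdom_x0(1)], of x] by (simp add: m_def)

text \<open>Differentiate the associative law \<open>q (y z) = (q y) z\<close> with respect to \<open>z\<close> at the identity.\<close>

lemma X_left_invariant:
  assumes "(q, y) \<in> mdom" shows "A q y (X v y) = X v (m (q, y))"
proof -
  note D = mdomD[OF assms]
  define S where "S = {z. (y, z) \<in> mdom} \<inter> {z. (m (q, y), z) \<in> mdom}"
  have S: "open S" "x\<^sub>0 \<in> S" unfolding S_def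
    using open_pair_slice[OF open_mdom] mdom_x0(1) D by auto
  have eq: "m (q, m (y, z)) = m (m (q, y), z)" if "z \<in> S" for z
  proof -
    have "(y, z) \<in> mdom" "(m (q, y), z) \<in> mdom" using that by (auto simp: S_def)
    then show ?thesis
      using mdomD(4)[of y z] D(4) by (simp add: m_def gr.assoc)
  qed
  have 1: "((\<lambda>z. m (y, z)) has_derivative A y x\<^sub>0) (at x\<^sub>0)" "((\<lambda>z. m (m (q, y), z)) has_derivative A (m (q, y)) x\<^sub>0) (at x\<^sub>0)"
    using A_derivative mdom_x0(1) D by auto
  have "((\<lambda>y. m (q, y)) has_derivative A q y) (at (m (y, x\<^sub>0)))" using A_derivative[OF assms] D by simp
  from has_derivative_compose[OF 1(1) this]
  have "((\<lambda>z. m (q, m (y, z))) has_derivative (\<lambda>v. A q y (A y x\<^sub>0 v))) (at x\<^sub>0)" .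
  then have "((\<lambda>z. m (m (q, y), z)) has_derivative (\<lambda>v. A q y (A y x\<^sub>0 v))) (at x\<^sub>0)"
    by (rule has_derivative_transform_within_open[OF _ S]) (rule eq)
  from has_derivative_unique[OF this 1(2)] show ?thesis by (simp add: X_def fun_eq_iff)
qed

text \<open>The Maurer-Cartan form: a tangent vector at \<open>x\<close> is translated to the identity.\<close>

definition \<theta> :: "'e \<Rightarrow> 'e \<Rightarrow> 'e" where "\<theta> x b = A (i x) x b"

lemma \<theta>_linear: "x \<in> idom \<Longrightarrow> linear (\<theta> x)"
  unfolding \<theta>_def[abs_def] using A_linear i_mdom(1) by blast

lemma X_linear: "x \<in> Om \<Longrightarrow> linear (\<lambda>v. X v x)"
  unfolding X_def[abs_def] using A_linear mdom_x0(1) by blast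

lemma \<theta>_X: assumes "x \<in> idom" shows "\<theta> x (X v x) = v"
proof -
  have "\<theta> x (X v x) = X v x\<^sub>0"
    unfolding \<theta>_def using X_left_invariant[OF i_mdom(1)[OF assms]] i_mdom(2)[OF assms] by simp
  then show ?thesis by (simp add: X_def A_x0_x0)
qed

lemma X_\<theta>: assumes "x \<in> idom" shows "X (\<theta> x b) x = b"
proof -
  have "\<theta> x \<circ> (\<lambda>v. X v x) = id" using \<theta>_X[OF assms] by (simp add: fun_eq_iff)
  then have "(\<lambda>v. X v x) \<circ> \<theta> x = id"
    using linear_inverse_left[OF X_linear \<theta>_linear, of x x] assms idomD(1) by blast
  then show ?thesis by (simp add: fun_eq_iff)
qed

lemma \<theta>_x0: "\<theta> x\<^sub>0 b = b" by (simp add: \<theta>_def A_x0_x0)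

text \<open>The Maurer-Cartan form is invariant under left translations.\<close>

lemma \<theta>_pullback:
  assumes "(q, y) \<in> mdom" "y \<in> idom" "m (q, y) \<in> idom"
  shows "\<theta> (m (q, y)) (A q y b) = \<theta> y b"
proof -
  have "A q y b = X (\<theta> y b) (m (q, y))"
    using X_left_invariant[OF assms(1), of "\<theta> y b"] X_\<theta>[OF assms(2)] by simp
  then show ?thesis using \<theta>_X[OF assms(3)] by simp
qed

text \<open>The derivative of \<open>x \<mapsto> \<theta> x b\<close> at \<open>x\<close> in the direction \<open>c\<close>, written out with the chain rule so that
its continuity is visible.\<close>

definition \<theta>' :: "'e \<Rightarrow> 'e \<Rightarrow> 'e \<Rightarrow> 'e" where
  "\<theta>' b x c = frechet_derivative (\<lambda>z. A (fst z) (snd z) b) (at (i x, x)) (frechet_derivative i (at x) c, c)"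

lemma \<theta>'_derivative: assumes "x \<in> idom" shows "((\<lambda>x. \<theta> x b) has_derivative \<theta>' b x) (at x)"
proof -
  have "((\<lambda>x. (i x, x)) has_derivative (\<lambda>c. (frechet_derivative i (at x) c, c))) (at x)"
    using smooth_onD(3)[OF i_smooth assms] by (intro has_derivative_Pair) auto
  from has_derivative_compose[OF this smooth_onD(3)[OF A_smooth i_mdom(1)[OF assms]]]
  show ?thesis by (simp add: \<theta>_def \<theta>'_def[abs_def])
qed

lemma \<theta>'_continuous: "continuous_on idom (\<lambda>x. \<theta>' b x c)"
  unfolding \<theta>'_def
proof (rule smooth_on_derivative_continuous[OF A_smooth])
  show "continuous_on idom (\<lambda>x. (i x, x))"
    by (intro continuous_intros smooth_onD(2)[OF i_smooth])
  show "continuous_on idom (\<lambda>x. (frechet_derivative i (at x) c, c))"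
    by (intro continuous_intros smooth_onD(2)[OF smooth_onD(4)[OF i_smooth]])
qed (use i_mdom(1) in auto)

lemma \<theta>'_linear: assumes "x \<in> idom" shows "linear (\<theta>' b x)" "linear (\<lambda>b. \<theta>' b x c)"
proof -
  show "linear (\<theta>' b x)" using \<theta>'_derivative[OF assms] by (rule has_derivative_linear)
  show "linear (\<lambda>b. \<theta>' b x c)"
  proof (rule linearI)
    fix a b
    have "((\<lambda>x. \<theta> x a + \<theta> x b) has_derivative (\<lambda>c. \<theta>' a x c + \<theta>' b x c)) (at x)"
      by (intro has_derivative_add \<theta>'_derivative assms)
    then have "((\<lambda>x. \<theta> x (a + b)) has_derivative (\<lambda>c. \<theta>' a x c + \<theta>' b x c)) (at x)"
      by (rule has_derivative_transform_within_open[OF _ open_idom assms]) (simp add: linear_add[OF \<theta>_linear])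
    from has_derivative_unique[OF this \<theta>'_derivative[OF assms]]
    show "\<theta>' (a + b) x c = \<theta>' a x c + \<theta>' b x c" by (simp add: fun_eq_iff)
  next
    fix k b
    have "((\<lambda>x. k *\<^sub>R \<theta> x b) has_derivative (\<lambda>c. k *\<^sub>R \<theta>' b x c)) (at x)"
      by (intro has_derivative_scaleR_right \<theta>'_derivative assms)
    then have "((\<lambda>x. \<theta> x (k *\<^sub>R b)) has_derivative (\<lambda>c. k *\<^sub>R \<theta>' b x c)) (at x)"
      by (rule has_derivative_transform_within_open[OF _ open_idom assms]) (simp add: linear_cmul[OF \<theta>_linear])
    from has_derivative_unique[OF this \<theta>'_derivative[OF assms]]
    show "\<theta>' (k *\<^sub>R b) x c = k *\<^sub>R \<theta>' b x c" by (simp add: fun_eq_iff)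
  qed
qed

text \<open>Differentiate \<open>\<theta> x (X w x) = w\<close> at the identity.\<close>

lemma X_derivative_x0: "((\<lambda>x. X w x) has_derivative (\<lambda>v. - \<theta>' w x\<^sub>0 v)) (at x\<^sub>0)"
proof -
  let ?D = "frechet_derivative (\<lambda>z. A (fst z) (snd z) w) (at (x\<^sub>0, x\<^sub>0))"
  have "((\<lambda>x. (x, x\<^sub>0)) has_derivative (\<lambda>v. (v, 0))) (at x\<^sub>0)"
    by (auto intro!: derivative_eq_intros)
  from has_derivative_compose[OF this smooth_onD(3)[OF A_smooth mdom_x0(1)[OF x0_in]], of w]
  have XD: "((\<lambda>x. X w x) has_derivative (\<lambda>v. ?D (v, 0))) (at x\<^sub>0)" by (simp add: X_def)
  have "((\<lambda>x. \<theta> x (X w x)) has_derivative (\<lambda>v. \<theta>' (X w x\<^sub>0) x\<^sub>0 v + \<theta> x\<^sub>0 (?D (v, 0)))) (at x\<^sub>0)"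
    by (rule has_derivative_linear_family[OF open_idom x0_idom \<theta>_linear \<theta>'_derivative[OF x0_idom] XD])
  then have 1: "((\<lambda>x. \<theta> x (X w x)) has_derivative (\<lambda>v. \<theta>' w x\<^sub>0 v + ?D (v, 0))) (at x\<^sub>0)"
    by (simp add: \<theta>_x0 X_def A_x0_x0)
  have 2: "((\<lambda>x. \<theta> x (X w x)) has_derivative (\<lambda>v. 0)) (at x\<^sub>0)"
    by (rule has_derivative_transform_within_open[OF has_derivative_const[of w] open_idom x0_idom]) (simp add: \<theta>_X)
  have "\<theta>' w x\<^sub>0 v + ?D (v, 0) = 0" for v using has_derivative_unique[OF 1 2] by (simp add: fun_eq_iff)
  then have "?D (v, 0) = - \<theta>' w x\<^sub>0 v" for v by (simp add: eq_neg_iff_add_eq_0 add.commute)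
  then show ?thesis using XD by simp
qed

lemma lie_bracket_eq: "lie_bracket G c\<^sub>0 v w = \<theta>' v x\<^sub>0 w - \<theta>' w x\<^sub>0 v"
proof -
  have d: "frechet_derivative (left_inv_field G c\<^sub>0 w) (at x\<^sub>0) = (\<lambda>v. - \<theta>' w x\<^sub>0 v)" for w
  proof -
    have "(left_inv_field G c\<^sub>0 w has_derivative (\<lambda>v. - \<theta>' w x\<^sub>0 v)) (at x\<^sub>0)"
      by (rule has_derivative_transform_within_open[OF X_derivative_x0 c0_facts(2) x0_in])
        (simp add: left_inv_field_eq)
    then show ?thesis by (rule frechet_derivative_at[symmetric])
  qed
  have v: "left_inv_field G c\<^sub>0 v x\<^sub>0 = v" for v
    using left_inv_field_eq[OF x0_in] by (simp add: X_def A_x0_x0)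
  show ?thesis unfolding lie_bracket_def Let_def d v by simp
qed

text \<open>By invariance, \<open>\<theta>\<close> near \<open>x\<close> is the pullback of \<open>\<theta>\<close> near the identity under the translation by the
inverse of \<open>x\<close>. Differentiating the pullback produces the derivative of \<open>\<theta>\<close> at the identity, whose
antisymmetric part is the bracket, and the second derivative of the translation, which is symmetric
and drops out.\<close>

theorem Maurer_Cartan:
  assumes "x \<in> idom"
  shows "\<theta>' b x c - \<theta>' c x b = lie_bracket G c\<^sub>0 (\<theta> x b) (\<theta> x c)"
proof -
  define q where "q = i x"
  have qx: "(q, x) \<in> mdom" "m (q, x) = x\<^sub>0" using i_mdom[OF assms] by (auto simp: q_def)
  define S where "S = {y \<in> idom \<inter> {y. (q, y) \<in> mdom}. m (q, y) \<in> idom}"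
  have cont: "continuous_on (idom \<inter> {y. (q, y) \<in> mdom}) (\<lambda>y. m (q, y))"
    by (rule continuous_on_compose2[OF smooth_onD(2)[OF m_smooth]]) (auto intro!: continuous_intros)
  have "open (idom \<inter> {y. (q, y) \<in> mdom})"
    by (intro open_Int open_idom open_pair_slice open_mdom)
  then have "open ((idom \<inter> {y. (q, y) \<in> mdom}) \<inter> (\<lambda>y. m (q, y)) -` idom)"
    using continuous_open_preimage[OF cont _ open_idom] by blast
  also have "(idom \<inter> {y. (q, y) \<in> mdom}) \<inter> (\<lambda>y. m (q, y)) -` idom = S" by (auto simp: S_def)
  finally have "open S" .
  moreover have "x \<in> S" using assms qx x0_idom by (simp add: S_def)
  ultimately have S: "open S" "x \<in> S" .
  have Aq: "A q x b = \<theta> x b" for b by (simp add: \<theta>_def q_def)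
  have key: "\<theta>' b x c = \<theta>' (\<theta> x b) x\<^sub>0 (\<theta> x c) + A' b q x c" for b c
  proof -
    have T: "((\<lambda>y. \<theta> (m (q, y)) d) has_derivative (\<lambda>c. \<theta>' d x\<^sub>0 (A q x c))) (at x)" for d
      using has_derivative_compose[OF A_derivative[OF qx(1)], of "\<lambda>z. \<theta> z d" "\<theta>' d x\<^sub>0"] \<theta>'_derivative[OF x0_idom]
      by (simp add: qx(2))
    have "((\<lambda>y. \<theta> (m (q, y)) (A q y b)) has_derivative (\<lambda>c. \<theta>' (A q x b) x\<^sub>0 (A q x c) + \<theta> (m (q, x)) (A' b q x c))) (at x)"
      by (rule has_derivative_linear_family[OF S _ T A'_derivative[OF qx(1)]]) (auto simp: S_def intro: \<theta>_linear)
    then have "((\<lambda>y. \<theta> y b) has_derivative (\<lambda>c. \<theta>' (A q x b) x\<^sub>0 (A q x c) + \<theta> (m (q, x)) (A' b q x c))) (at x)"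
      by (rule has_derivative_transform_within_open[OF _ S]) (auto simp: S_def intro: \<theta>_pullback)
    from has_derivative_unique[OF this \<theta>'_derivative[OF assms]]
    show ?thesis by (simp add: fun_eq_iff qx(2) \<theta>_x0 Aq)
  qed
  show ?thesis
    unfolding lie_bracket_eq key[of b c] key[of c b] by (simp add: A'_symmetric[OF qx(1), of c b])
qed

end

section \<open>The logarithm\<close>

locale two_step_lie_chart = lie_chart G c\<^sub>0
  for G :: "('g::{t2_space, second_countable_topology}, 'e::euclidean_space) lie_struct"
    and c\<^sub>0 :: "('g, 'e) chart" +
  assumes two_step: "two_step_nilpotent G c\<^sub>0"
begin

lemma lie_bracket_bilinear: "bounded_bilinear (lie_bracket G c\<^sub>0)"
proof -
  have "bilinear (lie_bracket G c\<^sub>0)"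
    unfolding bilinear_def lie_bracket_eq
    using \<theta>'_linear[OF x0_idom] by (auto intro!: linear_compose_sub)
  then show ?thesis by (simp add: bilinear_conv_bounded_bilinear)
qed

lemma lie_bracket_nil: "lie_bracket G c\<^sub>0 a (lie_bracket G c\<^sub>0 b c) = 0"
proof -
  have "lie_bracket G c\<^sub>0 b c \<in> bracket_space G c\<^sub>0 UNIV UNIV"
    unfolding bracket_space_def by (rule span_base) blast
  then have "lie_bracket G c\<^sub>0 a (lie_bracket G c\<^sub>0 b c) \<in> bracket_space G c\<^sub>0 UNIV (bracket_space G c\<^sub>0 UNIV UNIV)"
    unfolding bracket_space_def[of G c\<^sub>0 UNIV "bracket_space G c\<^sub>0 UNIV UNIV"] by (intro span_base) blast
  then show ?thesis using two_step unfolding two_step_nilpotent_def by simp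
qed

sublocale two_step_bracket "lie_bracket G c\<^sub>0"
proof (rule two_step_bracket.intro)
  show "lie_bracket G c\<^sub>0 x x = 0" for x by (simp add: lie_bracket_eq)
qed (rule lie_bracket_bilinear lie_bracket_nil)+

abbreviation "br \<equiv> lie_bracket G c\<^sub>0"
notation bch (infixl "\<odot>" 70)

lemma Z_eq_bracket_space: "Z = bracket_space G c\<^sub>0 UNIV UNIV"
  unfolding Z_def bracket_space_def by simp

lemma br_mod_Z: assumes "x - y \<in> Z" shows "br x w = br y w" "br w x = br w y"
  using Z_central[OF assms, of w] by (simp_all add: br.diff_left br.diff_right)

text \<open>The form \<open>\<theta> + 1/2 [F, \<theta>]\<close> of which the logarithm \<open>F\<close> is to be a primitive: \<open>F\<close> then maps the
left-invariant field of \<open>v\<close> to the field \<open>y \<mapsto> v + 1/2 [y, v]\<close>, which is left-invariant for \<open>\<odot>\<close>.\<close>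

definition Fdiff :: "('e \<Rightarrow> 'e) \<Rightarrow> 'e \<Rightarrow> 'e \<Rightarrow> 'e" where
  "Fdiff F x b = \<theta> x b + (1/2) *\<^sub>R br (F x) (\<theta> x b)"

text \<open>The equation for \<open>F\<close> contains \<open>F\<close>, but only modulo \<open>Z\<close>. So one first integrates \<open>P \<theta>\<close>, where
\<open>P\<close> is a projection along \<open>Z\<close>: it is closed since \<open>P\<close> kills brackets. With the primitive \<open>h\<close> in place of \<open>F\<close>
the form \<open>\<theta> + 1/2 [h, \<theta>]\<close> is closed by the Maurer-Cartan equation, and its primitive \<open>F\<close> satisfies
\<open>P F = h\<close>.\<close>

lemma logarithm_exists:
  obtains F r where "r > 0" "ball x\<^sub>0 r \<subseteq> idom" "F x\<^sub>0 = 0"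
    "\<And>x. x \<in> ball x\<^sub>0 r \<Longrightarrow> (F has_derivative Fdiff F x) (at x)"
proof -
  obtain P where P: "linear P" "\<And>z. z \<in> Z \<Longrightarrow> P z = 0" "\<And>x. x - P x \<in> Z" using projection_along_subspace[OF Z_subspace] by blast
  have brP: "br (P x) w = br x w" "br w (P x) = br w x" for x w using br_mod_Z[OF P(3)] by metis+
  have Pbl: "bounded_linear P" using P(1) by (simp add: linear_conv_bounded_linear)
  obtain r where r: "r > 0" "ball x\<^sub>0 r \<subseteq> idom" using open_idom x0_idom open_contains_ball by blast
  have sub: "x \<in> idom" if "x \<in> ball x\<^sub>0 r" for x using r that by blast
  have cont_\<theta>': "continuous_on (ball x\<^sub>0 r) (\<lambda>x. \<theta>' b x c)" for b c
    using \<theta>'_continuous r(2) by (rule continuous_on_subset)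
  have der_\<theta>: "((\<lambda>x. \<theta> x b) has_derivative \<theta>' b x) (at x)" if "x \<in> ball x\<^sub>0 r" for x b
    using \<theta>'_derivative[OF sub[OF that]] .
  have cont_\<theta>: "continuous_on (ball x\<^sub>0 r) (\<lambda>x. \<theta> x b)" for b
    by (rule has_derivative_continuous_on[of _ _ "\<theta>' b"], rule has_derivative_at_withinI, rule der_\<theta>)
  obtain h where h: "h x\<^sub>0 = 0" "\<And>x. x \<in> ball x\<^sub>0 r \<Longrightarrow> (h has_derivative (\<lambda>b. P (\<theta> x b))) (at x)"
  proof (rule Poincare_lemma_ball[of r x\<^sub>0 "\<lambda>x b. P (\<theta> x b)" "\<lambda>b x c. P (\<theta>' b x c)"])
    fix x b c assume x: "x \<in> ball x\<^sub>0 r"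
    show "linear (\<lambda>b. P (\<theta> x b))" using linear_compose[OF \<theta>_linear[OF sub[OF x]] P(1)] by (simp add: o_def)
    show "((\<lambda>x. P (\<theta> x b)) has_derivative (\<lambda>c. P (\<theta>' b x c))) (at x)"
      by (rule bounded_linear.has_derivative[OF Pbl der_\<theta>[OF x]])
    have "P (\<theta>' b x c - \<theta>' c x b) = 0" unfolding Maurer_Cartan[OF sub[OF x]] by (rule P(2)[OF br_in_Z])
    then show "P (\<theta>' b x c) = P (\<theta>' c x b)" by (simp add: linear_diff[OF P(1)])
  next
    fix b c show "continuous_on (ball x\<^sub>0 r) (\<lambda>x. P (\<theta>' b x c))"
      by (rule bounded_linear.continuous_on[OF Pbl cont_\<theta>'])
  qed (use r in auto)
  have cont_h: "continuous_on (ball x\<^sub>0 r) h"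
    by (rule has_derivative_continuous_on[of _ _ "\<lambda>x b. P (\<theta> x b)"], rule has_derivative_at_withinI, rule h(2))
  define \<omega> where "\<omega> x b = \<theta> x b + (1/2) *\<^sub>R br (h x) (\<theta> x b)" for x b
  define \<omega>' where "\<omega>' b x c = \<theta>' b x c + (1/2) *\<^sub>R (br (h x) (\<theta>' b x c) + br (P (\<theta> x c)) (\<theta> x b))" for b x c
  obtain F where F: "F x\<^sub>0 = 0" "\<And>x. x \<in> ball x\<^sub>0 r \<Longrightarrow> (F has_derivative \<omega> x) (at x)"
  proof (rule Poincare_lemma_ball[of r x\<^sub>0 \<omega> \<omega>'])
    fix x b c assume x: "x \<in> ball x\<^sub>0 r"
    show "linear (\<omega> x)" unfolding \<omega>_def
      by (rule linearI) (simp_all add: linear_add[OF \<theta>_linear[OF sub[OF x]]] linear_cmul[OF \<theta>_linear[OF sub[OF x]]]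
        br.add_right br.scaleR_right scaleR_add_right)
    show "((\<lambda>x. \<omega> x b) has_derivative \<omega>' b x) (at x)"
      unfolding \<omega>_def \<omega>'_def
      by (intro has_derivative_add der_\<theta>[OF x] has_derivative_scaleR_right br.FDERIV h(2)[OF x])
    have "\<omega>' b x c - \<omega>' c x b = (\<theta>' b x c - \<theta>' c x b) + (1/2) *\<^sub>R (br (h x) (\<theta>' b x c - \<theta>' c x b)
        + (br (\<theta> x c) (\<theta> x b) - br (\<theta> x b) (\<theta> x c)))"
      unfolding \<omega>'_def brP by (simp add: br.diff_right algebra_simps)
    also have "\<dots> = 0"
    proof -
      have "- u - u = (-2) *\<^sub>R u" for u :: 'e by (simp add: scaleR_2)
      then show ?thesis
        unfolding Maurer_Cartan[OF sub[OF x]] nil skew[of "\<theta> x c" "\<theta> x b"] by simp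
    qed
    finally show "\<omega>' b x c = \<omega>' c x b" by simp
  next
    fix b c show "continuous_on (ball x\<^sub>0 r) (\<lambda>x. \<omega>' b x c)"
      unfolding \<omega>'_def
      by (intro continuous_intros br.continuous_on cont_\<theta>' cont_h cont_\<theta> bounded_linear.continuous_on[OF Pbl])
  qed (use r in auto)
  have PF: "P (F x) = h x" if "x \<in> ball x\<^sub>0 r" for x
  proof -
    have "((\<lambda>y. P (F y) - h y) has_derivative (\<lambda>b. 0)) (at y within ball x\<^sub>0 r)" if y: "y \<in> ball x\<^sub>0 r" for y
    proof -
      have "((\<lambda>y. P (F y) - h y) has_derivative (\<lambda>b. P (\<omega> y b) - P (\<theta> y b))) (at y)"
        by (intro has_derivative_diff bounded_linear.has_derivative[OF Pbl] F(2) h(2) y)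
      moreover have "P (\<omega> y b) - P (\<theta> y b) = 0" for b
        using P(2)[OF br_in_Z] by (simp add: \<omega>_def linear_add[OF P(1)] linear_cmul[OF P(1)])
      ultimately show ?thesis by (auto intro: has_derivative_at_withinI)
    qed
    from has_derivative_zero_unique[OF convex_ball this that, of x\<^sub>0]
    have "P (F x) - h x = P (F x\<^sub>0) - h x\<^sub>0" using r by auto
    then show ?thesis by (simp add: F h linear_0[OF P(1)])
  qed
  have "\<omega> x = Fdiff F x" if "x \<in> ball x\<^sub>0 r" for x
    unfolding \<omega>_def[abs_def] Fdiff_def[abs_def] using PF[OF that] brP(1)[of "F x"] by simp
  then have Fd: "(F has_derivative Fdiff F x) (at x)" if "x \<in> ball x\<^sub>0 r" for x
    using F(2)[OF that] that by simp
  show ?thesis using that[of r F, OF r F(1) Fd] by simp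
qed

text \<open>Both sides, as functions of \<open>y\<close>, solve the equation that says that left-invariant fields are mapped
to left-invariant fields, and agree at the identity. The difference \<open>E\<close> satisfies
\<open>dE = 1/2 [E, \<theta>]\<close>; so \<open>E\<close> vanishes first modulo \<open>Z\<close> and then altogether.\<close>

lemma logarithm_homomorphism:
  assumes r: "r > 0" "ball x\<^sub>0 r \<subseteq> idom" and F0: "F x\<^sub>0 = 0"
    and F: "\<And>x. x \<in> ball x\<^sub>0 r \<Longrightarrow> (F has_derivative Fdiff F x) (at x)"
    and s: "s \<le> r" "\<And>x y. x \<in> ball x\<^sub>0 s \<Longrightarrow> y \<in> ball x\<^sub>0 s \<Longrightarrow> (x, y) \<in> mdom \<and> m (x, y) \<in> ball x\<^sub>0 r"
    and xy: "x \<in> ball x\<^sub>0 s" "y \<in> ball x\<^sub>0 s"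
  shows "F (m (x, y)) = F x \<odot> F y"
proof -
  obtain P where P: "linear P" "\<And>z. z \<in> Z \<Longrightarrow> P z = 0" "\<And>x. x - P x \<in> Z" using projection_along_subspace[OF Z_subspace] by blast
  have Pbl: "bounded_linear P" using P(1) by (simp add: linear_conv_bounded_linear)
  have x0s: "x\<^sub>0 \<in> ball x\<^sub>0 s" using xy by (simp add: le_less_trans[OF zero_le_dist])
  have sr: "z \<in> ball x\<^sub>0 r" if "z \<in> ball x\<^sub>0 s" for z using that s by auto
  define E where "E y = F (m (x, y)) - F x \<odot> F y" for y
  have ED: "(E has_derivative (\<lambda>b. (1/2) *\<^sub>R br (E z) (\<theta> z b))) (at z)" if z: "z \<in> ball x\<^sub>0 s" for z
  proof -
    have md: "(x, z) \<in> mdom" "m (x, z) \<in> ball x\<^sub>0 r" using s(2)[OF xy(1) z] by auto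
    have pb: "\<theta> (m (x, z)) (A x z b) = \<theta> z b" for b
      using \<theta>_pullback[OF md(1)] sr[OF z] md(2) r(2) by blast
    have 1: "((\<lambda>y. F (m (x, y))) has_derivative (\<lambda>b. \<theta> z b + (1/2) *\<^sub>R br (F (m (x, z))) (\<theta> z b))) (at z)"
      using has_derivative_compose[OF A_derivative[OF md(1)] F[OF md(2)]] by (simp add: pb Fdiff_def)
    have 2: "((\<lambda>y. F x \<odot> F y) has_derivative (\<lambda>b. (\<theta> z b + (1/2) *\<^sub>R br (F z) (\<theta> z b)) +
        (1/2) *\<^sub>R br (F x) (\<theta> z b + (1/2) *\<^sub>R br (F z) (\<theta> z b)))) (at z)"
      using has_derivative_add[OF has_derivative_add[OF has_derivative_const F[OF sr[OF z]]]
          has_derivative_scaleR_right[OF bounded_linear.has_derivative[OF br.bounded_linear_right F[OF sr[OF z]]]]]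
      by (simp add: bch_def Fdiff_def)
    show ?thesis unfolding E_def
      by (rule has_derivative_eq_rhs[OF has_derivative_diff[OF 1 2]])
        (simp add: fun_eq_iff bch_def br_simps algebra_simps)
  qed
  have E0: "E x\<^sub>0 = 0"
    using mdomD(1)[of x x\<^sub>0] s(2)[OF xy(1) x0s] by (simp add: E_def F0)
  have PE: "P (E z) = 0" if z: "z \<in> ball x\<^sub>0 s" for z
  proof -
    have "((\<lambda>y. P (E y)) has_derivative (\<lambda>b. 0)) (at y within ball x\<^sub>0 s)" if y: "y \<in> ball x\<^sub>0 s" for y
    proof -
      have "((\<lambda>y. P (E y)) has_derivative (\<lambda>b. P ((1/2) *\<^sub>R br (E y) (\<theta> y b)))) (at y)"
        by (intro bounded_linear.has_derivative[OF Pbl] ED y)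
      then show ?thesis using P(2)[OF br_in_Z] by (auto simp: linear_cmul[OF P(1)] intro: has_derivative_at_withinI)
    qed
    from has_derivative_zero_unique[OF convex_ball this z x0s] show ?thesis by (simp add: E0 linear_0[OF P(1)])
  qed
  have "(E has_derivative (\<lambda>b. 0)) (at z within ball x\<^sub>0 s)" if z: "z \<in> ball x\<^sub>0 s" for z
  proof -
    have "E z \<in> Z" using P(3)[of "E z"] PE[OF z] by simp
    then have "br (E z) w = 0" for w by (rule Z_central)
    then show ?thesis using ED[OF z] by (auto intro: has_derivative_at_withinI)
  qed
  from has_derivative_zero_unique[OF convex_ball this xy(2) x0s] show ?thesis by (simp add: E0 E_def[of y])
qed

lemma Fdiff_X: assumes "x \<in> idom" shows "Fdiff F x (X (w - (1/2) *\<^sub>R br (F x) w) x) = w"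
  by (simp add: Fdiff_def \<theta>_X[OF assms] br_simps)

text \<open>The logarithm has the identity as its derivative at \<open>x\<^sub>0\<close>, so it has a local inverse \<open>\<psi>\<close>. The explicit
formula for the derivative of \<open>\<psi>\<close> shows that it is continuous.\<close>

lemma local_exponential:
  obtains F \<psi> U V s where
    "open U" "x\<^sub>0 \<in> U" "U \<subseteq> idom" "open V" "0 \<in> V" "homeomorphism U V F \<psi>" "F x\<^sub>0 = 0"
    "\<And>x. x \<in> U \<Longrightarrow> (F has_derivative Fdiff F x) (at x)" "\<And>v. continuous_on U (\<lambda>x. Fdiff F x v)"
    "\<And>y. y \<in> V \<Longrightarrow> (\<psi> has_derivative (\<lambda>w. X (w - (1/2) *\<^sub>R br y w) (\<psi> y))) (at y)"
    "\<And>w. continuous_on V (\<lambda>y. X (w - (1/2) *\<^sub>R br y w) (\<psi> y))"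
    "s > 0" "ball 0 s \<subseteq> V"
    "\<And>u v. u \<in> ball 0 s \<Longrightarrow> v \<in> ball 0 s \<Longrightarrow> u \<odot> v \<in> V \<and> \<kappa> (\<psi> (u \<odot> v)) = \<kappa> (\<psi> u) \<cdot> \<kappa> (\<psi> v)"
proof -
  obtain F r where r: "r > 0" "ball x\<^sub>0 r \<subseteq> idom" and F0: "F x\<^sub>0 = 0"
    and F: "\<And>x. x \<in> ball x\<^sub>0 r \<Longrightarrow> (F has_derivative Fdiff F x) (at x)"
    by (rule logarithm_exists, rule that)
  let ?B = "ball x\<^sub>0 r"
  have x0B: "x\<^sub>0 \<in> ?B" using r by simp
  have cont_F: "continuous_on ?B F"
    by (rule has_derivative_continuous_on[of _ _ "Fdiff F"], rule has_derivative_at_withinI, rule F)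
  have cont_\<theta>: "continuous_on ?B (\<lambda>x. \<theta> x b)" for b
    by (rule has_derivative_continuous_on[of _ _ "\<theta>' b"], rule has_derivative_at_withinI, rule \<theta>'_derivative)
      (use r in blast)
  have cont_D: "continuous_on ?B (\<lambda>x. Fdiff F x v)" for v
    unfolding Fdiff_def by (intro continuous_intros br.continuous_on cont_F cont_\<theta>)
  have bl: "bounded_linear (Fdiff F x)" if "x \<in> ?B" for x
    using F[OF that] by (rule has_derivative_bounded_linear)
  have der: "(F has_derivative blinfun_apply (Blinfun (Fdiff F x))) (at x)" if "x \<in> ?B" for x
    using F[OF that] by (simp add: bounded_linear_Blinfun_apply bl[OF that])
  have contB: "continuous_on ?B (\<lambda>x. Blinfun (Fdiff F x))"
    using bl cont_D by (rule continuous_on_Blinfun_componentwise)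
  have id: "id_blinfun o\<^sub>L Blinfun (Fdiff F x\<^sub>0) = id_blinfun"
    by (rule blinfun_eqI) (simp add: bounded_linear_Blinfun_apply bl[OF x0B], simp add: Fdiff_def F0 \<theta>_x0 br.zero_left)
  obtain U V \<psi> \<psi>' where UV: "open U" "U \<subseteq> ?B" "x\<^sub>0 \<in> U" "open V" "F x\<^sub>0 \<in> V" "homeomorphism U V F \<psi>"
    and \<psi>': "\<And>y. y \<in> V \<Longrightarrow> (\<psi> has_derivative (\<psi>' y)) (at y)"
      "\<And>y. y \<in> V \<Longrightarrow> \<psi>' y = inv (blinfun_apply (Blinfun (Fdiff F (\<psi> y))))"
      "\<And>y. y \<in> V \<Longrightarrow> bij (blinfun_apply (Blinfun (Fdiff F (\<psi> y))))"
    by (rule inverse_function_theorem[OF open_ball der contB x0B id], assumption+, rule that)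
  have hom: "\<psi> (F x) = x" "F x \<in> V" if "x \<in> U" for x using UV(6) that by (auto simp: homeomorphism_def)
  have hom': "F (\<psi> y) = y" "\<psi> y \<in> U" if "y \<in> V" for y using UV(6) that by (auto simp: homeomorphism_def)
  have \<psi>0: "\<psi> 0 = x\<^sub>0" using hom(1)[OF UV(3)] F0 by simp
  have cont_\<psi>: "continuous_on V \<psi>" using UV(6) by (auto simp: homeomorphism_def)
  have \<psi>_der: "(\<psi> has_derivative (\<lambda>w. X (w - (1/2) *\<^sub>R br y w) (\<psi> y))) (at y)" if y: "y \<in> V" for y
  proof -
    have "\<psi> y \<in> ?B" using hom'(2)[OF y] UV(2) by blast
    then have i: "\<psi> y \<in> idom" and eq: "blinfun_apply (Blinfun (Fdiff F (\<psi> y))) = Fdiff F (\<psi> y)"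
      using r(2) bounded_linear_Blinfun_apply[OF bl] by auto
    have "\<psi>' y w = X (w - (1/2) *\<^sub>R br y w) (\<psi> y)" for w
      unfolding \<psi>'(2)[OF y] eq
      using Fdiff_X[OF i, of F w] \<psi>'(3)[OF y] hom'(1)[OF y] unfolding eq by (metis bij_is_inj inv_f_eq)
    then have "\<psi>' y = (\<lambda>w. X (w - (1/2) *\<^sub>R br y w) (\<psi> y))" by blast
    then show ?thesis using \<psi>'(1)[OF y] by simp
  qed
  have cont_\<psi>': "continuous_on V (\<lambda>y. X (w - (1/2) *\<^sub>R br y w) (\<psi> y))" for w
    unfolding X_def A_def
  proof (rule smooth_on_derivative_continuous[OF m_smooth])
    show "continuous_on V (\<lambda>y. (0, w - (1/2) *\<^sub>R br y w))"
      by (intro continuous_intros br.continuous_on)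
    show "(\<lambda>y. (\<psi> y, x\<^sub>0)) ` V \<subseteq> mdom"
    proof clarify
      fix y assume "y \<in> V"
      then have "\<psi> y \<in> idom" using hom'(2) UV(2) r(2) by blast
      then show "(\<psi> y, x\<^sub>0) \<in> mdom" by (intro mdom_x0(1) idomD(1))
    qed
  qed (intro continuous_intros cont_\<psi>)
  have "continuous_on mdom m" by (rule smooth_onD(2)[OF m_smooth])
  then have "open (mdom \<inter> m -` U)" using open_mdom UV(1) by (simp add: continuous_open_preimage)
  moreover have "(x\<^sub>0, x\<^sub>0) \<in> mdom \<inter> m -` U" using mdom_x0(1)[OF x0_in] x0_in UV(3) by simp
  ultimately obtain A B where AB: "open A" "open B" "x\<^sub>0 \<in> A" "x\<^sub>0 \<in> B" "A \<times> B \<subseteq> mdom \<inter> m -` U"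
    by (rule open_prod_elim) auto
  obtain s1 where s1: "s1 > 0" "ball x\<^sub>0 s1 \<subseteq> A \<inter> B"
    using AB open_contains_ball[of "A \<inter> B"] by blast
  define s2 where "s2 = min s1 r"
  have s2: "s2 > 0" "s2 \<le> r" using s1 r by (auto simp: s2_def)
  have s2m: "(x, y) \<in> mdom \<and> m (x, y) \<in> U" if "x \<in> ball x\<^sub>0 s2" "y \<in> ball x\<^sub>0 s2" for x y
  proof -
    have "x \<in> A" "y \<in> B" using that s1(2) by (auto simp: s2_def)
    then show ?thesis using AB(5) by blast
  qed
  have "open (V \<inter> \<psi> -` ball x\<^sub>0 s2)" using cont_\<psi> UV(4) by (simp add: continuous_open_preimage)
  moreover have "0 \<in> V \<inter> \<psi> -` ball x\<^sub>0 s2" using UV(5) F0 s2 \<psi>0 by simp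
  ultimately obtain s where s: "s > 0" "ball 0 s \<subseteq> V \<inter> \<psi> -` ball x\<^sub>0 s2"
    using open_contains_ball by blast
  have mult: "u \<odot> v \<in> V \<and> \<kappa> (\<psi> (u \<odot> v)) = \<kappa> (\<psi> u) \<cdot> \<kappa> (\<psi> v)" if uv: "u \<in> ball 0 s" "v \<in> ball 0 s" for u v
  proof -
    have V: "u \<in> V" "v \<in> V" and b: "\<psi> u \<in> ball x\<^sub>0 s2" "\<psi> v \<in> ball x\<^sub>0 s2" using uv s(2) by blast+
    have mm: "(\<psi> u, \<psi> v) \<in> mdom" "m (\<psi> u, \<psi> v) \<in> U" using s2m[OF b] by auto
    have "F (m (\<psi> u, \<psi> v)) = F (\<psi> u) \<odot> F (\<psi> v)"
      by (rule logarithm_homomorphism[OF r F0 F s2(2) _ b]) (use s2m UV(2) in blast)+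
    then have "F (m (\<psi> u, \<psi> v)) = u \<odot> v" using hom'(1) V by simp
    then show ?thesis using hom[OF mm(2)] mdomD(4)[OF mm(1)] by metis
  qed
  show ?thesis
    by (rule that[OF UV(1,3) _ UV(4) _ UV(6) F0 _ _ \<psi>_der cont_\<psi>' s(1) _ mult])
      (use UV r F F0 s continuous_on_subset[OF cont_D UV(2)] in \<open>auto\<close>)
qed

end

section \<open>The exponential map\<close>

context lie_chart
begin

primrec gpow :: "nat \<Rightarrow> 'g \<Rightarrow> 'g" where
  "gpow 0 p = gone G"
| "gpow (Suc n) p = p \<cdot> gpow n p"

lemma gr_neutral [simp]: "gone G \<cdot> p = p" "p \<cdot> gone G = p"
  by simp_all

lemma gr_inverse [simp]: "ginv G p \<cdot> p = gone G" "p \<cdot> ginv G p = gone G"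
  "ginv G p \<cdot> (p \<cdot> q) = q" "p \<cdot> (ginv G p \<cdot> q) = q"
  by (simp_all flip: gr.assoc)

lemma gpow_add: "gpow (k + n) p = gpow k p \<cdot> gpow n p"
  by (induction k) (simp_all add: gr.assoc)

lemma gpow_mult: "gpow (k * n) p = gpow k (gpow n p)"
  by (induction k) (simp_all add: gpow_add)

lemma gpow_commute: assumes "p \<cdot> q = q \<cdot> p" shows "gpow n p \<cdot> q = q \<cdot> gpow n p"
proof (induction n)
  case (Suc n)
  have "gpow (Suc n) p \<cdot> q = p \<cdot> (q \<cdot> gpow n p)" using Suc by (simp add: gr.assoc)
  also have "\<dots> = q \<cdot> gpow (Suc n) p" using assms by (simp flip: gr.assoc)
  finally show ?case .
qed simp

lemma gpow_commuting_mult: assumes "p \<cdot> q = q \<cdot> p" shows "gpow n (p \<cdot> q) = gpow n p \<cdot> gpow n q"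
proof (induction n)
  case (Suc n)
  have "gpow (Suc n) (p \<cdot> q) = p \<cdot> ((q \<cdot> gpow n p) \<cdot> gpow n q)" using Suc by (simp add: gr.assoc)
  also have "q \<cdot> gpow n p = gpow n p \<cdot> q" using gpow_commute[OF assms] by simp
  finally show ?case by (simp add: gr.assoc)
qed simp

text \<open>Each of the \<open>n (n - 1) / 2\<close> exchanges of a factor \<open>b\<close> with a factor \<open>a\<close> costs the commutator \<open>c\<^sup>2\<close>. Writing
the commutator as a square avoids halves in the exponent.\<close>

lemma collection_formula:
  assumes ab: "a \<cdot> b = (b \<cdot> a) \<cdot> (c \<cdot> c)" and ca: "c \<cdot> a = a \<cdot> c" and cb: "c \<cdot> b = b \<cdot> c"
  shows "gpow n a \<cdot> gpow n b = gpow n (a \<cdot> b) \<cdot> gpow (n * (n - 1)) c"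
proof (induction n)
  case (Suc n)
  let ?ba = "b \<cdot> a" and ?ab = "a \<cdot> b"
  have c_ba: "c \<cdot> ?ba = ?ba \<cdot> c" using ca cb by (metis gr.assoc)
  have cc_ba: "?ba \<cdot> (c \<cdot> c) = (c \<cdot> c) \<cdot> ?ba" using c_ba by (metis gr.assoc)
  have cn: "gpow k c \<cdot> b = b \<cdot> gpow k c" for k using gpow_commute[OF cb] .
  \<comment> \<open>commutators are central, so passing from \<open>b a\<close> to \<open>a b\<close> in a power costs one factor \<open>c\<^sup>2\<close> each\<close>
  have pow_ab: "gpow n ?ab = gpow n ?ba \<cdot> gpow (2 * n) c"
  proof -
    have "gpow n ?ab = gpow n ?ba \<cdot> gpow n (c \<cdot> c)" unfolding ab by (rule gpow_commuting_mult[OF cc_ba])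
    moreover have "c \<cdot> c = gpow 2 c" by (simp add: numeral_2_eq_2)
    ultimately show ?thesis by (simp add: mult.commute[of 2 n] gpow_mult)
  qed
  have shift: "gpow k ?ba \<cdot> b = b \<cdot> gpow k ?ab" for k
    by (induction k) (simp_all add: gr.assoc)
  have last: "gpow (Suc n) b = gpow n b \<cdot> b" using gpow_commute[of b b n] by simp
  have "gpow (Suc n) a \<cdot> gpow (Suc n) b = a \<cdot> ((gpow n a \<cdot> gpow n b) \<cdot> b)"
    unfolding last by (simp add: gr.assoc)
  also have "\<dots> = a \<cdot> (gpow n ?ab \<cdot> (gpow (n * (n - 1)) c \<cdot> b))" unfolding Suc by (simp add: gr.assoc)
  also have "\<dots> = a \<cdot> (gpow n ?ab \<cdot> (b \<cdot> gpow (n * (n - 1)) c))" unfolding cn ..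
  also have "\<dots> = a \<cdot> (gpow n ?ba \<cdot> ((gpow (2 * n) c \<cdot> b) \<cdot> gpow (n * (n - 1)) c))"
    by (simp only: pow_ab gr.assoc)
  also have "\<dots> = a \<cdot> ((gpow n ?ba \<cdot> b) \<cdot> (gpow (2 * n) c \<cdot> gpow (n * (n - 1)) c))"
    unfolding cn by (simp add: gr.assoc)
  also have "\<dots> = gpow (Suc n) ?ab \<cdot> gpow (2 * n + n * (n - 1)) c"
    unfolding shift gpow_add by (simp add: gr.assoc)
  also have "2 * n + n * (n - 1) = Suc n * (Suc n - 1)" by (cases n) auto
  finally show ?case .
qed simp

end

context two_step_lie_chart
begin

text \<open>One has to put \<open>\<Phi> y = (e0 (y / n))\<^sup>n\<close>, which does not depend on \<open>n\<close> as soon as \<open>y / n\<close> is small. For the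
homomorphism property take \<open>n\<close> large. The powers of \<open>a = e0 (x / n)\<close> and \<open>b = e0 (y / n)\<close> are combined
with the collection formula, where \<open>c = e0 (z / 2 n\<^sup>2)\<close> with \<open>z = [x, y]\<close>; the exponent then is
\<open>(x + y) / n + z / 2 n\<^sup>2 + (n - 1) z / 2 n\<^sup>2 = (x \<odot> y) / n\<close>.\<close>

lemma global_extension:
  assumes s: "s > 0" and hom: "\<And>u v. u \<in> ball 0 s \<Longrightarrow> v \<in> ball 0 s \<Longrightarrow> e0 (u \<odot> v) = e0 u \<cdot> e0 v"
  obtains \<Phi> where "\<And>u v. \<Phi> (u \<odot> v) = \<Phi> u \<cdot> \<Phi> v" "\<And>u. u \<in> ball 0 s \<Longrightarrow> \<Phi> u = e0 u"
proof -
  have e00: "e0 0 = gone G"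
  proof -
    have "e0 0 \<cdot> e0 0 = e0 0 \<cdot> gone G" using hom[of 0 0] s by simp
    then show ?thesis by (metis gr_inverse(3))
  qed
  have L1: "e0 (real k *\<^sub>R v) = gpow k (e0 v)" if "norm (real k *\<^sub>R v) < s" for k v
    using that
  proof (induction k)
    case 0 then show ?case by (simp add: e00)
  next
    case (Suc k)
    have le: "norm (real k *\<^sub>R v) \<le> norm (real (Suc k) *\<^sub>R v)" by (simp add: mult_right_mono)
    have k: "norm (real k *\<^sub>R v) < s" using le Suc.prems by linarith
    have "1 * norm v \<le> real (Suc k) * norm v" by (intro mult_right_mono) auto
    then have v: "norm v < s" using Suc.prems by simp
    have eq: "v \<odot> real k *\<^sub>R v = real (Suc k) *\<^sub>R v" using bch_scaleR[of 1 v "real k"] by simp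
    have "e0 (v \<odot> real k *\<^sub>R v) = e0 v \<cdot> e0 (real k *\<^sub>R v)" using k v by (intro hom) auto
    then show ?case using Suc.IH[OF k] eq by simp
  qed
  have L2: "gpow n (e0 ((1 / real n) *\<^sub>R y)) = gpow k (e0 ((1 / real k) *\<^sub>R y))"
    if "n > 0" "k > 0" "norm y < real n * s" "norm y < real k * s" for n k y
  proof -
    have *: "gpow n (e0 ((1 / real n) *\<^sub>R y)) = gpow (n * k) (e0 ((1 / (real n * real k)) *\<^sub>R y))"
      if "n > 0" "k > 0" "norm y < real n * s" for n k
    proof -
      have eq: "real k *\<^sub>R ((1 / (real n * real k)) *\<^sub>R y) = (1 / real n) *\<^sub>R y" using that by simp
      have "norm ((1 / real n) *\<^sub>R y) < s" using that by (simp add: field_simps)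
      then have "e0 ((1 / real n) *\<^sub>R y) = gpow k (e0 ((1 / (real n * real k)) *\<^sub>R y))"
        using L1[of k "(1 / (real n * real k)) *\<^sub>R y", unfolded eq] by simp
      then show ?thesis by (simp add: gpow_mult)
    qed
    show ?thesis using *[of n k] *[of k n] that by (simp add: mult.commute)
  qed
  define N where "N y = Suc (nat \<lceil>norm y / s\<rceil>)" for y :: 'e
  have N: "N y > 0" "norm y < real (N y) * s" for y
  proof -
    have "norm y / s < real (N y)" unfolding N_def by linarith
    then show "norm y < real (N y) * s" using s by (simp add: field_simps)
  qed (simp add: N_def)
  define \<Phi> where "\<Phi> y = gpow (N y) (e0 ((1 / real (N y)) *\<^sub>R y))" for y
  have \<Phi>: "\<Phi> y = gpow n (e0 ((1 / real n) *\<^sub>R y))" if "n > 0" "norm y < real n * s" for n y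
    unfolding \<Phi>_def using N that by (intro L2)
  have mult: "\<Phi> (x \<odot> y) = \<Phi> x \<cdot> \<Phi> y" for x y
  proof -
    define z where "z = br x y"
    define n where "n = Suc (nat \<lceil>(norm x + norm y + norm z) / s\<rceil>)"
    have n0: "n > 0" by (simp add: n_def)
    have "(norm x + norm y + norm z) / s < real n" unfolding n_def by linarith
    then have ns: "norm x + norm y + norm z < real n * s" using s by (simp add: field_simps)
    define R where "R = (norm x + norm y + norm z) / real n"
    have R: "R < s" using ns n0 by (simp add: R_def field_simps)
    define \<nu> where "\<nu> = 1 / real n"
    have \<nu>: "0 < \<nu>" "\<nu> \<le> 1" using n0 by (auto simp: \<nu>_def)
    have small: "p *\<^sub>R x + q *\<^sub>R y + t *\<^sub>R z \<in> ball 0 s" if "\<bar>p\<bar> \<le> \<nu>" "\<bar>q\<bar> \<le> \<nu>" "\<bar>t\<bar> \<le> \<nu>" for p q t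
    proof -
      have "norm (p *\<^sub>R x + q *\<^sub>R y + t *\<^sub>R z) \<le> \<bar>p\<bar> * norm x + \<bar>q\<bar> * norm y + \<bar>t\<bar> * norm z"
        using norm_triangle_ineq[of "p *\<^sub>R x + q *\<^sub>R y" "t *\<^sub>R z"] norm_triangle_ineq[of "p *\<^sub>R x" "q *\<^sub>R y"] by simp
      also have "\<dots> \<le> \<nu> * norm x + \<nu> * norm y + \<nu> * norm z"
        using that by (intro add_mono mult_right_mono) auto
      also have "\<dots> = R" by (simp add: R_def \<nu>_def add_divide_distrib)
      finally show ?thesis using R by simp
    qed
    have zZ: "t *\<^sub>R z \<in> Z" for t using br_in_Z Z_subspace by (simp add: z_def subspace_scale)
    have \<nu>2: "\<nu>\<^sup>2 \<le> \<nu>" "0 \<le> \<nu>\<^sup>2" using \<nu> by (simp_all add: power2_eq_square mult_left_le_one_le)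
    define a b c where "a = e0 (\<nu> *\<^sub>R x)" and "b = e0 (\<nu> *\<^sub>R y)" and "c = e0 ((\<nu>\<^sup>2 / 2) *\<^sub>R z)"
    have bx: "\<nu> *\<^sub>R x \<in> ball 0 s" and "by": "\<nu> *\<^sub>R y \<in> ball 0 s"
      using small[of \<nu> 0 0] small[of 0 \<nu> 0] \<nu> by auto
    have bz: "t *\<^sub>R z \<in> ball 0 s" if "\<bar>t\<bar> \<le> \<nu>" for t using small[of 0 0 t] \<nu> that by auto
    have cc: "c \<cdot> c = e0 (\<nu>\<^sup>2 *\<^sub>R z)"
    proof -
      have b: "(\<nu>\<^sup>2 / 2) *\<^sub>R z \<in> ball 0 s" using \<nu>2 \<nu> by (intro bz) simp
      show ?thesis unfolding c_def using hom[OF b b] by (simp add: bch_scaleR)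
    qed
    have comm: "e0 (t *\<^sub>R z) \<cdot> e0 u = e0 u \<cdot> e0 (t *\<^sub>R z)" if "\<bar>t\<bar> \<le> \<nu>" "u \<in> ball 0 s" for t u
      using hom[OF bz[OF that(1)] that(2)] hom[OF that(2) bz[OF that(1)]] bch_Z(3,4)[OF zZ] by simp
    have ab: "a \<cdot> b = e0 (\<nu> *\<^sub>R x + \<nu> *\<^sub>R y + (\<nu>\<^sup>2 / 2) *\<^sub>R z)"
      unfolding a_def b_def hom[OF bx "by", symmetric]
      by (simp add: bch_def br_simps z_def power2_eq_square)
    have ba: "b \<cdot> a = e0 (\<nu> *\<^sub>R x + \<nu> *\<^sub>R y + (- \<nu>\<^sup>2 / 2) *\<^sub>R z)"
      unfolding a_def b_def hom[OF "by" bx, symmetric]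
      by (simp add: bch_def br_simps z_def power2_eq_square skew[of y x] add.commute)
    have 1: "a \<cdot> b = (b \<cdot> a) \<cdot> (c \<cdot> c)"
    proof -
      have "(b \<cdot> a) \<cdot> (c \<cdot> c) = e0 ((\<nu> *\<^sub>R x + \<nu> *\<^sub>R y + (- \<nu>\<^sup>2 / 2) *\<^sub>R z) \<odot> \<nu>\<^sup>2 *\<^sub>R z)"
        unfolding ba cc using \<nu> \<nu>2 by (intro hom[symmetric] small bz) auto
      also have "(\<nu> *\<^sub>R x + \<nu> *\<^sub>R y + (- \<nu>\<^sup>2 / 2) *\<^sub>R z) \<odot> \<nu>\<^sup>2 *\<^sub>R z = \<nu> *\<^sub>R x + \<nu> *\<^sub>R y + ((- \<nu>\<^sup>2 / 2) *\<^sub>R z + \<nu>\<^sup>2 *\<^sub>R z)"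
        by (simp add: bch_Z(3)[OF zZ] add.assoc)
      also have "(- \<nu>\<^sup>2 / 2) *\<^sub>R z + \<nu>\<^sup>2 *\<^sub>R z = (\<nu>\<^sup>2 / 2) *\<^sub>R z"
        by (simp only: scaleR_add_left[symmetric]) simp
      finally show ?thesis using ab by simp
    qed
    have \<nu>22: "\<bar>\<nu>\<^sup>2 / 2\<bar> \<le> \<nu>" using \<nu>2 \<nu> by simp
    have 2: "c \<cdot> a = a \<cdot> c" "c \<cdot> b = b \<cdot> c"
      unfolding a_def b_def c_def using comm[OF \<nu>22] bx "by" by auto
    have "\<Phi> x \<cdot> \<Phi> y = gpow n a \<cdot> gpow n b"
    proof -
      have "norm x < real n * s" "norm y < real n * s"
        using ns norm_ge_zero[of x] norm_ge_zero[of y] norm_ge_zero[of z] by linarith+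
      then show ?thesis by (simp add: \<Phi>[OF n0] a_def b_def \<nu>_def)
    qed
    also have "\<dots> = gpow n (a \<cdot> b) \<cdot> gpow n (gpow (n - 1) c)"
      using collection_formula[OF 1 2] by (simp add: gpow_mult)
    also have "\<dots> = gpow n ((a \<cdot> b) \<cdot> gpow (n - 1) c)"
    proof -
      have "c \<cdot> (a \<cdot> b) = (a \<cdot> b) \<cdot> c" using 2 by (metis gr.assoc)
      from gpow_commute[OF this] show ?thesis by (metis gpow_commuting_mult)
    qed
    also have "gpow (n - 1) c = e0 ((real (n - 1) * (\<nu>\<^sup>2 / 2)) *\<^sub>R z)"
    proof -
      have "\<bar>real (n - 1) * (\<nu>\<^sup>2 / 2)\<bar> \<le> \<nu>"
        using n0 by (simp add: \<nu>_def power2_eq_square field_simps)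
      from bz[OF this] show ?thesis using L1[of "n - 1" "(\<nu>\<^sup>2 / 2) *\<^sub>R z"] by (simp add: c_def)
    qed
    also have "(a \<cdot> b) \<cdot> e0 ((real (n - 1) * (\<nu>\<^sup>2 / 2)) *\<^sub>R z) = e0 (\<nu> *\<^sub>R (x \<odot> y))"
    proof -
      have "\<bar>real (n - 1) * (\<nu>\<^sup>2 / 2)\<bar> \<le> \<nu>"
        using n0 by (simp add: \<nu>_def power2_eq_square field_simps)
      then have "(a \<cdot> b) \<cdot> e0 ((real (n - 1) * (\<nu>\<^sup>2 / 2)) *\<^sub>R z) =
        e0 ((\<nu> *\<^sub>R x + \<nu> *\<^sub>R y + (\<nu>\<^sup>2 / 2) *\<^sub>R z) \<odot> (real (n - 1) * (\<nu>\<^sup>2 / 2)) *\<^sub>R z)"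
        unfolding ab using \<nu> \<nu>22 by (intro hom[symmetric] small bz) auto
      also have "(\<nu> *\<^sub>R x + \<nu> *\<^sub>R y + (\<nu>\<^sup>2 / 2) *\<^sub>R z) \<odot> (real (n - 1) * (\<nu>\<^sup>2 / 2)) *\<^sub>R z
         = \<nu> *\<^sub>R x + \<nu> *\<^sub>R y + ((\<nu>\<^sup>2 / 2) + (real (n - 1) * (\<nu>\<^sup>2 / 2))) *\<^sub>R z"
        by (simp add: bch_Z(3)[OF zZ] add.assoc scaleR_add_left)
      also have "(\<nu>\<^sup>2 / 2) + (real (n - 1) * (\<nu>\<^sup>2 / 2)) = \<nu> / 2"
        using n0 by (simp add: \<nu>_def power2_eq_square field_simps)
      also have "\<nu> *\<^sub>R x + \<nu> *\<^sub>R y + (\<nu> / 2) *\<^sub>R z = \<nu> *\<^sub>R (x \<odot> y)"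
        by (simp add: bch_def z_def scaleR_add_right)
      finally show ?thesis .
    qed
    also have "gpow n (e0 (\<nu> *\<^sub>R (x \<odot> y))) = \<Phi> (x \<odot> y)"
    proof -
      have "norm (x \<odot> y) \<le> norm x + norm y + norm z / 2"
        unfolding bch_def z_def
        using norm_triangle_ineq[of "x + y" "(1/2) *\<^sub>R br x y"] norm_triangle_ineq[of x y] by simp
      then have "norm (x \<odot> y) < real n * s" using ns norm_ge_zero[of z] by linarith
      then show ?thesis by (simp add: \<Phi>[OF n0] \<nu>_def)
    qed
    finally show ?thesis by simp
  qed
  have "\<Phi> u = e0 u" if "u \<in> ball 0 s" for u
    using \<Phi>[of 1 u] that by simp
  then show ?thesis using that mult by blast
qed

end

text \<open>The exponential map \<open>\<Phi>\<close> of the group together with a chart of it near \<open>0\<close>: there \<open>\<psi>\<close> is \<open>\<Phi>\<close> read in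
the chart \<open>c\<^sub>0\<close>, and \<open>F\<close> is the logarithm.\<close>

locale lie_exponential = two_step_lie_chart G c\<^sub>0
  for G :: "('g::{t2_space, second_countable_topology}, 'e::euclidean_space) lie_struct"
    and c\<^sub>0 :: "('g, 'e) chart" +
  fixes \<Phi> :: "'e \<Rightarrow> 'g" and F \<psi> :: "'e \<Rightarrow> 'e" and \<U> \<V> :: "'e set" and s :: real
  assumes \<U>: "open \<U>" "snd c\<^sub>0 (gone G) \<in> \<U>" "\<U> \<subseteq> idom"
    and \<V>: "open \<V>" "0 \<in> \<V>"
    and hom: "homeomorphism \<U> \<V> F \<psi>" and F_x0: "F (snd c\<^sub>0 (gone G)) = 0"
    and F_der: "\<And>x. x \<in> \<U> \<Longrightarrow> (F has_derivative Fdiff F x) (at x)"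
    and Fdiff_cont: "\<And>v. continuous_on \<U> (\<lambda>x. Fdiff F x v)"
    and \<psi>_der: "\<And>y. y \<in> \<V> \<Longrightarrow> (\<psi> has_derivative (\<lambda>w. X (w - (1/2) *\<^sub>R lie_bracket G c\<^sub>0 y w) (\<psi> y))) (at y)"
    and \<psi>'_cont: "\<And>w. continuous_on \<V> (\<lambda>y. X (w - (1/2) *\<^sub>R lie_bracket G c\<^sub>0 y w) (\<psi> y))"
    and s: "s > 0" "ball 0 s \<subseteq> \<V>"
    and \<Phi>_mult: "\<And>u v. \<Phi> (bch u v) = gmul G (\<Phi> u) (\<Phi> v)"
    and \<Phi>_local: "\<And>u. u \<in> ball 0 s \<Longrightarrow> \<Phi> u = chart_inv c\<^sub>0 (\<psi> u)"
    and \<Phi>_surj: "surj \<Phi>"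

text \<open>The image of \<open>\<Phi>\<close> is a subgroup that contains a neighbourhood of the identity. It is therefore open
and closed, hence everything.\<close>

lemma (in two_step_lie_chart) exponential_exists:
  assumes conn: "connected (UNIV :: 'g set)"
  shows "\<exists>\<Phi> F \<psi> U V s. lie_exponential G c\<^sub>0 \<Phi> F \<psi> U V s"
proof -
  obtain F \<psi> U V s where
    U: "open U" "x\<^sub>0 \<in> U" "U \<subseteq> idom" and V: "open V" "0 \<in> V" and h: "homeomorphism U V F \<psi>" and F0: "F x\<^sub>0 = 0"
    and Fd: "\<And>x. x \<in> U \<Longrightarrow> (F has_derivative Fdiff F x) (at x)" "\<And>v. continuous_on U (\<lambda>x. Fdiff F x v)"
    and \<psi>d: "\<And>y. y \<in> V \<Longrightarrow> (\<psi> has_derivative (\<lambda>w. X (w - (1/2) *\<^sub>R br y w) (\<psi> y))) (at y)"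
    "\<And>w. continuous_on V (\<lambda>y. X (w - (1/2) *\<^sub>R br y w) (\<psi> y))"
    and s: "s > 0" "ball 0 s \<subseteq> V"
    and mult: "\<And>u v. u \<in> ball 0 s \<Longrightarrow> v \<in> ball 0 s \<Longrightarrow> u \<odot> v \<in> V \<and> \<kappa> (\<psi> (u \<odot> v)) = \<kappa> (\<psi> u) \<cdot> \<kappa> (\<psi> v)"
    by (rule local_exponential, rule that)
  have m': "\<kappa> (\<psi> (u \<odot> v)) = \<kappa> (\<psi> u) \<cdot> \<kappa> (\<psi> v)" if "u \<in> ball 0 s" "v \<in> ball 0 s" for u v
    using mult[OF that] by blast
  obtain \<Phi> where \<Phi>: "\<And>u v. \<Phi> (u \<odot> v) = \<Phi> u \<cdot> \<Phi> v" "\<And>u. u \<in> ball 0 s \<Longrightarrow> \<Phi> u = \<kappa> (\<psi> u)"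
    by (rule global_extension[OF s(1), of "\<lambda>u. \<kappa> (\<psi> u)"], rule m', assumption+, rule that)
  have \<Phi>0: "\<Phi> 0 = gone G"
  proof -
    have "\<Phi> 0 \<cdot> \<Phi> 0 = \<Phi> 0 \<cdot> gone G" using \<Phi>(1)[of 0 0] by simp
    then show ?thesis by (metis gr_inverse(3))
  qed
  define N where "N = \<Phi> ` ball 0 s"
  have oneN: "gone G \<in> N" unfolding N_def using \<Phi>0 s by (intro image_eqI[of _ _ 0]) auto
  have "open N"
  proof -
    have "\<psi> ` ball 0 s = U \<inter> F -` ball 0 s"
      using h s(2) by (force simp: homeomorphism_def)
    moreover have "open (U \<inter> F -` ball 0 s)"
      using h U(1) by (intro continuous_open_preimage) (auto simp: homeomorphism_def)
    ultimately have o: "open (\<psi> ` ball 0 s)" by simp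
    have sub: "\<psi> ` ball 0 s \<subseteq> Om" using h s(2) U(3) idomD(1) by (force simp: homeomorphism_def)
    have "N = \<kappa> ` (\<psi> ` ball 0 s)" unfolding N_def using \<Phi>(2) by (auto simp: image_def)
    also have "\<dots> = fst c\<^sub>0 \<inter> \<phi> -` (\<psi> ` ball 0 s)"
    proof (intro equalityI subsetI)
      fix p assume "p \<in> \<kappa> ` (\<psi> ` ball 0 s)"
      then obtain x where x: "x \<in> \<psi> ` ball 0 s" "p = \<kappa> x" by blast
      then have "x \<in> Om" using sub by blast
      then show "p \<in> fst c\<^sub>0 \<inter> \<phi> -` (\<psi> ` ball 0 s)" using x c0_facts(4,5)[of x] by (metis IntI vimageI)
    next
      fix p assume p: "p \<in> fst c\<^sub>0 \<inter> \<phi> -` (\<psi> ` ball 0 s)"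
      then have "p = \<kappa> (\<phi> p)" using c0_facts(3) by simp
      then show "p \<in> \<kappa> ` (\<psi> ` ball 0 s)" using p by blast
    qed
    finally show ?thesis using o c0_facts(1,6) by (simp add: continuous_open_preimage)
  qed
  have translate: "open {q. p \<cdot> q \<in> N}" for p
  proof -
    have "continuous_on UNIV (\<lambda>q. p \<cdot> q)"
      using continuous_on_compose2[OF mult_continuous, of UNIV "\<lambda>q. (p, q)"]
        continuous_on_Pair[OF continuous_on_const continuous_on_id, of UNIV p] by simp
    then have "open ((\<lambda>q. p \<cdot> q) -` N)" using \<open>open N\<close> open_vimage by blast
    then show ?thesis by (simp add: vimage_def)
  qed
  have "open (range \<Phi>)"
  proof (rule topological_space_class.openI)
    fix p assume "p \<in> range \<Phi>"
    then obtain x where x: "p = \<Phi> x" by blast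
    have "{q. ginv G p \<cdot> q \<in> N} \<subseteq> range \<Phi>"
    proof clarify
      fix q assume "ginv G p \<cdot> q \<in> N"
      then obtain u where "ginv G p \<cdot> q = \<Phi> u" unfolding N_def by blast
      then have "q = \<Phi> (x \<odot> u)" using x by (metis \<Phi>(1) gr_inverse(4))
      then show "q \<in> range \<Phi>" by blast
    qed
    moreover have "p \<in> {q. ginv G p \<cdot> q \<in> N}" using oneN by simp
    ultimately show "\<exists>T. open T \<and> p \<in> T \<and> T \<subseteq> range \<Phi>" using translate by blast
  qed
  moreover have "open (- range \<Phi>)"
  proof (rule topological_space_class.openI)
    fix p assume p: "p \<in> - range \<Phi>"
    have "{q. ginv G p \<cdot> q \<in> N} \<subseteq> - range \<Phi>"
    proof clarify
      fix q x assume "ginv G p \<cdot> \<Phi> x \<in> N"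
      then obtain u where u: "ginv G p \<cdot> \<Phi> x = \<Phi> u" unfolding N_def by blast
      have "\<Phi> (x \<odot> - u) = p"
      proof -
        have "p \<cdot> \<Phi> u = \<Phi> x" using u by (metis gr_inverse(4))
        then have "\<Phi> (x \<odot> - u) = p \<cdot> \<Phi> (u \<odot> - u)" by (simp only: \<Phi>(1) gr.assoc[symmetric])
        then show ?thesis using \<Phi>0 by simp
      qed
      then show False using p by blast
    qed
    moreover have "p \<in> {q. ginv G p \<cdot> q \<in> N}" using oneN by simp
    ultimately show "\<exists>T. open T \<and> p \<in> T \<and> T \<subseteq> - range \<Phi>" using translate by blast
  qed
  ultimately have surj: "surj \<Phi>"
    using conn unfolding connected_def by auto
  show ?thesis
    by (intro exI, unfold_locales) (fact U V h F0 Fd \<psi>d s \<Phi> surj)+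
qed

section \<open>Velocities of curves in exponential coordinates\<close>

context lie_chart
begin

text \<open>The left translation by \<open>p\<close> in the charts \<open>b\<close> and \<open>c\<close>.\<close>

definition translation :: "('g, 'e) chart \<Rightarrow> ('g, 'e) chart \<Rightarrow> 'g \<Rightarrow> 'e \<Rightarrow> 'e" where
  "translation b c p y = snd c (p \<cdot> chart_inv b y)"

definition translation_dom :: "('g, 'e) chart \<Rightarrow> ('g, 'e) chart \<Rightarrow> 'g \<Rightarrow> 'e set" where
  "translation_dom b c p = {y \<in> snd b ` fst b. p \<cdot> chart_inv b y \<in> fst c}"

lemma translation_C1:
  assumes "b \<in> atlas G" "c \<in> atlas G"
  shows "\<exists>D. open (translation_dom b c p) \<and> (\<forall>y\<in>translation_dom b c p. (translation b c p has_derivative D y) (at y)) \<and>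
    (\<forall>v. continuous_on (translation_dom b c p) (\<lambda>y. D y v))"
proof -
  obtain a where a: "a \<in> atlas G" "p \<in> fst a" using charts_cover .
  define M where "M = {(x, y). x \<in> snd a ` fst a \<and> y \<in> snd b ` fst b \<and> chart_inv a x \<cdot> chart_inv b y \<in> fst c}"
  define f where "f = (\<lambda>(x, y). snd c (chart_inv a x \<cdot> chart_inv b y))"
  have sm: "smooth_on M f" unfolding M_def f_def by (rule mult_smooth[OF a(1) assms])
  define x where "x = snd a p"
  have x: "chart_inv a x = p" "x \<in> snd a ` fst a" using chart_facts(3)[OF a] a(2) by (auto simp: x_def)
  have dom: "translation_dom b c p = {y. (x, y) \<in> M}" using x by (auto simp: translation_dom_def M_def)
  have Tf: "translation b c p = (\<lambda>y. f (x, y))" using x by (simp add: translation_def f_def fun_eq_iff)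
  let ?D = "\<lambda>y v. frechet_derivative f (at (x, y)) (0, v)"
  have "open (translation_dom b c p)" unfolding dom by (rule open_pair_slice[OF smooth_onD(1)[OF sm]])
  moreover have "(translation b c p has_derivative ?D y) (at y)" if "y \<in> translation_dom b c p" for y
    unfolding Tf using smooth_on_partial[OF sm, of x y] that dom by simp
  moreover have "continuous_on (translation_dom b c p) (\<lambda>y. ?D y v)" for v
    by (rule smooth_on_derivative_continuous[OF sm]) (auto simp: dom intro!: continuous_intros)
  ultimately show ?thesis by (intro exI[of _ ?D]) simp
qed

lemma translation_lipschitz:
  assumes "b \<in> atlas G" "c \<in> atlas G" "y \<in> translation_dom b c p"
  obtains r L where "r > 0" "ball y r \<subseteq> translation_dom b c p" "L-lipschitz_on (ball y r) (translation b c p)"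
proof -
  obtain D where D: "open (translation_dom b c p)" "\<And>y. y \<in> translation_dom b c p \<Longrightarrow> (translation b c p has_derivative D y) (at y)"
    "\<And>v. continuous_on (translation_dom b c p) (\<lambda>y. D y v)"
    using translation_C1[OF assms(1,2)] by metis
  show ?thesis by (rule C1_locally_lipschitz[OF D(1) assms(3) D(2,3)]) (auto intro: that)
qed

lemma x0_translation_dom: "p \<in> fst c \<Longrightarrow> x\<^sub>0 \<in> translation_dom c\<^sub>0 c p"
  using x0_in by (simp add: translation_dom_def)

lemma left_diff_derivative:
  assumes "c \<in> atlas G" "p \<in> fst c"
  shows "(translation c\<^sub>0 c p has_derivative left_diff G c\<^sub>0 c p) (at x\<^sub>0)"
proof -
  obtain D where "\<forall>y\<in>translation_dom c\<^sub>0 c p. (translation c\<^sub>0 c p has_derivative D y) (at y)"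
    using translation_C1[OF c0 assms(1), of p] by blast
  then have D: "(translation c\<^sub>0 c p has_derivative D x\<^sub>0) (at x\<^sub>0)" using x0_translation_dom[OF assms(2)] by blast
  then show ?thesis
    using frechet_derivative_at[OF D] by (simp add: left_diff_def translation_def[abs_def])
qed

lemma left_diff_left_inverse:
  assumes c: "c \<in> atlas G" and p: "p \<in> fst c"
  obtains D where "(translation c c\<^sub>0 (ginv G p) has_derivative D) (at (snd c p))" "\<And>v. D (left_diff G c\<^sub>0 c p v) = v"
    "snd c p \<in> translation_dom c c\<^sub>0 (ginv G p)"
proof -
  have dom: "snd c p \<in> translation_dom c c\<^sub>0 (ginv G p)"
    using p one_in chart_facts(3)[OF c p] by (simp add: translation_dom_def)
  obtain D' where "\<forall>y\<in>translation_dom c c\<^sub>0 (ginv G p). (translation c c\<^sub>0 (ginv G p) has_derivative D' y) (at y)"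
    using translation_C1[OF c c0, of "ginv G p"] by blast
  then obtain D where D: "(translation c c\<^sub>0 (ginv G p) has_derivative D) (at (snd c p))" using dom by blast
  have T0: "translation c\<^sub>0 c p x\<^sub>0 = snd c p" by (simp add: translation_def)
  have "((\<lambda>x. translation c c\<^sub>0 (ginv G p) (translation c\<^sub>0 c p x)) has_derivative (\<lambda>v. D (left_diff G c\<^sub>0 c p v))) (at x\<^sub>0)"
    using has_derivative_compose[OF left_diff_derivative[OF c p]] D T0 by metis
  moreover have "open (translation_dom c\<^sub>0 c p)" using translation_C1[OF c0 c] by blast
  moreover have "translation c c\<^sub>0 (ginv G p) (translation c\<^sub>0 c p x) = x" if "x \<in> translation_dom c\<^sub>0 c p" for x
    using that chart_facts(3)[OF c] c0_facts(5) by (simp add: translation_def translation_dom_def)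
  ultimately have "((\<lambda>x. x) has_derivative (\<lambda>v. D (left_diff G c\<^sub>0 c p v))) (at x\<^sub>0)"
    using x0_translation_dom[OF p] by (meson has_derivative_transform_within_open)
  from has_derivative_unique[OF this has_derivative_ident] have "D (left_diff G c\<^sub>0 c p v) = v" for v
    by (simp add: fun_eq_iff)
  then show ?thesis using that D dom by blast
qed

text \<open>The velocity of a curve, as an element of the Lie algebra, is well defined because the differential of
a left translation is injective.\<close>

lemma velocity_unique:
  assumes "has_velocity G c\<^sub>0 \<gamma> t v" "has_velocity G c\<^sub>0 \<gamma> t v'" "t \<in> {0..1}"
  shows "v = v'"
proof -
  obtain c where c: "c \<in> atlas G" "\<gamma> t \<in> fst c" using charts_cover .
  obtain D where D: "\<And>v. D (left_diff G c\<^sub>0 c (\<gamma> t) v) = v" by (rule left_diff_left_inverse[OF c], rule that)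
  have "left_diff G c\<^sub>0 c (\<gamma> t) v = left_diff G c\<^sub>0 c (\<gamma> t) v'"
    using vector_derivative_unique_within_closed_interval[of 0 1 t "snd c \<circ> \<gamma>"] assms c
    unfolding has_velocity_def by simp
  then show ?thesis using D by metis
qed

end

context lie_exponential
begin

lemma \<Phi>_zero [simp]: "\<Phi> 0 = gone G"
proof -
  have "\<Phi> 0 \<cdot> \<Phi> 0 = \<Phi> 0 \<cdot> gone G" using \<Phi>_mult[of 0 0] by simp
  then show ?thesis by (metis gr_inverse(3))
qed

lemma \<Phi>_minus: "\<Phi> (- x) = ginv G (\<Phi> x)"
proof -
  have "\<Phi> x \<cdot> \<Phi> (- x) = gone G" by (simp flip: \<Phi>_mult)
  then show ?thesis by (metis gr_inverse(3) gr_neutral(2))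
qed

lemma \<psi>_facts: assumes "u \<in> ball 0 s"
  shows "\<psi> u \<in> \<U>" "F (\<psi> u) = u" "\<psi> u \<in> Om" "\<phi> (\<Phi> u) = \<psi> u" "\<Phi> u \<in> fst c\<^sub>0"
proof -
  have "u \<in> \<V>" using assms s(2) by blast
  then show 1: "\<psi> u \<in> \<U>" "F (\<psi> u) = u" using hom by (auto simp: homeomorphism_def)
  then show 2: "\<psi> u \<in> Om" using \<U>(3) idomD(1) by blast
  show "\<phi> (\<Phi> u) = \<psi> u" "\<Phi> u \<in> fst c\<^sub>0" unfolding \<Phi>_local[OF assms] using c0_facts(4,5)[OF 2] by auto
qed

lemma \<psi>_zero: "\<psi> 0 = x\<^sub>0"
  using \<psi>_facts(4)[of 0] s by simp

lemma \<psi>_der_zero: "(\<psi> has_derivative (\<lambda>w. w)) (at 0)"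
  using \<psi>_der[OF \<V>(2)] by (simp add: \<psi>_zero X_def A_x0_x0 br_simps)

lemma bch_left_derivative: "((\<lambda>y. a \<odot> y) has_derivative (\<lambda>w. w + (1/2) *\<^sub>R br a w)) (at y)"
  unfolding bch_def
  by (rule has_derivative_eq_rhs, (rule derivative_intros bounded_linear.has_derivative[OF br.bounded_linear_right])+) (simp add: fun_eq_iff)

lemma bch_left_vector_derivative:
  assumes "(k has_vector_derivative v) (at t within S)"
  shows "((\<lambda>\<tau>. a \<odot> k \<tau>) has_vector_derivative (v + (1/2) *\<^sub>R br a v)) (at t within S)"
proof -
  have "((\<lambda>\<tau>. a \<odot> k \<tau>) has_derivative (\<lambda>x. x *\<^sub>R v + (1/2) *\<^sub>R br a (x *\<^sub>R v))) (at t within S)"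
    using has_derivative_compose[OF assms[unfolded has_vector_derivative_def] bch_left_derivative] .
  then show ?thesis unfolding has_vector_derivative_def
    by (rule has_derivative_eq_rhs) (simp add: fun_eq_iff br_simps algebra_simps)
qed

lemma bch_continuous: "continuous_on S (\<lambda>y. a \<odot> y)"
  by (rule has_derivative_continuous_on, rule has_derivative_at_withinI, rule bch_left_derivative)

text \<open>In exponential coordinates around the point \<open>y t\<close>, the curve is \<open>k \<tau> = - y t \<odot> y \<tau>\<close>, which passes
through \<open>0\<close> with velocity \<open>u\<close>, and \<open>\<Phi>\<close> has the identity as its derivative at \<open>0\<close>.\<close>

lemma exp_velocity:
  assumes y: "(y has_vector_derivative (u + (1/2) *\<^sub>R br (y t) u)) (at t within {0..1})" and t: "t \<in> {0..1}"
  shows "has_velocity G c\<^sub>0 (\<lambda>\<tau>. p \<cdot> \<Phi> (y \<tau>)) t u"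
  unfolding has_velocity_def
proof (intro ballI impI)
  fix c assume c: "c \<in> atlas G" and q_in: "p \<cdot> \<Phi> (y t) \<in> fst c"
  define q where "q = p \<cdot> \<Phi> (y t)"
  define k where "k \<tau> = - y t \<odot> y \<tau>" for \<tau>
  have kd: "(k has_vector_derivative u) (at t within {0..1})"
    using bch_left_vector_derivative[OF y, of "- y t"] unfolding k_def by (simp add: br_simps)
  have k0: "k t = 0" by (simp add: k_def)
  have "(\<psi> \<circ> k has_vector_derivative u) (at t within {0..1})"
    using has_derivative_compose[OF kd[unfolded has_vector_derivative_def], of \<psi> "\<lambda>w. w"] \<psi>_der_zero k0
    by (simp add: has_vector_derivative_def o_def)
  then have "((\<lambda>\<tau>. translation c\<^sub>0 c q ((\<psi> \<circ> k) \<tau>)) has_derivative (\<lambda>x. left_diff G c\<^sub>0 c q (x *\<^sub>R u))) (at t within {0..1})"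
    using has_derivative_compose[of "\<psi> \<circ> k" "\<lambda>x. x *\<^sub>R u" t "{0..1}" "translation c\<^sub>0 c q" "left_diff G c\<^sub>0 c q"]
      left_diff_derivative[OF c q_in] k0 \<psi>_zero by (simp add: has_vector_derivative_def q_def)
  moreover have "(\<lambda>x. left_diff G c\<^sub>0 c q (x *\<^sub>R u)) = (\<lambda>x. x *\<^sub>R left_diff G c\<^sub>0 c q u)"
    using has_derivative_linear[OF left_diff_derivative[OF c q_in]] by (simp add: linear_cmul q_def fun_eq_iff)
  ultimately have d: "((\<lambda>\<tau>. translation c\<^sub>0 c q (\<psi> (k \<tau>))) has_vector_derivative left_diff G c\<^sub>0 c q u) (at t within {0..1})"
    by (simp add: has_vector_derivative_def)
  have "continuous (at t within {0..1}) k" using kd by (rule has_vector_derivative_continuous)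
  then obtain e where e: "e > 0" "\<And>\<tau>. \<tau> \<in> {0..1} \<Longrightarrow> dist \<tau> t < e \<Longrightarrow> dist (k \<tau>) (k t) < s"
    using s(1) unfolding continuous_within_eps_delta by blast
  have eq: "translation c\<^sub>0 c q (\<psi> (k \<tau>)) = (snd c \<circ> (\<lambda>\<tau>. p \<cdot> \<Phi> (y \<tau>))) \<tau>" if "\<tau> \<in> {0..1}" "dist \<tau> t < e" for \<tau>
  proof -
    have "k \<tau> \<in> ball 0 s" using e(2)[OF that] k0 by simp
    then have "\<kappa> (\<psi> (k \<tau>)) = \<Phi> (k \<tau>)" using \<Phi>_local by simp
    moreover have "\<Phi> (y t) \<cdot> \<Phi> (k \<tau>) = \<Phi> (y \<tau>)" by (simp add: k_def flip: \<Phi>_mult)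
    ultimately show ?thesis by (simp add: translation_def q_def gr.assoc)
  qed
  show "(snd c \<circ> (\<lambda>\<tau>. p \<cdot> \<Phi> (y \<tau>)) has_vector_derivative left_diff G c\<^sub>0 c (p \<cdot> \<Phi> (y t)) u) (at t within {0..1})"
    using has_vector_derivative_transform_within[OF d e(1) t eq] by (simp add: q_def o_def)
qed

lemma exp_local_chart:
  "p \<cdot> \<Phi> (y0 \<odot> u) = (p \<cdot> \<Phi> y0) \<cdot> \<kappa> (\<psi> u)" if "u \<in> ball 0 s"
  using \<Phi>_local[OF that] by (simp add: \<Phi>_mult gr.assoc)

lemma \<psi>_lipschitz: obtains r L where "r > 0" "r \<le> s" "L-lipschitz_on (ball 0 r) \<psi>"
proof -
  obtain r L where rL: "r > 0" "ball 0 r \<subseteq> \<V>" "L-lipschitz_on (ball 0 r) \<psi>"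
    by (rule C1_locally_lipschitz[OF \<V> \<psi>_der \<psi>'_cont], assumption, rule that)
  have "L-lipschitz_on (ball 0 (min r s)) \<psi>" by (rule lipschitz_on_subset[OF rL(3)]) auto
  then show ?thesis using that[of "min r s" L] rL(1) s(1) by simp
qed

lemma bch_lipschitz: "\<exists>L. L-lipschitz_on S (\<lambda>y. a \<odot> y)"
proof -
  obtain K where K: "K > 0" "\<And>a b. norm (br a b) \<le> norm a * norm b * K" using br.pos_bounded by blast
  have "dist (a \<odot> x) (a \<odot> y) \<le> (1 + norm a * K) * dist x y" for x y
  proof -
    have "a \<odot> x - a \<odot> y = (x - y) + (1/2) *\<^sub>R br a (x - y)"
      by (simp add: bch_def br.diff_right algebra_simps)
    then have "norm (a \<odot> x - a \<odot> y) \<le> norm (x - y) + (1/2) * norm (br a (x - y))"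
      using norm_triangle_ineq[of "x - y" "(1/2) *\<^sub>R br a (x - y)"] by simp
    also have "\<dots> \<le> norm (x - y) + norm a * norm (x - y) * K"
      using K(2)[of a "x - y"] norm_ge_zero[of "br a (x - y)"] by linarith
    finally show ?thesis by (simp add: dist_norm algebra_simps)
  qed
  then show ?thesis using K by (intro exI[of _ "1 + norm a * K"]) (auto intro!: lipschitz_onI)
qed

lemma exp_chart_lipschitz:
  assumes c: "c \<in> atlas G" and q: "p \<cdot> \<Phi> y0 \<in> fst c"
  shows "\<exists>r>0. \<exists>L. L-lipschitz_on (ball y0 r) (\<lambda>y. snd c (p \<cdot> \<Phi> y))"
proof -
  let ?q = "p \<cdot> \<Phi> y0"
  obtain r1 L1 where 1: "r1 > 0" "ball x\<^sub>0 r1 \<subseteq> translation_dom c\<^sub>0 c ?q" "L1-lipschitz_on (ball x\<^sub>0 r1) (translation c\<^sub>0 c ?q)"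
    by (rule translation_lipschitz[OF c0 c x0_translation_dom[OF q]], rule that)
  obtain r2 L2 where 2: "r2 > 0" "r2 \<le> s" "L2-lipschitz_on (ball 0 r2) \<psi>"
    by (rule \<psi>_lipschitz, rule that)
  have "continuous_on (ball 0 r2) \<psi>" using 2(3) by (rule lipschitz_on_continuous_on)
  then have "isCont \<psi> 0" using 2(1) by (simp add: continuous_on_eq_continuous_at)
  then obtain r3 where 3: "r3 > 0" "\<And>u. dist u 0 < r3 \<Longrightarrow> dist (\<psi> u) (\<psi> 0) < r1"
    using 1(1) unfolding continuous_at_eps_delta by blast
  define r4 where "r4 = min r2 r3"
  have "isCont (\<lambda>y. - y0 \<odot> y) y0" using bch_continuous[of UNIV] by (simp add: continuous_on_eq_continuous_at)
  then obtain r where r: "r > 0" "\<And>y. dist y y0 < r \<Longrightarrow> dist (- y0 \<odot> y) (- y0 \<odot> y0) < r4"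
    using 2(1) 3(1) unfolding continuous_at_eps_delta r4_def by (meson min_less_iff_conj)
  obtain L3 where L3: "L3-lipschitz_on (ball y0 r) (\<lambda>y. - y0 \<odot> y)" using bch_lipschitz by blast
  have im1: "(\<lambda>y. - y0 \<odot> y) ` ball y0 r \<subseteq> ball 0 r4" using r(2) by (auto simp: dist_commute)
  have im2: "\<psi> ` ball 0 r4 \<subseteq> ball x\<^sub>0 r1" using 3(2) by (auto simp: dist_commute r4_def \<psi>_zero)
  have "L2-lipschitz_on ((\<lambda>y. - y0 \<odot> y) ` ball y0 r) \<psi>"
    using im1 by (intro lipschitz_on_subset[OF 2(3)]) (auto simp: r4_def)
  from lipschitz_on_compose2[OF L3 this]
  have a: "(L2 * L3)-lipschitz_on (ball y0 r) (\<lambda>y. \<psi> (- y0 \<odot> y))" .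
  have "L1-lipschitz_on ((\<lambda>y. \<psi> (- y0 \<odot> y)) ` ball y0 r) (translation c\<^sub>0 c ?q)"
    using im1 im2 by (intro lipschitz_on_subset[OF 1(3)]) blast
  from lipschitz_on_compose2[OF a this]
  have "(L1 * (L2 * L3))-lipschitz_on (ball y0 r) (\<lambda>y. translation c\<^sub>0 c ?q (\<psi> (- y0 \<odot> y)))" .
  moreover have "translation c\<^sub>0 c ?q (\<psi> (- y0 \<odot> y)) = snd c (p \<cdot> \<Phi> y)" if "y \<in> ball y0 r" for y
  proof -
    have "- y0 \<odot> y \<in> ball 0 s" using im1 that 2(2) by (force simp: r4_def)
    from exp_local_chart[OF this, of p y0] show ?thesis by (simp add: translation_def)
  qed
  ultimately have "(L1 * (L2 * L3))-lipschitz_on (ball y0 r) (\<lambda>y. snd c (p \<cdot> \<Phi> y))"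
    by (simp add: lipschitz_on_def)
  then show ?thesis using r(1) by blast
qed

lemma \<Phi>_continuous: "continuous_on UNIV \<Phi>"
proof -
  have "isCont \<Phi> y0" for y0
  proof -
    have "isCont \<psi> (- y0 \<odot> y0)" using has_derivative_continuous[OF \<psi>_der_zero] by simp
    moreover have "isCont (\<lambda>y. - y0 \<odot> y) y0" using bch_continuous[of UNIV] by (simp add: continuous_on_eq_continuous_at)
    ultimately have "isCont (\<lambda>y. \<psi> (- y0 \<odot> y)) y0" by (rule isCont_o2[rotated])
    moreover have "isCont \<kappa> (\<psi> (- y0 \<odot> y0))"
      using bspec[OF continuous_on_eq_continuous_at[THEN iffD1, OF c0_facts(2) c0_facts(7)] x0_in]
      by (simp add: \<psi>_zero)
    ultimately have "isCont (\<lambda>y. \<kappa> (\<psi> (- y0 \<odot> y))) y0" by (rule isCont_o2)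
    moreover have "isCont (\<lambda>q. \<Phi> y0 \<cdot> q) q" for q
      using continuous_on_compose2[OF mult_continuous, of UNIV "\<lambda>q. (\<Phi> y0, q)"]
        continuous_on_Pair[OF continuous_on_const continuous_on_id, of UNIV "\<Phi> y0"]
      by (simp add: continuous_on_eq_continuous_at)
    ultimately have c: "isCont (\<lambda>y. \<Phi> y0 \<cdot> \<kappa> (\<psi> (- y0 \<odot> y))) y0" by (rule isCont_o2)
    have "open ((\<lambda>y. - y0 \<odot> y) -` ball 0 s)" using bch_continuous by (intro open_vimage) auto
    then have "\<forall>\<^sub>F y in nhds y0. y \<in> (\<lambda>y. - y0 \<odot> y) -` ball 0 s"
      using s by (intro eventually_nhds_in_open) auto
    then have "\<forall>\<^sub>F y in nhds y0. \<Phi> y0 \<cdot> \<kappa> (\<psi> (- y0 \<odot> y)) = \<Phi> y"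
    proof (rule eventually_mono)
      fix y assume "y \<in> (\<lambda>y. - y0 \<odot> y) -` ball 0 s"
      then show "\<Phi> y0 \<cdot> \<kappa> (\<psi> (- y0 \<odot> y)) = \<Phi> y" using exp_local_chart[of "- y0 \<odot> y" "gone G" y0] by simp
    qed
    from isCont_cong[OF this] show ?thesis using c by simp
  qed
  then show ?thesis by (simp add: continuous_on_eq_continuous_at)
qed

text \<open>In every chart \<open>\<Phi>\<close> is locally Lipschitz, and a locally Lipschitz curve on a compact interval is
Lipschitz.\<close>

lemma exp_lipschitz_curve:
  assumes y: "L-lipschitz_on {0..1} y"
  shows "abs_continuous_curve G (\<lambda>\<tau>. p \<cdot> \<Phi> (y \<tau>))"
  unfolding abs_continuous_curve_def
proof (intro conjI ballI allI impI)
  have yc: "continuous_on {0..1} y" using y by (rule lipschitz_on_continuous_on)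
  have "continuous_on {0..1} (\<lambda>\<tau>. (p, \<Phi> (y \<tau>)))"
    by (intro continuous_intros continuous_on_compose2[OF \<Phi>_continuous yc]) auto
  from continuous_on_compose2[OF mult_continuous this] show "continuous_on {0..1} (\<lambda>\<tau>. p \<cdot> \<Phi> (y \<tau>))" by simp
  fix c a b assume c: "c \<in> atlas G" and ab: "0 \<le> a \<and> a \<le> b \<and> b \<le> 1 \<and> (\<lambda>\<tau>. p \<cdot> \<Phi> (y \<tau>)) ` {a..b} \<subseteq> fst c"
  have "\<exists>M. M-lipschitz_on {a..b} (\<lambda>\<tau>. snd c (p \<cdot> \<Phi> (y \<tau>)))"
  proof (rule locally_lipschitz_interval)
    show "a \<le> b" using ab by simp
    fix t assume t: "t \<in> {a..b}"
    then have "p \<cdot> \<Phi> (y t) \<in> fst c" using ab by blast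
    from exp_chart_lipschitz[OF c this] obtain r M where r: "r > 0" "M-lipschitz_on (ball (y t) r) (\<lambda>y. snd c (p \<cdot> \<Phi> y))"
      by blast
    have t01: "t \<in> {0..1}" using t ab by auto
    then obtain d where d: "d > 0" "\<And>\<tau>. \<tau> \<in> {0..1} \<Longrightarrow> dist \<tau> t < d \<Longrightarrow> dist (y \<tau>) (y t) < r"
      using yc r(1) unfolding continuous_on_iff by metis
    let ?J = "{a..b} \<inter> {t - d<..<t + d}"
    have im: "y ` ?J \<subseteq> ball (y t) r" using d(2) ab by (force simp: dist_commute dist_real_def)
    have "L-lipschitz_on ?J y" using ab by (intro lipschitz_on_subset[OF y]) auto
    from lipschitz_on_compose2[OF this lipschitz_on_subset[OF r(2) im]]
    have "(M * L)-lipschitz_on ?J (\<lambda>\<tau>. snd c (p \<cdot> \<Phi> (y \<tau>)))" .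
    then show "\<exists>d>0. \<exists>L. L-lipschitz_on ({a..b} \<inter> {t - d<..<t + d}) (\<lambda>\<tau>. snd c (p \<cdot> \<Phi> (y \<tau>)))"
      using d(1) by blast
  qed
  then show "abs_continuous_on {a..b} (snd c \<circ> (\<lambda>\<tau>. p \<cdot> \<Phi> (y \<tau>)))"
    using lipschitz_imp_abs_continuous by (auto simp: o_def)
qed

end

section \<open>Polygons are horizontal curves\<close>

locale sub_riem_group =
  lie_exponential G c\<^sub>0 \<Phi> F \<psi> \<U> \<V> s + sub_riem_model "lie_bracket G c\<^sub>0" r \<Delta>
  for G :: "('g::{t2_space, second_countable_topology}, 'e::euclidean_space) lie_struct"
    and c\<^sub>0 :: "('g, 'e) chart" and \<Phi> F \<psi> \<U> \<V> s and r :: "'e \<Rightarrow> 'e \<Rightarrow> real" and \<Delta> :: "'e set" +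
  fixes \<rho> :: "'e \<Rightarrow> 'e \<Rightarrow> real"
  assumes r_eq: "u \<in> \<Delta> \<Longrightarrow> v \<in> \<Delta> \<Longrightarrow> r u v = \<rho> u v"
begin

text \<open>The curve is parametrized with one edge per unit of time. On an edge it is affine, although it is the
curve \<open>y\<^sub>n \<odot> t v = y\<^sub>n + t (v + 1/2 [y\<^sub>n, v])\<close> of the group; the exceptional set \<open>S\<close> consists of the
vertices.\<close>

lemma polygon_path:
  assumes W: "subspace W"
  shows "xs \<in> lists W \<Longrightarrow> \<exists>y u L S. y 0 = 0 \<and> y (real (length xs)) = lprod xs \<and>
    L-lipschitz_on {0..real (length xs)} y \<and> finite S \<and>
    (\<forall>t\<in>{0..real (length xs)} - S. (y has_vector_derivative (u t + (1/2) *\<^sub>R br (y t) (u t))) (at t)) \<and>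
    (\<forall>t. u t \<in> W) \<and> ((\<lambda>t. nrm (u t)) has_integral plen xs) {0..real (length xs)}"
proof (induction xs rule: rev_induct)
  case Nil
  have "0-lipschitz_on {0..0} (\<lambda>_::real. 0::'e)" by (auto intro: lipschitz_onI)
  moreover have "0 \<in> W" using W by (rule subspace_0)
  moreover have "((\<lambda>t::real. nrm 0) has_integral 0) {0..0}" by simp
  ultimately show ?case
    by (intro exI[of _ "\<lambda>_. 0"] exI[of _ 0] exI[of _ "{0}"]) (simp add: br_simps)
next
  case (snoc v xs)
  define n where "n = real (length xs)"
  have v: "v \<in> W" and "xs \<in> lists W" using snoc.prems by auto
  then obtain y u L S where IH: "y 0 = 0" "y n = lprod xs" "L-lipschitz_on {0..n} y" "finite S"
    "\<And>t. t \<in> {0..n} - S \<Longrightarrow> (y has_vector_derivative (u t + (1/2) *\<^sub>R br (y t) (u t))) (at t)"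
    "\<And>t. u t \<in> W" "((\<lambda>t. nrm (u t)) has_integral plen xs) {0..n}"
    using snoc.IH unfolding n_def by blast
  have n0: "0 \<le> n" by (simp add: n_def)
  define w where "w = v + (1/2) *\<^sub>R br (y n) v"
  define z where "z t = y n + (t - n) *\<^sub>R w" for t
  define y' where "y' t = (if t \<le> n then y t else z t)" for t
  define u' where "u' t = (if t \<le> n then u t else v)" for t
  have len: "real (length (xs @ [v])) = n + 1" by (simp add: n_def)
  have zd: "(z has_vector_derivative w) (at t)" for t
    unfolding z_def by (auto intro!: derivative_eq_intros)
  have "(max L (norm w))-lipschitz_on {0..n + 1} y'"
    unfolding y'_def
  proof (rule lipschitz_on_concat_max[OF IH(3)])
    show "(norm w)-lipschitz_on {n..n + 1} z"
      by (rule lipschitz_onI) (simp_all add: z_def dist_norm mult.commute flip: scaleR_diff_left)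
  qed (simp add: z_def)
  moreover have "(y' has_vector_derivative (u' t + (1/2) *\<^sub>R br (y' t) (u' t))) (at t)"
    if t: "t \<in> {0..n + 1} - (S \<union> {n})" for t
  proof (cases "t < n")
    case True
    then have "(y has_vector_derivative (u t + (1/2) *\<^sub>R br (y t) (u t))) (at t)" using t by (intro IH(5)) auto
    then have "(y' has_vector_derivative (u t + (1/2) *\<^sub>R br (y t) (u t))) (at t)"
      by (rule has_vector_derivative_transform_within_open[of _ _ _ "{..<n}"]) (use True in \<open>auto simp: y'_def\<close>)
    then show ?thesis using True by (simp add: y'_def u'_def)
  next
    case False
    then have tn: "t > n" using t by auto
    have "(y' has_vector_derivative w) (at t)"
      by (rule has_vector_derivative_transform_within_open[OF zd, of "{n<..}"]) (use tn in \<open>auto simp: y'_def\<close>)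
    moreover have "v + (1/2) *\<^sub>R br (z t) v = w" by (simp add: z_def w_def br_simps)
    ultimately show ?thesis using tn by (simp add: y'_def u'_def)
  qed
  moreover have "u' t \<in> W" for t using IH(6) v by (simp add: u'_def)
  moreover have "((\<lambda>t. nrm (u' t)) has_integral plen (xs @ [v])) {0..n + 1}"
  proof -
    have 1: "((\<lambda>t. nrm (u' t)) has_integral plen xs) {0..n}"
      by (rule has_integral_eq[OF _ IH(7)]) (simp add: u'_def)
    have c: "((\<lambda>t. nrm v) has_integral nrm v) {n..n + 1}"
      using has_integral_const_real[of "nrm v" n "n + 1"] by simp
    have 2: "((\<lambda>t. nrm (u' t)) has_integral nrm v) {n..n + 1}"
      by (rule has_integral_spike_finite[where S="{n}", OF _ _ c]) (auto simp: u'_def)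
    show ?thesis using has_integral_combine[OF n0 _ 1 2] by simp
  qed
  moreover have "y' 0 = 0" using IH(1) n0 by (simp add: y'_def)
  moreover have "y' (n + 1) = lprod (xs @ [v])"
    by (simp add: y'_def z_def w_def lprod_append IH(2) bch_def br.zero_right)
  ultimately show ?case unfolding len using IH(4)
    by (intro exI[of _ y'] exI[of _ u'] exI[of _ "max L (norm w)"] exI[of _ "S \<union> {n}"]) auto
qed

definition speed :: "(real \<Rightarrow> 'g) \<Rightarrow> real \<Rightarrow> real" where
  "speed \<gamma> t = (let v = (THE v. has_velocity G c\<^sub>0 \<gamma> t v) in sqrt (\<rho> v v))"

lemma curve_length_eq: "curve_length G c\<^sub>0 \<rho> \<gamma> = integral {0..1} (speed \<gamma>)"
  unfolding curve_length_def speed_def[abs_def] ..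

lemma the_velocity: "has_velocity G c\<^sub>0 \<gamma> t v \<Longrightarrow> t \<in> {0..1} \<Longrightarrow> (THE v. has_velocity G c\<^sub>0 \<gamma> t v) = v"
  using velocity_unique by (intro the_equality) auto

lemma speed_eq:
  assumes "has_velocity G c\<^sub>0 \<gamma> t v" "t \<in> {0..1}" "v \<in> \<Delta>" shows "speed \<gamma> t = nrm v"
  unfolding speed_def the_velocity[OF assms(1,2)] Let_def nrm_def using r_eq assms(3) by simp

theorem polygon_curve:
  assumes W: "admissible W" and xs: "xs \<in> lists W"
  shows "\<exists>\<gamma>. horizontal G c\<^sub>0 W \<gamma> \<and> \<gamma> 0 = p \<and> \<gamma> 1 = p \<cdot> \<Phi> (lprod xs) \<and> curve_length G c\<^sub>0 \<rho> \<gamma> = plen xs"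
proof -
  have W': "subspace W" "W \<subseteq> \<Delta>" using W by (auto simp: admissible_def)
  \<comment> \<open>a zero edge makes the list nonempty, so that time can be rescaled to the unit interval\<close>
  define zs where "zs = 0 # xs"
  have zs: "zs \<in> lists W" "lprod zs = lprod xs" "plen zs = plen xs" "length zs > 0"
    using xs W'(1) by (auto simp: zs_def subspace_0)
  define n where "n = real (length zs)"
  have n: "n > 0" using zs(4) by (simp add: n_def)
  obtain y u L S where y: "y 0 = 0" "y n = lprod zs" "L-lipschitz_on {0..n} y" "finite S"
    "\<And>t. t \<in> {0..n} - S \<Longrightarrow> (y has_vector_derivative (u t + (1/2) *\<^sub>R br (y t) (u t))) (at t)"
    "\<And>t. u t \<in> W" "((\<lambda>t. nrm (u t)) has_integral plen zs) {0..n}"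
    using polygon_path[OF W'(1) zs(1)] unfolding n_def by blast
  define Y where "Y t = y (n * t)" for t
  define v where "v t = n *\<^sub>R u (n * t)" for t
  define S' where "S' = (\<lambda>t. t / n) ` S"
  have S': "finite S'" using y(4) by (simp add: S'_def)
  have nt: "n * t \<in> {0..n} - S" if "t \<in> {0..1} - S'" for t
  proof -
    have "n * t \<in> S \<Longrightarrow> t \<in> S'" using n by (force simp: S'_def)
    then show ?thesis using that n by (auto simp: mult_left_le)
  qed
  have vW: "v t \<in> W" for t using y(6) W'(1) by (simp add: v_def subspace_scale)
  have lip: "(L * n)-lipschitz_on {0..1} Y"
  proof -
    have a: "n-lipschitz_on {0..1} (\<lambda>t. n * t)"
      using n by (intro lipschitz_onI) (auto simp: dist_real_def abs_mult simp flip: right_diff_distrib)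
    have "(\<lambda>t. n * t) ` {0..1} \<subseteq> {0..n}" using n by (auto simp: mult_left_le)
    from lipschitz_on_compose2[OF a lipschitz_on_subset[OF y(3) this]] show ?thesis unfolding Y_def .
  qed
  define \<gamma> where "\<gamma> t = p \<cdot> \<Phi> (Y t)" for t
  have vel: "has_velocity G c\<^sub>0 \<gamma> t (v t)" if t: "t \<in> {0..1} - S'" for t
  proof -
    have "((\<lambda>t. n * t) has_vector_derivative n) (at t)" by (auto intro!: derivative_eq_intros)
    from vector_diff_chain_at[OF this y(5)[OF nt[OF t]]]
    have 1: "(Y has_vector_derivative (n *\<^sub>R (u (n * t) + (1/2) *\<^sub>R br (y (n * t)) (u (n * t))))) (at t)"
      by (simp add: o_def Y_def[abs_def])
    have 2: "n *\<^sub>R (u (n * t) + (1/2) *\<^sub>R br (y (n * t)) (u (n * t))) = v t + (1/2) *\<^sub>R br (Y t) (v t)"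
      unfolding v_def Y_def br.scaleR_right scaleR_add_right by simp
    have "(Y has_vector_derivative (v t + (1/2) *\<^sub>R br (Y t) (v t))) (at t within {0..1})"
      using has_vector_derivative_at_within[OF 1] unfolding 2 .
    then show ?thesis unfolding \<gamma>_def using t by (intro exp_velocity) auto
  qed
  have "horizontal G c\<^sub>0 W \<gamma>"
    unfolding horizontal_def
  proof
    show "abs_continuous_curve G \<gamma>" unfolding \<gamma>_def using lip by (rule exp_lipschitz_curve)
    have "S' \<in> null_sets lebesgue" using negligible_finite[OF S'] by (simp add: negligible_iff_null_sets)
    then show "AE t in lebesgue. t \<in> {0..1} \<longrightarrow> (\<exists>v\<in>W. has_velocity G c\<^sub>0 \<gamma> t v)"
    proof (rule AE_I')
      show "{t \<in> space lebesgue. \<not> (t \<in> {0..1} \<longrightarrow> (\<exists>v\<in>W. has_velocity G c\<^sub>0 \<gamma> t v))} \<subseteq> S'"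
      proof
        fix t assume t: "t \<in> {t \<in> space lebesgue. \<not> (t \<in> {0..1} \<longrightarrow> (\<exists>v\<in>W. has_velocity G c\<^sub>0 \<gamma> t v))}"
        show "t \<in> S'"
        proof (rule ccontr)
          assume "t \<notin> S'"
          then have "has_velocity G c\<^sub>0 \<gamma> t (v t)" using t by (intro vel) simp
          then show False using t vW[of t] by blast
        qed
      qed
    qed
  qed
  moreover have "curve_length G c\<^sub>0 \<rho> \<gamma> = plen xs"
  proof -
    have "((\<lambda>t. nrm (u (n * t))) has_integral (1 / \<bar>n\<bar>) *\<^sub>R plen zs) ((\<lambda>t. t / n) ` {0..n})"
      by (rule has_integral_stretch_real[OF y(7)]) (use n in simp)
    moreover have "(\<lambda>t. t / n) ` {0..n} = {0..1}"
    proof (intro equalityI subsetI)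
      fix t assume "t \<in> {0..1::real}"
      then have "t = (n * t) / n" "n * t \<in> {0..n}" using n by (auto simp: mult_left_le)
      then show "t \<in> (\<lambda>t. t / n) ` {0..n}" by blast
    qed (use n in auto)
    ultimately have "((\<lambda>t. n * nrm (u (n * t))) has_integral n * ((1 / \<bar>n\<bar>) *\<^sub>R plen zs)) {0..1}"
      by (intro has_integral_mult_right) simp
    then have "((\<lambda>t. nrm (v t)) has_integral plen zs) {0..1}"
      using n by (simp add: v_def nrm_scaleR)
    then have "(speed \<gamma> has_integral plen zs) {0..1}"
      by (rule has_integral_spike_finite[OF S', rotated]) (use speed_eq[OF vel] vW W'(2) in blast)
    then show ?thesis by (simp add: curve_length_eq integral_unique zs(3))
  qed
  moreover have "\<gamma> 0 = p" "\<gamma> 1 = p \<cdot> \<Phi> (lprod xs)" by (simp_all add: \<gamma>_def Y_def y zs)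
  ultimately show ?thesis by blast
qed

end

section \<open>Horizontal curves are approximated by polygons\<close>

context lie_exponential
begin

text \<open>Exponential coordinates centred at \<open>q\<close>, as a function on the chart \<open>c\<close>.\<close>

definition chart_log :: "('g, 'e) chart \<Rightarrow> 'g \<Rightarrow> 'e \<Rightarrow> 'e" where
  "chart_log c q z = F (translation c c\<^sub>0 (ginv G q) z)"

lemma chart_log_regular:
  assumes c: "c \<in> atlas G" and q: "q \<in> fst c"
  shows "\<exists>r>0. \<exists>L. L-lipschitz_on (ball (snd c q) r) (chart_log c q) \<and>
    (\<forall>z\<in>ball (snd c q) r. z \<in> translation_dom c c\<^sub>0 (ginv G q) \<and> translation c c\<^sub>0 (ginv G q) z \<in> \<U> \<and>
      (\<exists>D. (chart_log c q has_derivative D) (at z)))"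
proof -
  let ?T = "translation c c\<^sub>0 (ginv G q)" and ?dom = "translation_dom c c\<^sub>0 (ginv G q)" and ?z = "snd c q"
  have zdom: "?z \<in> ?dom" by (rule left_diff_left_inverse[OF c q])
  have Tz: "?T ?z = x\<^sub>0" using chart_facts(3)[OF c q] by (simp add: translation_def)
  obtain r1 L1 where 1: "r1 > 0" "ball ?z r1 \<subseteq> ?dom" "L1-lipschitz_on (ball ?z r1) ?T"
    by (rule translation_lipschitz[OF c c0 zdom], rule that)
  obtain r2 L2 where 2: "r2 > 0" "ball x\<^sub>0 r2 \<subseteq> \<U>" "L2-lipschitz_on (ball x\<^sub>0 r2) F"
    by (rule C1_locally_lipschitz[OF \<U>(1,2) F_der Fdiff_cont], assumption, rule that)
  have "continuous_on (ball ?z r1) ?T" using 1(3) by (rule lipschitz_on_continuous_on)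
  then have "isCont ?T ?z" using 1(1) by (simp add: continuous_on_eq_continuous_at)
  then obtain r3 where 3: "r3 > 0" "\<And>z. dist z ?z < r3 \<Longrightarrow> dist (?T z) x\<^sub>0 < r2"
    using 2(1) unfolding continuous_at_eps_delta Tz by blast
  define r where "r = min r1 r3"
  have sub: "ball ?z r \<subseteq> ball ?z r1" by (auto simp: r_def)
  have im: "?T ` ball ?z r \<subseteq> ball x\<^sub>0 r2" using 3(2) by (auto simp: r_def dist_commute)
  from lipschitz_on_compose2[OF lipschitz_on_subset[OF 1(3) sub] lipschitz_on_subset[OF 2(3) im]]
  have lip: "(L2 * L1)-lipschitz_on (ball ?z r) (chart_log c q)" unfolding chart_log_def .
  obtain D' where D': "\<forall>y\<in>?dom. (?T has_derivative D' y) (at y)"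
    using translation_C1[OF c c0, of "ginv G q"] by blast
  have "z \<in> ?dom \<and> ?T z \<in> \<U> \<and> (\<exists>D. (chart_log c q has_derivative D) (at z))" if z: "z \<in> ball ?z r" for z
  proof -
    have a: "z \<in> ?dom" "?T z \<in> \<U>" using z sub 1(2) im 2(2) by blast+
    have "(?T has_derivative D' z) (at z)" using D' a(1) by blast
    from has_derivative_compose[OF this F_der[OF a(2)]]
    show ?thesis using a unfolding chart_log_def[abs_def] by blast
  qed
  moreover have "r > 0" using 1 3 by (simp add: r_def)
  ultimately show ?thesis using lip by blast
qed

lemma chart_log_exp:
  assumes c: "c \<in> atlas G" and q: "q \<in> fst c" and p: "p \<in> fst c"
    and dom: "snd c p \<in> translation_dom c c\<^sub>0 (ginv G q)" "translation c c\<^sub>0 (ginv G q) (snd c p) \<in> \<U>"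
    and small: "chart_log c q (snd c p) \<in> ball 0 s"
  shows "q \<cdot> \<Phi> (chart_log c q (snd c p)) = p"
proof -
  let ?z = "translation c c\<^sub>0 (ginv G q) (snd c p)"
  have "\<psi> (F ?z) = ?z" using dom(2) hom by (auto simp: homeomorphism_def)
  then have "\<Phi> (chart_log c q (snd c p)) = \<kappa> ?z" using \<Phi>_local[OF small] by (simp add: chart_log_def)
  also have "\<dots> = ginv G q \<cdot> p"
    using dom(1) chart_facts(3)[OF c p] c0_facts(3) by (simp add: translation_def translation_dom_def)
  finally show ?thesis by simp
qed

lemma chart_log_\<Phi>:
  assumes c: "c \<in> atlas G" and p: "q \<cdot> \<Phi> u \<in> fst c" and u: "u \<in> ball 0 s"
  shows "chart_log c q (snd c (q \<cdot> \<Phi> u)) = u"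
  using \<psi>_facts[OF u] chart_facts(3)[OF c p] by (simp add: chart_log_def translation_def)

text \<open>Near \<open>0\<close> the composition of \<open>chart_log\<close> with \<open>u \<mapsto> p \<cdot> \<Phi> u\<close> is the left translation \<open>u \<mapsto> k \<odot> u\<close>.
Comparing derivatives at \<open>0\<close> gives the derivative of \<open>chart_log\<close> on horizontal velocities.\<close>

lemma chart_log_derivative:
  assumes c: "c \<in> atlas G" and q: "q \<in> fst c" and p: "p \<in> fst c" and D: "(chart_log c q has_derivative D) (at (snd c p))"
    and k: "p = q \<cdot> \<Phi> k" "k \<in> ball 0 s"
  shows "D (left_diff G c\<^sub>0 c p v) = v + (1/2) *\<^sub>R br k v"
proof -
  have T0: "translation c\<^sub>0 c p x\<^sub>0 = snd c p" by (simp add: translation_def)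
  have "((\<lambda>u. translation c\<^sub>0 c p (\<psi> u)) has_derivative (\<lambda>v. left_diff G c\<^sub>0 c p v)) (at 0)"
    using has_derivative_compose[OF \<psi>_der_zero, of "translation c\<^sub>0 c p" "left_diff G c\<^sub>0 c p"] left_diff_derivative[OF c p]
    by (simp add: \<psi>_zero)
  from has_derivative_compose[OF this, of "chart_log c q" D]
  have d: "((\<lambda>u. chart_log c q (translation c\<^sub>0 c p (\<psi> u))) has_derivative (\<lambda>v. D (left_diff G c\<^sub>0 c p v))) (at 0)"
    using D by (simp add: T0 \<psi>_zero)
  have open1: "open {u. p \<cdot> \<Phi> u \<in> fst c}"
  proof -
    have "continuous_on UNIV (\<lambda>u. (p, \<Phi> u))" by (intro continuous_intros \<Phi>_continuous)
    from continuous_on_compose2[OF mult_continuous this] have "continuous_on UNIV (\<lambda>u. p \<cdot> \<Phi> u)" by simp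
    from open_vimage[OF chart_facts(1)[OF c] this] show ?thesis by (simp add: vimage_def)
  qed
  have open2: "open {u. k \<odot> u \<in> ball 0 s}"
    using open_vimage[OF open_ball[of 0 s] bch_continuous[of UNIV k]] by (simp only: vimage_def)
  define S where "S = ({u. p \<cdot> \<Phi> u \<in> fst c} \<inter> {u. k \<odot> u \<in> ball 0 s}) \<inter> ball 0 s"
  have S: "open S" "0 \<in> S" unfolding S_def using open1 open2 p k s by (auto intro!: open_Int simp del: mem_ball)
  have "chart_log c q (translation c\<^sub>0 c p (\<psi> u)) = k \<odot> u" if "u \<in> S" for u
  proof -
    have u: "p \<cdot> \<Phi> u \<in> fst c" "k \<odot> u \<in> ball 0 s" "u \<in> ball 0 s" using that by (auto simp: S_def)
    have "translation c\<^sub>0 c p (\<psi> u) = snd c (q \<cdot> \<Phi> (k \<odot> u))"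
      using \<Phi>_local[OF u(3)] by (simp add: translation_def k(1) \<Phi>_mult gr.assoc)
    moreover have "q \<cdot> \<Phi> (k \<odot> u) \<in> fst c" using u(1) by (simp add: k(1) \<Phi>_mult gr.assoc)
    ultimately show ?thesis using chart_log_\<Phi>[OF c _ u(2)] by simp
  qed
  from has_derivative_transform_within_open[OF d S this]
  have "((\<lambda>u. k \<odot> u) has_derivative (\<lambda>v. D (left_diff G c\<^sub>0 c p v))) (at 0)" .
  from has_derivative_unique[OF this bch_left_derivative] show ?thesis by (simp add: fun_eq_iff)
qed

end

context sub_riem_group
begin

text \<open>In exponential coordinates \<open>k\<close> centred at \<open>\<gamma> t0\<close> the velocity \<open>v\<close> of the curve satisfies
\<open>k' = v + 1/2 [k, v]\<close>. Hence \<open>- k a \<odot> k b\<close> is the mean motion \<open>w = \<integral> v\<close>, which lies in \<open>W\<close>, plus the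
central term \<open>\<zeta> = 1/2 \<integral> [k - k a, v]\<close>. The latter is small compared with the length because \<open>k\<close> stays
close to \<open>0\<close> on a short interval. So the curve is replaced there by the single edge \<open>w\<close>.\<close>

lemma curve_polygon_local:
  assumes W: "admissible W" and \<gamma>: "horizontal G c\<^sub>0 W \<gamma>" and t0: "t0 \<in> {0..1}" and e: "e > 0"
  shows "\<exists>d>0. \<forall>a b. 0 \<le> a \<and> a \<le> t0 \<and> t0 \<le> b \<and> b \<le> 1 \<and> b - a < d \<longrightarrow>
    speed \<gamma> integrable_on {a..b} \<and> (\<exists>w\<in>W. \<exists>\<zeta>\<in>Z. \<gamma> b = \<gamma> a \<cdot> \<Phi> (w + \<zeta>) \<and>
      nrm w \<le> integral {a..b} (speed \<gamma>) \<and> norm \<zeta> \<le> e * integral {a..b} (speed \<gamma>))"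
proof -
  have W': "subspace W" "W \<subseteq> \<Delta>" using W by (auto simp: admissible_def)
  have \<gamma>c: "continuous_on {0..1} \<gamma>" and \<gamma>ac: "\<And>c a b. c \<in> atlas G \<Longrightarrow> 0 \<le> a \<Longrightarrow> a \<le> b \<Longrightarrow> b \<le> 1 \<Longrightarrow>
    \<gamma> ` {a..b} \<subseteq> fst c \<Longrightarrow> abs_continuous_on {a..b} (snd c \<circ> \<gamma>)"
    and \<gamma>ae: "AE t in lebesgue. t \<in> {0..1} \<longrightarrow> (\<exists>v\<in>W. has_velocity G c\<^sub>0 \<gamma> t v)"
    using \<gamma> unfolding horizontal_def abs_continuous_curve_def by blast+
  obtain N where N: "negligible N" "\<And>t. t \<in> {0..1} - N \<Longrightarrow> \<exists>v\<in>W. has_velocity G c\<^sub>0 \<gamma> t v"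
  proof -
    obtain N where "{t \<in> space lebesgue. \<not> (t \<in> {0..1} \<longrightarrow> (\<exists>v\<in>W. has_velocity G c\<^sub>0 \<gamma> t v))} \<subseteq> N" "N \<in> null_sets lebesgue"
      using \<gamma>ae unfolding eventually_ae_filter by blast
    then show ?thesis by (intro that[of N]) (auto simp: negligible_iff_null_sets)
  qed
  define v where "v t = (THE v. has_velocity G c\<^sub>0 \<gamma> t v)" for t
  have v: "has_velocity G c\<^sub>0 \<gamma> t (v t)" "v t \<in> W" "speed \<gamma> t = nrm (v t)" if t: "t \<in> {0..1} - N" for t
  proof -
    obtain x where x: "x \<in> W" "has_velocity G c\<^sub>0 \<gamma> t x" using N(2)[OF t] by blast
    have "v t = x" unfolding v_def using x(2) t by (intro the_velocity) auto
    then show "has_velocity G c\<^sub>0 \<gamma> t (v t)" "v t \<in> W" "speed \<gamma> t = nrm (v t)"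
      using x t W'(2) speed_eq[of \<gamma> t x] by auto
  qed
  obtain c where c: "c \<in> atlas G" "\<gamma> t0 \<in> fst c" using charts_cover .
  define q where "q = \<gamma> t0"
  define h where "h = chart_log c q"
  have q: "q \<in> fst c" using c by (simp add: q_def)
  obtain \<delta> L where \<delta>: "\<delta> > 0" "L-lipschitz_on (ball (snd c q) \<delta>) h"
    "\<And>z. z \<in> ball (snd c q) \<delta> \<Longrightarrow> z \<in> translation_dom c c\<^sub>0 (ginv G q) \<and> translation c c\<^sub>0 (ginv G q) z \<in> \<U> \<and> (\<exists>D. (h has_derivative D) (at z))"
    using chart_log_regular[OF c(1) q] unfolding h_def by blast
  have hq: "h (snd c q) = 0" using chart_log_\<Phi>[OF c(1), of q 0] q s by (simp add: h_def)
  obtain K where K: "K > 0" "\<And>a b. norm (br a b) \<le> norm a * norm b * K" using br.pos_bounded by blast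
  obtain cl where cl: "cl > 0" "\<And>x. x \<in> \<Delta> \<Longrightarrow> cl * norm x \<le> nrm x" by (rule nrm_lower, rule that)
  obtain B where B: "B > 0" "\<And>x. nrm x \<le> B * norm x" by (rule nrm_upper, rule that)
  \<comment> \<open>the bracket is bounded by \<open>K\<close> and \<open>nrm\<close> by \<open>cl\<close> from below, so coordinates below \<open>\<eta>\<close> give errors below \<open>e\<close> times the length\<close>
  define \<eta> where "\<eta> = min s (e * cl / K)"
  have \<eta>: "\<eta> > 0" "\<eta> \<le> s" "\<eta> * K \<le> e * cl"
    using s e cl K by (auto simp: \<eta>_def min_def field_simps)
  have "continuous_on (ball (snd c q) \<delta>) h" using \<delta>(2) by (rule lipschitz_on_continuous_on)
  then have "isCont h (snd c q)" using \<delta>(1) by (simp add: continuous_on_eq_continuous_at)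
  then obtain \<delta>' where \<delta>': "\<delta>' > 0" "\<And>z. dist z (snd c q) < \<delta>' \<Longrightarrow> dist (h z) (h (snd c q)) < \<eta>"
    using \<eta>(1) unfolding continuous_at_eps_delta by blast
  define \<delta>2 where "\<delta>2 = min \<delta> \<delta>'"
  have \<delta>2: "\<delta>2 > 0" using \<delta>(1) \<delta>'(1) by (simp add: \<delta>2_def)
  define Q where "Q = fst c \<inter> snd c -` ball (snd c q) \<delta>2"
  have "open Q" unfolding Q_def using chart_facts(1,6)[OF c(1)] by (simp add: continuous_open_preimage)
  moreover have "\<gamma> t0 \<in> Q" using c(2) \<delta>2 by (simp add: Q_def q_def)
  ultimately obtain d1 where d1: "d1 > 0" "\<And>t. t \<in> {0..1} \<Longrightarrow> dist t t0 < d1 \<Longrightarrow> \<gamma> t \<in> Q"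
  proof -
    have "\<forall>\<^sub>F t in at t0 within {0..1}. \<gamma> t \<in> Q"
      using \<gamma>c t0 \<open>open Q\<close> \<open>\<gamma> t0 \<in> Q\<close> unfolding continuous_on_def by (blast intro: topological_tendstoD)
    then obtain d where "d > 0" "\<And>t. t \<in> {0..1} \<Longrightarrow> t \<noteq> t0 \<Longrightarrow> dist t t0 < d \<Longrightarrow> \<gamma> t \<in> Q"
      unfolding eventually_at by blast
    then show ?thesis using that \<open>\<gamma> t0 \<in> Q\<close> by metis
  qed
  define lo hi where "lo = max 0 (t0 - d1 / 2)" and "hi = min 1 (t0 + d1 / 2)"
  have lohi: "0 \<le> lo" "lo \<le> t0" "t0 \<le> hi" "hi \<le> 1" using t0 d1 by (auto simp: lo_def hi_def)
  have in01: "{lo..hi} \<subseteq> {0..1}" using lohi by auto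
  have inQ: "\<gamma> t \<in> Q" if "t \<in> {lo..hi}" for t
    using that d1 lohi by (intro d1(2)) (auto simp: dist_real_def lo_def hi_def abs_if)
  define k where "k t = h (snd c (\<gamma> t))" for t
  have ball1: "snd c (\<gamma> t) \<in> ball (snd c q) \<delta>" "\<gamma> t \<in> fst c" "norm (k t) < \<eta>" if "t \<in> {lo..hi}" for t
    using inQ[OF that] \<delta>'(2)[of "snd c (\<gamma> t)"] hq by (auto simp: Q_def \<delta>2_def k_def dist_commute)
  have ks: "k t \<in> ball 0 s" if "t \<in> {lo..hi}" for t using ball1(3)[OF that] \<eta>(2) by simp
  have \<gamma>k: "\<gamma> t = q \<cdot> \<Phi> (k t)" if t: "t \<in> {lo..hi}" for t
    using chart_log_exp[OF c(1) q ball1(2)[OF t]] \<delta>(3)[OF ball1(1)[OF t]] ks[OF t] by (simp add: h_def k_def)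
  have kac: "abs_continuous_on {lo..hi} k"
  proof -
    have "abs_continuous_on {lo..hi} (snd c \<circ> \<gamma>)"
      using lohi ball1(2) by (intro \<gamma>ac c(1)) auto
    from abs_continuous_on_lipschitz_compose[OF this \<delta>(2) order_refl] ball1(1)
    show ?thesis unfolding k_def by (auto simp: image_subset_iff)
  qed
  have kcont: "continuous_on {lo..hi} k"
  proof -
    have "continuous_on {lo..hi} (\<lambda>t. snd c (\<gamma> t))"
      by (rule continuous_on_compose2[OF chart_facts(6)[OF c(1)] continuous_on_subset[OF \<gamma>c in01]]) (use ball1(2) in auto)
    from continuous_on_compose2[OF lipschitz_on_continuous_on[OF \<delta>(2)] this] ball1(1) show ?thesis
      unfolding k_def by (auto simp: image_subset_iff)
  qed
  define k' where "k' t = v t + (1/2) *\<^sub>R br (k t) (v t)" for t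
  have kder: "(k has_vector_derivative k' t) (at t within {0..1})" if t: "t \<in> {lo..hi} - N" for t
  proof -
    have t': "t \<in> {lo..hi}" "t \<in> {0..1} - N" using t in01 by auto
    obtain D where D: "(h has_derivative D) (at (snd c (\<gamma> t)))" using \<delta>(3)[OF ball1(1)[OF t'(1)]] by blast
    have "((snd c \<circ> \<gamma>) has_vector_derivative left_diff G c\<^sub>0 c (\<gamma> t) (v t)) (at t within {0..1})"
      using v(1)[OF t'(2)] c(1) ball1(2)[OF t'(1)] unfolding has_velocity_def by blast
    from has_derivative_compose[OF this[unfolded has_vector_derivative_def], of h D] D
    have "(k has_derivative (\<lambda>x. D (x *\<^sub>R left_diff G c\<^sub>0 c (\<gamma> t) (v t)))) (at t within {0..1})"
      by (simp add: k_def[abs_def])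
    moreover have "D (left_diff G c\<^sub>0 c (\<gamma> t) (v t)) = k' t"
      unfolding k'_def using D unfolding h_def
      by (rule chart_log_derivative[OF c(1) q ball1(2)[OF t'(1)] _ \<gamma>k[OF t'(1)] ks[OF t'(1)]])
    ultimately show ?thesis
      unfolding has_vector_derivative_def by (simp add: linear_cmul[OF has_derivative_linear[OF D]])
  qed
  obtain \<delta>3 where \<delta>3: "\<delta>3 > 0" "\<forall>a b N f'. a \<le> b \<and> b - a < \<delta>3 \<and> {a..b} \<subseteq> {lo..hi} \<and> negligible N \<and>
    (\<forall>t\<in>{a..b} - N. (k has_vector_derivative f' t) (at t within {a..b})) \<longrightarrow> f' absolutely_integrable_on {a..b}"
    using abs_continuous_derivative_integrable[OF kac] by (elim exE conjE) (rule that)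
  define d where "d = min \<delta>3 (d1 / 2)"
  have "speed \<gamma> integrable_on {a..b} \<and> (\<exists>w\<in>W. \<exists>\<zeta>\<in>Z. \<gamma> b = \<gamma> a \<cdot> \<Phi> (w + \<zeta>) \<and>
      nrm w \<le> integral {a..b} (speed \<gamma>) \<and> norm \<zeta> \<le> e * integral {a..b} (speed \<gamma>))"
    if ab: "0 \<le> a" "a \<le> t0" "t0 \<le> b" "b \<le> 1" "b - a < d" for a b
  proof -
    have ab': "a \<le> b" "b - a < \<delta>3" "{a..b} \<subseteq> {lo..hi}" using ab by (auto simp: d_def lo_def hi_def)
    have sub01: "{a..b} \<subseteq> {0..1}" using ab by auto
    have kder': "(k has_vector_derivative k' t) (at t within {a..b})" if "t \<in> {a..b} - N" for t
      using kder[of t] that ab'(3) by (intro has_vector_derivative_within_subset[OF _ sub01]) blast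
    have kint: "(k' has_integral k b - k a) {a..b}"
      by (rule abs_continuous_fundamental_theorem[OF ab'(1) kac ab'(3) N(1) kder'])
    have kabs: "k' absolutely_integrable_on {a..b}" using \<delta>3(2) ab' N(1) kder' by blast
    have kc: "continuous_on {a..b} k" using kcont ab'(3) by (rule continuous_on_subset)
    have bil: "bilinear br" using br.bounded_bilinear_axioms by (simp add: bilinear_conv_bounded_bilinear)
    have brk: "(\<lambda>t. br (k t) (k' t)) absolutely_integrable_on {a..b}"
    proof (rule absolutely_integrable_bounded_measurable_product[OF bil _ _ _ kabs])
      show "k \<in> borel_measurable (lebesgue_on {a..b})"
        using kc by (intro continuous_imp_measurable_on_sets_lebesgue) auto
      show "bounded (k ` {a..b})" using kc by (intro compact_imp_bounded compact_continuous_image) auto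
    qed auto
    \<comment> \<open>the velocity is recovered from the derivative since double brackets vanish; this shows that it is measurable and integrable\<close>
    have veq: "v t = k' t - (1/2) *\<^sub>R br (k t) (k' t)" for t by (simp add: k'_def br_simps)
    have vabs: "v absolutely_integrable_on {a..b}"
      unfolding veq[abs_def]
      by (intro set_integral_diff(1) kabs absolutely_integrable_scaleR_left brk)
    have vint: "(v has_integral integral {a..b} v) {a..b}"
      using vabs set_lebesgue_integral_eq_integral(1) by (intro integrable_integral)
    have nrm_borel: "nrm \<in> borel_measurable borel"
      unfolding nrm_def[abs_def] by (intro borel_measurable_continuous_onI continuous_intros r.continuous_on)
    have "(\<lambda>t. nrm (v t)) absolutely_integrable_on {a..b}"
    proof (rule measurable_bounded_by_integrable_imp_absolutely_integrable)
      show "(\<lambda>t. nrm (v t)) \<in> borel_measurable (lebesgue_on {a..b})"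
        using measurable_compose[OF absolutely_integrable_measurable[THEN iffD1, OF _ vabs, THEN conjunct1] nrm_borel] by auto
      show "(\<lambda>t. B * norm (v t)) integrable_on {a..b}"
        using vabs by (intro integrable_on_mult_right) (simp add: absolutely_integrable_on_def)
      show "norm (nrm (v t)) \<le> B * norm (v t)" for t using B(2) by simp
    qed auto
    then have nint: "(\<lambda>t. nrm (v t)) integrable_on {a..b}" by (rule set_lebesgue_integral_eq_integral(1))
    have v_ab: "v t \<in> W" "speed \<gamma> t = nrm (v t)" if "t \<in> {a..b} - N" for t using v[of t] that sub01 by auto
    have sp: "speed \<gamma> integrable_on {a..b}"
      by (rule integrable_spike[OF nint N(1)]) (use v_ab in auto)
    have sp_eq: "integral {a..b} (speed \<gamma>) = integral {a..b} (\<lambda>t. nrm (v t))"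
      by (rule integral_spike[OF N(1)]) (use v_ab in auto)
    define w where "w = integral {a..b} v"
    have wW: "w \<in> W" unfolding w_def using integral_in_subspace[OF W'(1) vint N(1)] v_ab(1) by blast
    have nrm_w: "nrm w \<le> integral {a..b} (speed \<gamma>)"
    proof -
      have "((\<lambda>t. r w (v t)) has_integral r w w) {a..b}"
        using has_integral_linear[OF vint r.bounded_linear_right[of w]] by (simp add: o_def w_def)
      moreover have "((\<lambda>t. nrm w * nrm (v t)) has_integral nrm w * integral {a..b} (speed \<gamma>)) {a..b}"
        unfolding sp_eq by (intro has_integral_mult_right integrable_integral nint)
      ultimately have "r w w \<le> nrm w * integral {a..b} (speed \<gamma>)"
        by (rule has_integral_le) (use r_le_nrm in \<open>metis abs_le_D1\<close>)
      then have "nrm w * nrm w \<le> nrm w * integral {a..b} (speed \<gamma>)" by (simp add: nrm_sq[symmetric] power2_eq_square)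
      moreover have "0 \<le> integral {a..b} (speed \<gamma>)" unfolding sp_eq by (rule integral_nonneg[OF nint]) simp
      ultimately show ?thesis using nrm_nonneg[of w] by (cases "nrm w = 0") (auto simp: mult_le_cancel_left)
    qed
    define g where "g t = br (k t - k a) (v t)" for t
    have brv: "br (k t) (k' t) = br (k t) (v t)" for t by (simp add: k'_def br_simps)
    have gint: "(g has_integral (integral {a..b} (\<lambda>t. br (k t) (v t)) - br (k a) w)) {a..b}"
    proof -
      have "((\<lambda>t. br (k t) (v t)) has_integral integral {a..b} (\<lambda>t. br (k t) (v t))) {a..b}"
        using set_lebesgue_integral_eq_integral(1)[OF brk] unfolding brv by (rule integrable_integral)
      moreover have "((\<lambda>t. br (k a) (v t)) has_integral br (k a) w) {a..b}"
        using has_integral_linear[OF vint br.bounded_linear_right[of "k a"]] by (simp add: o_def w_def)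
      ultimately show ?thesis unfolding g_def br.diff_left by (rule has_integral_diff)
    qed
    define I where "I = integral {a..b} (\<lambda>t. br (k t) (v t))"
    define \<zeta> where "\<zeta> = (1/2) *\<^sub>R (I - br (k a) w)"
    have gZ: "I - br (k a) w \<in> Z"
      using integral_in_subspace[OF Z_subspace gint[folded I_def] negligible_empty] by (simp add: g_def br_in_Z)
    have IZ: "I \<in> Z" using subspace_add[OF Z_subspace gZ br_in_Z[of "k a" w]] by simp
    have \<zeta>Z: "\<zeta> \<in> Z" unfolding \<zeta>_def using gZ Z_subspace by (simp add: subspace_scale)
    have kb: "k b - k a = w + (1/2) *\<^sub>R I"
    proof -
      have "(k' has_integral w + (1/2) *\<^sub>R I) {a..b}"
        unfolding k'_def[abs_def] I_def w_def
        using set_lebesgue_integral_eq_integral(1)[OF brk] unfolding brv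
        by (intro has_integral_add vint has_integral_cmul integrable_integral)
      then show ?thesis using has_integral_unique[OF kint] by blast
    qed
    have step: "- k a \<odot> k b = w + \<zeta>"
    proof -
      have "k b = k a + (w + (1/2) *\<^sub>R I)" using kb by (simp add: algebra_simps)
      then show ?thesis
        by (simp add: bch_def \<zeta>_def br_simps Z_central[OF IZ] algebra_simps)
    qed
    have ends: "a \<in> {lo..hi}" "b \<in> {lo..hi}" using ab' by auto
    have "\<gamma> b = \<gamma> a \<cdot> \<Phi> (- k a \<odot> k b)"
    proof -
      have "\<gamma> a \<cdot> \<Phi> (- k a \<odot> k b) = q \<cdot> \<Phi> (k a \<odot> (- k a \<odot> k b))"
        unfolding \<gamma>k[OF ends(1)] \<Phi>_mult by (simp add: gr.assoc)
      then show ?thesis using \<gamma>k[OF ends(2)] by simp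
    qed
    then have \<gamma>b: "\<gamma> b = \<gamma> a \<cdot> \<Phi> (w + \<zeta>)" unfolding step .
    have norm_\<zeta>: "norm \<zeta> \<le> e * integral {a..b} (speed \<gamma>)"
    proof -
      define v1 where "v1 t = (if t \<in> N then 0 else v t)" for t
      have g1: "((\<lambda>t. br (k t - k a) (v1 t)) has_integral (I - br (k a) w)) {a..b}"
        by (rule has_integral_spike[OF N(1) _ gint[folded I_def]]) (simp add: g_def v1_def)
      have bound: "norm (br (k t - k a) (v1 t)) \<le> (2 * e) * nrm (v1 t)" if t: "t \<in> {a..b}" for t
      proof -
        have v1: "v1 t \<in> \<Delta>" using v_ab(1)[of t] t W'(2) subspace_0[OF \<Delta>_subspace] by (auto simp: v1_def)
        have "norm (k t - k a) \<le> 2 * \<eta>"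
          using norm_triangle_ineq4[of "k t" "k a"] ball1(3)[OF ends(1)] ball1(3)[of t] t ab'(3) by force
        then have "norm (k t - k a) * norm (v1 t) * K \<le> (2 * \<eta>) * norm (v1 t) * K"
          using K(1) by (intro mult_right_mono) auto
        also have "\<dots> = 2 * (\<eta> * K) * norm (v1 t)" by simp
        also have "\<dots> \<le> 2 * (e * cl) * norm (v1 t)" using \<eta>(3) by (intro mult_right_mono) auto
        also have "\<dots> = (2 * e) * (cl * norm (v1 t))" by simp
        also have "\<dots> \<le> (2 * e) * nrm (v1 t)" using e by (intro mult_left_mono cl(2) v1) auto
        finally show ?thesis using K(2)[of "k t - k a" "v1 t"] by linarith
      qed
      have n1: "((\<lambda>t. (2 * e) * nrm (v1 t)) has_integral (2 * e) * integral {a..b} (speed \<gamma>)) {a..b}"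
        unfolding sp_eq
        by (rule has_integral_spike[OF N(1) _ has_integral_mult_right[OF integrable_integral[OF nint]]]) (simp add: v1_def)
      have "norm (I - br (k a) w) \<le> (2 * e) * integral {a..b} (speed \<gamma>)"
        using integral_norm_bound_integral[OF has_integral_integrable[OF g1] has_integral_integrable[OF n1] bound]
        unfolding integral_unique[OF g1] integral_unique[OF n1] .
      then show ?thesis by (simp add: \<zeta>_def)
    qed
    show ?thesis using sp wW \<zeta>Z \<gamma>b nrm_w norm_\<zeta> by blast
  qed
  moreover have "d > 0" using \<delta>3(1) d1(1) by (simp add: d_def)
  ultimately show ?thesis by blast
qed

text \<open>The local statement is additive: products of endpoints concatenate the polygons and add the central
errors, and lengths and errors are bounded by integrals. Bolzano's principle extends it from short
intervals to all intervals.\<close>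

theorem curve_polygon:
  assumes W: "admissible W" and \<gamma>: "horizontal G c\<^sub>0 W \<gamma>" and ab: "0 \<le> a" "a \<le> b" "b \<le> 1" and e: "e > 0"
  shows "speed \<gamma> integrable_on {a..b} \<and> (\<exists>xs\<in>lists W. \<exists>\<zeta>\<in>Z. \<gamma> b = \<gamma> a \<cdot> \<Phi> (lprod xs + \<zeta>) \<and>
      plen xs \<le> integral {a..b} (speed \<gamma>) \<and> norm \<zeta> \<le> e * integral {a..b} (speed \<gamma>))"
proof -
  define P where "P a b \<longleftrightarrow> (0 \<le> a \<and> b \<le> 1 \<longrightarrow> speed \<gamma> integrable_on {a..b} \<and> (\<exists>xs\<in>lists W. \<exists>\<zeta>\<in>Z. \<gamma> b = \<gamma> a \<cdot> \<Phi> (lprod xs + \<zeta>) \<and>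
      plen xs \<le> integral {a..b} (speed \<gamma>) \<and> norm \<zeta> \<le> e * integral {a..b} (speed \<gamma>)))" for a b
  have "P a b" using ab(2)
  proof (induction rule: Bolzano)
    case (trans x y z)
    show ?case unfolding P_def
    proof
      assume xz: "0 \<le> x \<and> z \<le> 1"
      then have xy: "0 \<le> x \<and> y \<le> 1" and yz: "0 \<le> y \<and> z \<le> 1" using trans(3,4) by auto
      obtain xs \<zeta> where 1: "speed \<gamma> integrable_on {x..y}" "xs \<in> lists W" "\<zeta> \<in> Z" "\<gamma> y = \<gamma> x \<cdot> \<Phi> (lprod xs + \<zeta>)"
        "plen xs \<le> integral {x..y} (speed \<gamma>)" "norm \<zeta> \<le> e * integral {x..y} (speed \<gamma>)"
        using trans(1)[unfolded P_def, rule_format, OF xy] by blast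
      obtain ys \<xi> where 2: "speed \<gamma> integrable_on {y..z}" "ys \<in> lists W" "\<xi> \<in> Z" "\<gamma> z = \<gamma> y \<cdot> \<Phi> (lprod ys + \<xi>)"
        "plen ys \<le> integral {y..z} (speed \<gamma>)" "norm \<xi> \<le> e * integral {y..z} (speed \<gamma>)"
        using trans(2)[unfolded P_def, rule_format, OF yz] by blast
      have int: "speed \<gamma> integrable_on {x..z}"
        by (rule Henstock_Kurzweil_Integration.integrable_combine[OF trans(3,4) 1(1) 2(1)])
      have sum: "integral {x..z} (speed \<gamma>) = integral {x..y} (speed \<gamma>) + integral {y..z} (speed \<gamma>)"
        by (rule Henstock_Kurzweil_Integration.integral_combine[OF trans(3,4) int, symmetric])
      have "\<gamma> z = \<gamma> x \<cdot> \<Phi> ((lprod xs + \<zeta>) \<odot> (lprod ys + \<xi>))"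
        unfolding 2(4) 1(4) \<Phi>_mult gr.assoc ..
      also have "(lprod xs + \<zeta>) \<odot> (lprod ys + \<xi>) = lprod (xs @ ys) + (\<zeta> + \<xi>)"
        by (simp add: bch_Z(1)[OF 1(3)] bch_Z(2)[OF 2(3)] lprod_append)
      finally have "\<gamma> z = \<gamma> x \<cdot> \<Phi> (lprod (xs @ ys) + (\<zeta> + \<xi>))" .
      moreover have "\<zeta> + \<xi> \<in> Z" using 1 2 Z_subspace by (simp add: subspace_add)
      moreover have "xs @ ys \<in> lists W" using 1 2 by simp
      moreover have "plen (xs @ ys) \<le> integral {x..z} (speed \<gamma>)" using 1 2 sum by simp
      moreover have "norm (\<zeta> + \<xi>) \<le> e * integral {x..z} (speed \<gamma>)"
        using norm_triangle_ineq[of \<zeta> \<xi>] 1(6) 2(6) unfolding sum by (simp add: distrib_left)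
      ultimately show "speed \<gamma> integrable_on {x..z} \<and> (\<exists>xs\<in>lists W. \<exists>\<zeta>\<in>Z. \<gamma> z = \<gamma> x \<cdot> \<Phi> (lprod xs + \<zeta>) \<and>
          plen xs \<le> integral {x..z} (speed \<gamma>) \<and> norm \<zeta> \<le> e * integral {x..z} (speed \<gamma>))"
        using int by blast
    qed
  next
    case (local t)
    have t: "t \<in> {0..1}" using local ab by auto
    obtain d where d: "d > 0" "\<forall>a b. 0 \<le> a \<and> a \<le> t \<and> t \<le> b \<and> b \<le> 1 \<and> b - a < d \<longrightarrow>
      speed \<gamma> integrable_on {a..b} \<and> (\<exists>w\<in>W. \<exists>\<zeta>\<in>Z. \<gamma> b = \<gamma> a \<cdot> \<Phi> (w + \<zeta>) \<and>
      nrm w \<le> integral {a..b} (speed \<gamma>) \<and> norm \<zeta> \<le> e * integral {a..b} (speed \<gamma>))"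
      using curve_polygon_local[OF W \<gamma> t e] by (elim exE conjE) (rule that)
    have "P a b" if "a \<le> t \<and> t \<le> b \<and> b - a < d" for a b
      unfolding P_def
    proof
      assume "0 \<le> a \<and> b \<le> 1"
      then have *: "0 \<le> a \<and> a \<le> t \<and> t \<le> b \<and> b \<le> 1 \<and> b - a < d" using that by simp
      obtain w \<zeta> where w: "speed \<gamma> integrable_on {a..b}" "w \<in> W" "\<zeta> \<in> Z" "\<gamma> b = \<gamma> a \<cdot> \<Phi> (w + \<zeta>)"
        "nrm w \<le> integral {a..b} (speed \<gamma>)" "norm \<zeta> \<le> e * integral {a..b} (speed \<gamma>)"
        using d(2)[rule_format, OF *] by blast
      show "speed \<gamma> integrable_on {a..b} \<and> (\<exists>xs\<in>lists W. \<exists>\<zeta>\<in>Z. \<gamma> b = \<gamma> a \<cdot> \<Phi> (lprod xs + \<zeta>) \<and>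
          plen xs \<le> integral {a..b} (speed \<gamma>) \<and> norm \<zeta> \<le> e * integral {a..b} (speed \<gamma>))"
        using w by (intro conjI bexI[of _ "[w]"] bexI[of _ \<zeta>]) auto
    qed
    then show ?case using d(1) by blast
  qed
  then show ?thesis using ab by (simp add: P_def)
qed

end

section \<open>The sub-Riemannian distance as an infimum over polygons\<close>

context lie_exponential
begin

text \<open>The exponential map at \<open>q\<close> covers a neighbourhood of \<open>q\<close> by arbitrarily short vectors.\<close>

lemma exp_neighbourhood:
  assumes e: "e > 0"
  shows "\<exists>Q. open Q \<and> q \<in> Q \<and> (\<forall>p\<in>Q. \<exists>u. norm u < e \<and> p = q \<cdot> \<Phi> u)"
proof -
  obtain c where c: "c \<in> atlas G" "q \<in> fst c" using charts_cover .
  obtain r L where r: "r > 0" "L-lipschitz_on (ball (snd c q) r) (chart_log c q)"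
    "\<And>z. z \<in> ball (snd c q) r \<Longrightarrow> z \<in> translation_dom c c\<^sub>0 (ginv G q) \<and> translation c c\<^sub>0 (ginv G q) z \<in> \<U>"
    using chart_log_regular[OF c] by blast
  have h0: "chart_log c q (snd c q) = 0" using chart_log_\<Phi>[OF c(1), of q 0] c s by simp
  have "continuous_on (ball (snd c q) r) (chart_log c q)" using r(2) by (rule lipschitz_on_continuous_on)
  then have "isCont (chart_log c q) (snd c q)" using r(1) by (simp add: continuous_on_eq_continuous_at)
  then obtain r' where r': "r' > 0" "\<And>z. dist z (snd c q) < r' \<Longrightarrow> dist (chart_log c q z) (chart_log c q (snd c q)) < min e s"
    using e s(1) unfolding continuous_at_eps_delta by (metis min_less_iff_conj)
  define Q where "Q = fst c \<inter> snd c -` ball (snd c q) (min r r')"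
  have "open Q" unfolding Q_def using chart_facts(1,6)[OF c(1)] by (simp add: continuous_open_preimage)
  moreover have "q \<in> Q" using c r r' by (simp add: Q_def)
  moreover have "\<exists>u. norm u < e \<and> p = q \<cdot> \<Phi> u" if p: "p \<in> Q" for p
  proof -
    have p': "p \<in> fst c" "snd c p \<in> ball (snd c q) r" "dist (snd c p) (snd c q) < r'"
      using p by (auto simp: Q_def dist_commute)
    have "norm (chart_log c q (snd c p)) < min e s" using r'(2)[OF p'(3)] h0 by simp
    moreover then have "q \<cdot> \<Phi> (chart_log c q (snd c p)) = p"
      using chart_log_exp[OF c p'(1)] r(3)[OF p'(2)] by simp
    ultimately show ?thesis by (intro exI[of _ "chart_log c q (snd c p)"]) simp
  qed
  ultimately show ?thesis by blast
qed

end

context sub_riem_group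
begin

text \<open>The infimum over the preimages under \<open>\<Phi>\<close> makes the definition meaningful whether or not \<open>\<Phi>\<close> is
injective.\<close>

definition group_dist :: "'e set \<Rightarrow> 'g \<Rightarrow> 'g \<Rightarrow> real" where
  "group_dist W p q = Inf {polygon_norm W y | y. q = p \<cdot> \<Phi> y}"

lemma group_dist_le: "admissible W \<Longrightarrow> q = p \<cdot> \<Phi> y \<Longrightarrow> group_dist W p q \<le> polygon_norm W y"
  unfolding group_dist_def by (rule cInf_lower) (auto intro!: bdd_belowI[of _ 0] polygon_norm_nonneg)

lemma exp_reaches: "\<exists>y. q = p \<cdot> \<Phi> y"
proof -
  obtain y where "\<Phi> y = ginv G p \<cdot> q" using \<Phi>_surj by (metis surjD)
  then show ?thesis by (intro exI[of _ y]) simp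
qed

lemma le_group_dist:
  assumes "\<And>y. q = p \<cdot> \<Phi> y \<Longrightarrow> c \<le> polygon_norm W y" shows "c \<le> group_dist W p q"
  unfolding group_dist_def by (rule cInf_greatest) (use exp_reaches[of q p] assms in auto)

lemma group_dist_approx:
  assumes "e > 0" shows "\<exists>y. q = p \<cdot> \<Phi> y \<and> polygon_norm W y < group_dist W p q + e"
proof (rule ccontr)
  assume contr: "\<not> ?thesis"
  have "group_dist W p q + e \<le> group_dist W p q"
  proof (rule le_group_dist)
    fix y assume "q = p \<cdot> \<Phi> y"
    then have "\<not> polygon_norm W y < group_dist W p q + e" using contr by blast
    then show "group_dist W p q + e \<le> polygon_norm W y" by simp
  qed
  then show False using assms by simp
qed

lemma group_dist_proper_length_distance:
  assumes W: "admissible W"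
  shows "proper_length_distance (group_dist W) (gone G)"
proof
  have nonneg: "0 \<le> group_dist W x y" for x y by (rule le_group_dist) (rule polygon_norm_nonneg[OF W])
  show "group_dist W x x = 0" for x
    using group_dist_le[OF W, of x x 0] nonneg[of x x] by (simp add: polygon_norm_zero[OF W])
  have sym_le: "group_dist W y x \<le> group_dist W x y" for x y
  proof (rule le_group_dist)
    fix u assume "y = x \<cdot> \<Phi> u"
    then have "x = y \<cdot> \<Phi> (- u)" by (simp add: \<Phi>_minus gr.assoc)
    from group_dist_le[OF W this] show "group_dist W y x \<le> polygon_norm W u" by (simp add: polygon_norm_minus[OF W])
  qed
  show sym: "group_dist W x y = group_dist W y x" for x y using sym_le[of x y] sym_le[of y x] by simp
  show triangle: "group_dist W x z \<le> group_dist W x y + group_dist W y z" for x y z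
  proof (rule field_le_epsilon)
    fix e :: real assume "e > 0"
    then have e: "e / 2 > 0" by simp
    obtain u where u: "y = x \<cdot> \<Phi> u" "polygon_norm W u < group_dist W x y + e / 2" using group_dist_approx[OF e] by blast
    obtain v where v: "z = y \<cdot> \<Phi> v" "polygon_norm W v < group_dist W y z + e / 2" using group_dist_approx[OF e] by blast
    have "z = x \<cdot> \<Phi> (u \<odot> v)" by (simp add: u(1) v(1) \<Phi>_mult gr.assoc)
    from group_dist_le[OF W this] show "group_dist W x z \<le> group_dist W x y + group_dist W y z + e"
      using polygon_norm_triangle[OF W, of u v] u(2) v(2) by linarith
  qed
  show "continuous_on UNIV (group_dist W x)" for x
    unfolding continuous_on_def
  proof (intro ballI tendstoI)
    fix q and e :: real assume e: "e > 0"
    obtain \<delta> where \<delta>: "\<delta> > 0" "\<And>y. norm y < \<delta> \<Longrightarrow> polygon_norm W y < e" by (rule polygon_norm_small[OF W e], rule that)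
    obtain Q where Q: "open Q" "q \<in> Q" "\<And>p. p \<in> Q \<Longrightarrow> \<exists>u. norm u < \<delta> \<and> p = q \<cdot> \<Phi> u"
      using exp_neighbourhood[OF \<delta>(1), of q] by blast
    have "dist (group_dist W x p) (group_dist W x q) < e" if p: "p \<in> Q" for p
    proof -
      obtain u where u: "norm u < \<delta>" "p = q \<cdot> \<Phi> u" using Q(3)[OF p] by blast
      have "group_dist W q p < e" using group_dist_le[OF W u(2)] \<delta>(2)[OF u(1)] by linarith
      then show ?thesis using triangle[of x p q] triangle[of x q p] sym[of p q] by (simp add: dist_real_def)
    qed
    then show "\<forall>\<^sub>F p in at q within UNIV. dist (group_dist W x p) (group_dist W x q) < e"
      using Q(1,2) by (auto simp: eventually_at_topological)
  qed
  show "\<exists>K. compact K \<and> {x. group_dist W (gone G) x \<le> R} \<subseteq> K" for R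
  proof -
    obtain A where A: "A \<ge> 0" "\<And>W y. admissible W \<Longrightarrow> norm y \<le> A * (polygon_norm W y + 1) + A * (polygon_norm W y + 1)\<^sup>2"
      by (rule polygon_norm_coercive, rule that)
    define R' where "R' = A * (R + 2) + A * (R + 2)\<^sup>2"
    have "compact (\<Phi> ` cball 0 R')"
      by (intro compact_continuous_image continuous_on_subset[OF \<Phi>_continuous]) auto
    moreover have "x \<in> \<Phi> ` cball 0 R'" if x: "group_dist W (gone G) x \<le> R" for x
    proof -
      obtain y where y: "x = gone G \<cdot> \<Phi> y" "polygon_norm W y < group_dist W (gone G) x + 1" using group_dist_approx[OF zero_less_one] by blast
      have n: "0 \<le> polygon_norm W y" "polygon_norm W y + 1 \<le> R + 2" using polygon_norm_nonneg[OF W] y(2) x by auto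
      have "norm y \<le> A * (polygon_norm W y + 1) + A * (polygon_norm W y + 1)\<^sup>2" by (rule A(2)[OF W])
      also have "\<dots> \<le> R'" unfolding R'_def using n(1)
        by (intro add_mono mult_left_mono[OF n(2) A(1)] mult_left_mono[OF power_mono[OF n(2)] A(1)]) simp
      finally show ?thesis using y(1) by auto
    qed
    ultimately show ?thesis by blast
  qed
  show "\<exists>z. group_dist W x z \<le> t \<and> group_dist W z y \<le> group_dist W x y - t + \<epsilon>" if t: "0 \<le> t" "t \<le> group_dist W x y" "\<epsilon> > 0" for t x y \<epsilon>
  proof -
    have e: "\<epsilon> / 2 > 0" using t by simp
    obtain v where v: "y = x \<cdot> \<Phi> v" "polygon_norm W v < group_dist W x y + \<epsilon> / 2" using group_dist_approx[OF e] by blast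
    have "t \<le> polygon_norm W v" using t(2) group_dist_le[OF W v(1)] by linarith
    then obtain u where u: "polygon_norm W u \<le> t" "polygon_norm W (- u \<odot> v) \<le> polygon_norm W v - t + \<epsilon> / 2"
      using polygon_norm_split[OF W t(1) _ e] by blast
    have "y = (x \<cdot> \<Phi> u) \<cdot> \<Phi> (- u \<odot> v)" by (simp add: v(1) gr.assoc flip: \<Phi>_mult)
    from group_dist_le[OF W this] group_dist_le[OF W refl, of x u] show ?thesis using u v(2)
      by (intro exI[of _ "x \<cdot> \<Phi> u"]) linarith
  qed
qed

lemma group_dist_\<Delta>_le_group_dist_V: "group_dist \<Delta> p q \<le> group_dist V p q"
proof (rule le_group_dist)
  fix y assume "q = p \<cdot> \<Phi> y"
  from group_dist_le[OF admissible_\<Delta> this] show "group_dist \<Delta> p q \<le> polygon_norm V y"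
    using polygon_norm_antimono[OF admissible_V admissible_\<Delta> V_subset, of y] by linarith
qed

lemma group_dist_nonneg: "admissible W \<Longrightarrow> 0 \<le> group_dist W p q"
  by (rule le_group_dist) (rule polygon_norm_nonneg)

lemma group_dist_squares_close:
  obtains C where "\<And>p q. \<bar>(group_dist \<Delta> p q)\<^sup>2 - (group_dist V p q)\<^sup>2\<bar> \<le> C"
proof -
  obtain C where C: "\<And>y. (polygon_norm V y)\<^sup>2 \<le> (polygon_norm \<Delta> y)\<^sup>2 + C" by (rule polygon_norm_V_le_\<Delta>, rule that)
  have "\<bar>(group_dist \<Delta> p q)\<^sup>2 - (group_dist V p q)\<^sup>2\<bar> \<le> C" for p q
  proof -
    have "sqrt ((group_dist V p q)\<^sup>2 - C) \<le> group_dist \<Delta> p q"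
    proof (rule le_group_dist)
      fix y assume y: "q = p \<cdot> \<Phi> y"
      have "(group_dist V p q)\<^sup>2 \<le> (polygon_norm V y)\<^sup>2"
        using group_dist_le[OF admissible_V y] group_dist_nonneg[OF admissible_V] by (intro power_mono) auto
      then have "(group_dist V p q)\<^sup>2 - C \<le> (polygon_norm \<Delta> y)\<^sup>2" using C[of y] by linarith
      then show "sqrt ((group_dist V p q)\<^sup>2 - C) \<le> polygon_norm \<Delta> y"
        using polygon_norm_nonneg[OF admissible_\<Delta>] by (intro real_le_lsqrt) auto
    qed
    then have "(group_dist V p q)\<^sup>2 - C \<le> (group_dist \<Delta> p q)\<^sup>2" by (rule sqrt_le_D)
    moreover have "(group_dist \<Delta> p q)\<^sup>2 \<le> (group_dist V p q)\<^sup>2"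
      using group_dist_\<Delta>_le_group_dist_V group_dist_nonneg[OF admissible_\<Delta>] by (intro power_mono) auto
    ultimately show ?thesis by simp
  qed
  then show ?thesis by (rule that)
qed

lemma speed_integral_nonneg:
  assumes "admissible W" "horizontal G c\<^sub>0 W \<gamma>" "0 \<le> a" "a \<le> b" "b \<le> 1"
  shows "0 \<le> integral {a..b} (speed \<gamma>)"
  using curve_polygon[OF assms zero_less_one] plen_nonneg order_trans by blast

text \<open>The polygons that approximate the curve miss its endpoint by a central element of arbitrarily small
size, and by \<open>polygon_norm_correction\<close> the price for this tends to zero.\<close>

lemma group_dist_le_curve_length:
  assumes W: "admissible W" and \<gamma>: "horizontal G c\<^sub>0 W \<gamma>" and ab: "0 \<le> a" "a \<le> b" "b \<le> 1"
  shows "group_dist W (\<gamma> a) (\<gamma> b) \<le> curve_length G c\<^sub>0 \<rho> \<gamma>"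
proof -
  define l where "l = integral {a..b} (speed \<gamma>)"
  have l0: "0 \<le> l" unfolding l_def by (rule speed_integral_nonneg[OF W \<gamma> ab])
  have "l \<le> curve_length G c\<^sub>0 \<rho> \<gamma>"
  proof -
    have int: "speed \<gamma> integrable_on {0..1}" "speed \<gamma> integrable_on {0..b}"
      using curve_polygon[OF W \<gamma> _ _ _ zero_less_one] ab by auto
    have "integral {0..1} (speed \<gamma>) = (integral {0..a} (speed \<gamma>) + l) + integral {b..1} (speed \<gamma>)"
      unfolding l_def
      using Henstock_Kurzweil_Integration.integral_combine[of 0 b 1, OF _ ab(3) int(1)]
        Henstock_Kurzweil_Integration.integral_combine[of 0 a b, OF ab(1,2) int(2)] ab by simp
    then show ?thesis
      using speed_integral_nonneg[OF W \<gamma>, of 0 a] speed_integral_nonneg[OF W \<gamma>, of b 1] ab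
      by (simp add: curve_length_eq)
  qed
  moreover have "group_dist W (\<gamma> a) (\<gamma> b) \<le> l"
  proof (rule power2_le_imp_le[OF field_le_epsilon l0])
    fix e :: real assume e: "e > 0"
    obtain C where C: "C \<ge> 0" "\<And>W xs \<zeta>. admissible W \<Longrightarrow> xs \<in> lists W \<Longrightarrow> \<zeta> \<in> Z \<Longrightarrow>
      (polygon_norm W (lprod xs + \<zeta>))\<^sup>2 \<le> (plen xs)\<^sup>2 + C * norm \<zeta>" by (rule polygon_norm_correction, rule that)
    \<comment> \<open>the length \<open>l\<close> may be zero\<close>
    define e' where "e' = e / (C * l + 1)"
    have p: "C * l + 1 > 0" using C(1) l0 by (simp add: add_nonneg_pos)
    have e': "e' > 0" "C * (e' * l) \<le> e"
    proof -
      show "e' > 0" using e p by (simp add: e'_def)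
      have "e * (C * l) \<le> e * (C * l + 1)" using e by simp
      then show "C * (e' * l) \<le> e" using p by (simp add: e'_def divide_le_eq mult_ac)
    qed
    obtain xs \<zeta> where x: "xs \<in> lists W" "\<zeta> \<in> Z" "\<gamma> b = \<gamma> a \<cdot> \<Phi> (lprod xs + \<zeta>)" "plen xs \<le> l" "norm \<zeta> \<le> e' * l"
      using curve_polygon[OF W \<gamma> ab e'(1)] unfolding l_def by blast
    have "(group_dist W (\<gamma> a) (\<gamma> b))\<^sup>2 \<le> (polygon_norm W (lprod xs + \<zeta>))\<^sup>2"
      using group_dist_le[OF W x(3)] group_dist_nonneg[OF W] by (intro power_mono) auto
    also have "\<dots> \<le> (plen xs)\<^sup>2 + C * norm \<zeta>" by (rule C(2)[OF W x(1,2)])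
    also have "\<dots> \<le> l\<^sup>2 + C * (e' * l)" using x C(1) by (intro add_mono power_mono mult_left_mono) auto
    also have "\<dots> \<le> l\<^sup>2 + e" using e'(2) by simp
    finally show "(group_dist W (\<gamma> a) (\<gamma> b))\<^sup>2 \<le> l\<^sup>2 + e" .
  qed
  ultimately show ?thesis by linarith
qed

theorem sub_riemannian_dist_eq:
  assumes W: "admissible W"
  shows "sub_riemannian_dist G c\<^sub>0 W \<rho> p q = group_dist W p q"
proof -
  interpret pld: proper_length_distance "group_dist W" "gone G" by (rule group_dist_proper_length_distance[OF W])
  let ?S = "{curve_length G c\<^sub>0 \<rho> \<gamma> | \<gamma>. horizontal G c\<^sub>0 W \<gamma> \<and> p \<in> \<gamma> ` {0..1} \<and> q \<in> \<gamma> ` {0..1}}"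
  have lower: "group_dist W p q \<le> l" if l: "l \<in> ?S" for l
  proof -
    obtain \<gamma> a b where g: "l = curve_length G c\<^sub>0 \<rho> \<gamma>" "horizontal G c\<^sub>0 W \<gamma>" "a \<in> {0..1}" "b \<in> {0..1}" "p = \<gamma> a" "q = \<gamma> b"
      using l by blast
    show ?thesis
    proof (cases "a \<le> b")
      case True
      then show ?thesis using group_dist_le_curve_length[OF W g(2), of a b] g by simp
    next
      case False
      then show ?thesis using group_dist_le_curve_length[OF W g(2), of b a] g pld.sym[of p q] by simp
    qed
  qed
  have mem: "plen xs \<in> ?S" if xs: "xs \<in> lists W" "q = p \<cdot> \<Phi> (lprod xs)" for xs
  proof -
    obtain \<gamma> where g: "horizontal G c\<^sub>0 W \<gamma>" "\<gamma> 0 = p" "\<gamma> 1 = q" "curve_length G c\<^sub>0 \<rho> \<gamma> = plen xs"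
      using polygon_curve[OF W xs(1), of p] xs(2) by blast
    have "p \<in> \<gamma> ` {0..1}" "q \<in> \<gamma> ` {0..1}" using g(2,3) by (auto intro!: image_eqI)
    then show ?thesis using g(1) by (intro CollectI exI[of _ \<gamma>] conjI g(4)[symmetric])
  qed
  have bdd: "bdd_below ?S" using lower by (rule bdd_belowI)
  have "Inf ?S \<le> group_dist W p q"
  proof (rule le_group_dist)
    fix y assume y: "q = p \<cdot> \<Phi> y"
    show "Inf ?S \<le> polygon_norm W y"
      by (rule le_polygon_norm[OF W]) (use mem y bdd in \<open>auto intro!: cInf_lower\<close>)
  qed
  moreover have "group_dist W p q \<le> Inf ?S"
  proof (rule cInf_greatest)
    obtain y where y: "q = p \<cdot> \<Phi> y" using exp_reaches by blast
    obtain xs where "xs \<in> lists W" "lprod xs = y" using polygon_exists[OF W] by blast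
    then show "?S \<noteq> {}" using mem[of xs] y by blast
  qed (rule lower)
  ultimately show ?thesis unfolding sub_riemannian_dist_def by linarith
qed

lemma asymptotic_fibre_eq: "asymptotic_fibre G c\<^sub>0 \<Delta> \<rho> = V"
  unfolding asymptotic_fibre_def V_def Z_eq_bracket_space[symmetric] using r_eq by auto

theorem horoboundaries_coincide:
  "horoboundary (gone G) (sub_riemannian_dist G c\<^sub>0 \<Delta> \<rho>) = horoboundary (gone G) (asymptotic_dist G c\<^sub>0 \<Delta> \<rho>)"
proof -
  obtain C where C: "\<And>p q. \<bar>(group_dist \<Delta> p q)\<^sup>2 - (group_dist V p q)\<^sup>2\<bar> \<le> C" by (rule group_dist_squares_close, rule that)
  have "sub_riemannian_dist G c\<^sub>0 \<Delta> \<rho> = group_dist \<Delta>" "asymptotic_dist G c\<^sub>0 \<Delta> \<rho> = group_dist V"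
    unfolding asymptotic_dist_def asymptotic_fibre_eq
    using sub_riemannian_dist_eq[OF admissible_\<Delta>] sub_riemannian_dist_eq[OF admissible_V] by blast+
  then show ?thesis
    using horoboundary_eq[OF group_dist_proper_length_distance[OF admissible_\<Delta>] group_dist_proper_length_distance[OF admissible_V] C]
    by simp
qed

end

section \<open>The theorem\<close>

text \<open>The metric is extended by composing it with a linear projection onto \<open>\<Delta>\<close>. In step two
\<open>\<Delta> + [\<gg>, \<gg>]\<close> is a subalgebra, so it is everything if \<open>\<Delta>\<close> generates.\<close>

lemma (in two_step_lie_chart) sub_riem_model_exists:
  assumes "sub_riemannian_structure G c\<^sub>0 \<Delta> \<rho>"
  shows "\<exists>r. sub_riem_model (lie_bracket G c\<^sub>0) r \<Delta> \<and> (\<forall>u\<in>\<Delta>. \<forall>v\<in>\<Delta>. r u v = \<rho> u v)"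
proof -
  have S: "subspace \<Delta>" and hull: "lie_subalgebra G c\<^sub>0 hull \<Delta> = UNIV" and ip: "inner_product_on \<Delta> \<rho>"
    using assms by (auto simp: sub_riemannian_structure_def)
  have \<rho>sym: "\<rho> u v = \<rho> v u" if "u \<in> \<Delta>" "v \<in> \<Delta>" for u v using ip that unfolding inner_product_on_def by blast
  have \<rho>lin: "\<rho> (a *\<^sub>R u + b *\<^sub>R v) w = a * \<rho> u w + b * \<rho> v w" if "u \<in> \<Delta>" "v \<in> \<Delta>" "w \<in> \<Delta>" for a b u v w
    using ip that unfolding inner_product_on_def by blast
  have \<rho>pos: "\<rho> u u > 0" if "u \<in> \<Delta>" "u \<noteq> 0" for u using ip that unfolding inner_product_on_def by blast
  have \<rho>add: "\<rho> (u + v) w = \<rho> u w + \<rho> v w" if "u \<in> \<Delta>" "v \<in> \<Delta>" "w \<in> \<Delta>" for u v w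
    using \<rho>lin[OF that, of 1 1] by simp
  have \<rho>scale: "\<rho> (c *\<^sub>R u) w = c * \<rho> u w" if "u \<in> \<Delta>" "w \<in> \<Delta>" for c u w
    using \<rho>lin[OF that(1) that(1) that(2), of c 0] by simp
  obtain P where P: "linear P" "\<And>z. z \<in> \<Delta> \<Longrightarrow> P z = 0" "\<And>x. x - P x \<in> \<Delta>"
    using projection_along_subspace[OF S] by blast
  define Q where "Q x = x - P x" for x
  have Q: "Q x \<in> \<Delta>" "x \<in> \<Delta> \<Longrightarrow> Q x = x" for x using P(2,3) by (auto simp: Q_def)
  have Qlin: "Q (x + y) = Q x + Q y" "Q (c *\<^sub>R x) = c *\<^sub>R Q x" for x y c
    using P(1) by (simp_all add: Q_def linear_add linear_cmul scaleR_diff_right)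
  define r where "r x y = \<rho> (Q x) (Q y)" for x y
  have rsym: "r x y = r y x" for x y unfolding r_def by (rule \<rho>sym[OF Q(1) Q(1)])
  have rlin: "linear (\<lambda>x. r x y)" for y
    by (rule linearI) (simp_all add: r_def Qlin \<rho>add \<rho>scale Q(1))
  have "bilinear r" unfolding bilinear_def using rlin by (simp add: rsym[of x for x])
  have model: "sub_riem_model (lie_bracket G c\<^sub>0) r \<Delta>"
  proof (intro sub_riem_model.intro sub_riem_model_axioms.intro)
    show "two_step_bracket br" by unfold_locales
    show "bounded_bilinear r" using \<open>bilinear r\<close> by (simp add: bilinear_conv_bounded_bilinear)
    show "r x y = r y x" for x y by (rule rsym)
    show "0 \<le> r x x" for x
      using \<rho>pos[OF Q(1), of x] \<rho>scale[OF Q(1) Q(1), of 0 x x] by (cases "Q x = 0") (auto simp: r_def less_imp_le)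
    show "subspace \<Delta>" by (rule S)
    show "0 < r x x" if "x \<in> \<Delta>" "x \<noteq> 0" for x using \<rho>pos that Q(2) by (simp add: r_def)
    show "\<exists>u\<in>\<Delta>. \<exists>z\<in>Z. x = u + z" for x
    proof -
      define H where "H = {u + z | u z. u \<in> \<Delta> \<and> z \<in> Z}"
      have "lie_subalgebra G c\<^sub>0 H"
        unfolding lie_subalgebra_def
      proof (intro conjI ballI)
        show "subspace H" unfolding H_def by (rule subspace_sums[OF S Z_subspace])
        fix u v
        have "br u v = 0 + br u v" by simp
        then show "br u v \<in> H" unfolding H_def using subspace_0[OF S] br_in_Z by blast
      qed
      moreover have "\<Delta> \<subseteq> H"
      proof
        fix u assume "u \<in> \<Delta>"
        moreover have "u = u + 0" by simp
        ultimately show "u \<in> H" unfolding H_def using subspace_0[OF Z_subspace] by blast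
      qed
      ultimately have "lie_subalgebra G c\<^sub>0 hull \<Delta> \<subseteq> H" by (intro hull_minimal)
      then show ?thesis using hull unfolding H_def by blast
    qed
  qed
  have "r u v = \<rho> u v" if "u \<in> \<Delta>" "v \<in> \<Delta>" for u v using that by (simp add: r_def Q(2))
  then show ?thesis using model by blast
qed

text \<open>Two points are joined by the track of a homotopy between the constant loops at these points.\<close>

lemma simply_connected_imp_connected_UNIV:
  assumes "simply_connected (UNIV :: 'a::topological_space set)"
  shows "connected (UNIV :: 'a set)"
proof -
  have "path_component UNIV p q" for p q :: 'a
  proof -
    have "homotopic_loops UNIV (\<lambda>_. p) (\<lambda>_. q)"
      using assms unfolding simply_connected_def by (simp add: path_def pathstart_def pathfinish_def)
    from homotopic_loops_imp_path_component_value[OF this, of 0] show ?thesis by simp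
  qed
  then show ?thesis by (intro path_connected_imp_connected) (simp add: path_connected_component)
qed

theorem corollary1p3:
  fixes G :: "('g::{t2_space, second_countable_topology}, 'e::euclidean_space) lie_struct"
    and c\<^sub>0 :: "('g, 'e) chart"
    and \<Delta> :: "'e set"
    and \<rho> :: "'e \<Rightarrow> 'e \<Rightarrow> real"
  assumes "lie_group G"
    and "simply_connected (UNIV :: 'g set)"
    and "c\<^sub>0 \<in> atlas G" and "gone G \<in> fst c\<^sub>0"
    and "two_step_nilpotent G c\<^sub>0"
    and "sub_riemannian_structure G c\<^sub>0 \<Delta> \<rho>"
  shows "horoboundary (gone G) (sub_riemannian_dist G c\<^sub>0 \<Delta> \<rho>) =
         horoboundary (gone G) (asymptotic_dist G c\<^sub>0 \<Delta> \<rho>)"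
proof -
  interpret two_step_lie_chart G c\<^sub>0
    using assms by unfold_locales
  obtain r where r: "sub_riem_model (lie_bracket G c\<^sub>0) r \<Delta>" "\<forall>u\<in>\<Delta>. \<forall>v\<in>\<Delta>. r u v = \<rho> u v"
    using sub_riem_model_exists[OF assms(6)] by blast
  obtain \<Phi> F \<psi> U V s where "lie_exponential G c\<^sub>0 \<Phi> F \<psi> U V s"
    using exponential_exists[OF simply_connected_imp_connected_UNIV[OF assms(2)]] by blast
  then interpret sub_riem_group G c\<^sub>0 \<Phi> F \<psi> U V s r \<Delta> \<rho>
    using r by (intro sub_riem_group.intro sub_riem_group_axioms.intro) auto
  show ?thesis by (rule horoboundaries_coincide)
qed

end
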